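(* There exists a graph on nine vertices such that it is not possible to construct a spectral graph drawing based on the Laplacian matrix in a radical computation tree. For this graph there exists a dense subset $A$ of $\mathbf{Q}$ such that it is not possible to construct a spectral graph drawing based on the relaxed Laplacian with $\rho\in A$ in a radical computation tree.
   Context: For a graph $G$: adjacency matrix $A$ ($A_{ij}=1$ iff $ij$ is an edge), degree matrix $D$ (diagonal, $D_{ii}=\deg(v_i)$), Laplacian $L=D-A$, relaxed Laplacian $L-\rho D$ with parameter $\rho$. A spectral graph drawing based on a matrix $M$ takes eigenvectors $u_1,\dots,u_n$ of $M$ ordered by eigenvalue, chooses two of them $u_r,u_s$ with $r\neq s$, and places vertex $i$ at $(u_r[i],u_s[i])$. An algebraic computation tree is a rooted tree whose computation nodes compute a value as the sum, difference, product or quotient of integer constants and values computed at ancestor nodes, and whose decision nodes test whether a computed value is greater than zero and branch. A radical computation tree additionally allows computing the $k$-th root of a previously computed value ($k$ an integer parameter) and complex conjugation. *)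

theory Defs
  imports "HOL-Analysis.Analysis"
begin

definition simple_graph :: "('n \<Rightarrow> 'n \<Rightarrow> bool) \<Rightarrow> bool" where
  "simple_graph E \<longleftrightarrow> (\<forall>x y. E x y = E y x) \<and> (\<forall>x. \<not> E x x)"

definition adjacency_matrix :: "('n::finite \<Rightarrow> 'n \<Rightarrow> bool) \<Rightarrow> real^'n^'n" where
  "adjacency_matrix E = (\<chi> i j. if E i j then 1 else 0)"

definition degree_matrix :: "('n::finite \<Rightarrow> 'n \<Rightarrow> bool) \<Rightarrow> real^'n^'n" where
  "degree_matrix E = (\<chi> i j. if i = j then real (card {k. E i k}) else 0)"

definition laplacian :: "('n::finite \<Rightarrow> 'n \<Rightarrow> bool) \<Rightarrow> real^'n^'n" where
  "laplacian E = degree_matrix E - adjacency_matrix E"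

definition relaxed_laplacian :: "real \<Rightarrow> ('n::finite \<Rightarrow> 'n \<Rightarrow> bool) \<Rightarrow> real^'n^'n" where
  "relaxed_laplacian rho E = laplacian E - rho *\<^sub>R degree_matrix E"

definition spectral_drawing :: "real^'n^'n \<Rightarrow> ('n::finite \<Rightarrow> real \<times> real) \<Rightarrow> bool" where
  "spectral_drawing M p \<longleftrightarrow>
     (\<exists>(u :: nat \<Rightarrow> real^'n) (lam :: nat \<Rightarrow> real) r s.
        (\<forall>i < CARD('n). M *v u i = lam i *s u i) \<and>
        inj_on u {..<CARD('n)} \<and> independent (u ` {..<CARD('n)}) \<and>
        (\<forall>i j. i \<le> j \<and> j < CARD('n) \<longrightarrow> lam i \<le> lam j) \<and>
        r < CARD('n) \<and> s < CARD('n) \<and> r \<noteq> s \<and>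
        (\<forall>v. p v = (u r $ v, u s $ v)))"

text \<open>Values computable (on a fixed input, i.e. along a single path) by a radical computation
  tree: closure of the integer constants under +, -, *, /, complex conjugation and k-th roots
  (every branch of the root is admitted).\<close>
inductive_set radical_computable :: "complex set" where
  int_const: "of_int k \<in> radical_computable"
| add: "x \<in> radical_computable \<Longrightarrow> y \<in> radical_computable \<Longrightarrow> x + y \<in> radical_computable"
| diff: "x \<in> radical_computable \<Longrightarrow> y \<in> radical_computable \<Longrightarrow> x - y \<in> radical_computable"
| mult: "x \<in> radical_computable \<Longrightarrow> y \<in> radical_computable \<Longrightarrow> x * y \<in> radical_computable"
| divide: "x \<in> radical_computable \<Longrightarrow> y \<in> radical_computable \<Longrightarrow> y \<noteq> 0 \<Longrightarrow> x / y \<in> radical_computable"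
| conj: "x \<in> radical_computable \<Longrightarrow> cnj x \<in> radical_computable"
| root: "k > 0 \<Longrightarrow> z ^ k \<in> radical_computable \<Longrightarrow> z \<in> radical_computable"

definition radical_spectral_drawable :: "real^'n^'n \<Rightarrow> bool" where
  "radical_spectral_drawable M \<longleftrightarrow>
     (\<exists>p::'n::finite \<Rightarrow> real \<times> real. spectral_drawing M p \<and>
        (\<forall>v. complex_of_real (fst (p v)) \<in> radical_computable \<and>
             complex_of_real (snd (p v)) \<in> radical_computable))"

end

theory Submission
  imports Defs "Jordan_Normal_Form.Char_Poly" "HOL-Number_Theory.Cong"
begin

text \<open>
  If both coordinates of a drawing are computable by radicals, then so are two distinct eigenvalues,
  and some term of the derived series of the automorphism group of the algebraic numbers fixes both
  of them. The characteristic polynomial of the graph below factors into irreducibles of degrees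
  1, 1, 7 modulo 5 and of degrees 1, 3, 5 modulo 7. Frobenius automorphisms at 5 and 7 thus act on
  its nine roots as a 7-cycle and as a permutation of cycle type 5 + 3 + 1, and no term of the derived
  series of a permutation group containing such elements fixes two points. Only the residues
  modulo 35 matter, so the same holds for \<open>L - \<rho> D\<close> whenever \<open>\<rho> = 35 a / (35 c + 1)\<close>, and these
  numbers are dense.
\<close>

unbundle no m_inv_syntax

section \<open>Relations compatible with ring operations\<close>

text \<open>The all-ones vector makes 0 an eigenvalue of every Laplacian, so one eigenvalue and its
  coordinate can always be computed; what has to be excluded is two of them. For other parameters of
  the family no rational factorisation is known, so the argument cannot start from irreducibility or
  from a named Galois group. It uses only what reduction modulo 5 and 7 reveals, and the bound of at
  most one fixed root holds whether or not a rational root is present. Solvability is expressed by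
  the derived series of all automorphisms of the algebraic numbers, so no radical tower or splitting
  field is built: extracting a root costs two further terms, and conjugation is harmless because
  every term is normal. The price is that automorphisms with prescribed behaviour modulo a prime
  ideal must be constructed, which is the purpose of the extension theory and of the Frobenius
  theorem. Scaling by \<open>35 c + 1\<close> clears the denominator of the parameter without
  changing the matrix modulo 35, and squarefreeness modulo 5 keeps the nine eigenvalues
  distinct.\<close>

text \<open>Subrings, (partial) homomorphisms, congruences and the Frobenius map modulo a prime are all
  instances: a relation with this property is a subring of the product ring. All of them lift to
  polynomials coefficientwise.\<close>

definition ring_rel :: "('a::comm_ring_1 \<Rightarrow> 'b::comm_ring_1 \<Rightarrow> bool) \<Rightarrow> bool" where
  "ring_rel S \<longleftrightarrow> S 1 1 \<and>
     (\<forall>a b c d. S a b \<longrightarrow> S c d \<longrightarrow> S (a - c) (b - d) \<and> S (a * c) (b * d))"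

lemma ring_rel_one: "ring_rel S \<Longrightarrow> S 1 1"
  and ring_rel_diff: "ring_rel S \<Longrightarrow> S a b \<Longrightarrow> S c d \<Longrightarrow> S (a - c) (b - d)"
  and ring_rel_mult: "ring_rel S \<Longrightarrow> S a b \<Longrightarrow> S c d \<Longrightarrow> S (a * c) (b * d)"
  unfolding ring_rel_def by blast+

lemma ring_rel_zero: "ring_rel S \<Longrightarrow> S 0 0"
  using ring_rel_diff[of S 1 1 1 1] ring_rel_one[of S] by simp

lemma ring_rel_uminus: "ring_rel S \<Longrightarrow> S a b \<Longrightarrow> S (- a) (- b)"
  using ring_rel_diff[of S 0 0 a b] ring_rel_zero[of S] by simp

lemma ring_rel_add: "ring_rel S \<Longrightarrow> S a b \<Longrightarrow> S c d \<Longrightarrow> S (a + c) (b + d)"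
  using ring_rel_diff[of S a b "- c" "- d"] ring_rel_uminus[of S c d] by simp

lemma ring_rel_sum:
  assumes "ring_rel S" "\<And>i. i \<in> I \<Longrightarrow> S (f i) (g i)"
  shows "S (sum f I) (sum g I)"
  using assms(2)
  by (induction I rule: infinite_finite_induct)
     (auto intro: ring_rel_zero[OF assms(1)] ring_rel_add[OF assms(1)])

lemma ring_rel_prod:
  assumes "ring_rel S" "\<And>i. i \<in> I \<Longrightarrow> S (f i) (g i)"
  shows "S (prod f I) (prod g I)"
  using assms(2)
  by (induction I rule: infinite_finite_induct)
     (auto intro: ring_rel_one[OF assms(1)] ring_rel_mult[OF assms(1)])

lemma ring_rel_power: "ring_rel S \<Longrightarrow> S a b \<Longrightarrow> S (a ^ n) (b ^ n)"
  by (induction n) (auto intro: ring_rel_one ring_rel_mult)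

lemma ring_rel_of_nat: "ring_rel S \<Longrightarrow> S (of_nat n) (of_nat n)"
  by (induction n) (auto intro: ring_rel_zero ring_rel_one ring_rel_add)

lemma ring_rel_of_int: "ring_rel S \<Longrightarrow> S (of_int n) (of_int n)"
  by (cases n) (auto intro: ring_rel_of_nat ring_rel_uminus simp del: of_nat_Suc)

lemma ring_rel_conversep: "ring_rel S \<Longrightarrow> ring_rel S\<inverse>\<inverse>"
  unfolding ring_rel_def by auto

section \<open>Coefficientwise extension of relations to polynomials\<close>

definition poly_rel :: "('a::comm_ring_1 \<Rightarrow> 'b::comm_ring_1 \<Rightarrow> bool) \<Rightarrow> 'a poly \<Rightarrow> 'b poly \<Rightarrow> bool"
  where "poly_rel S p q \<longleftrightarrow> (\<forall>i. S (coeff p i) (coeff q i))"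

lemma ring_rel_poly_rel: "ring_rel S \<Longrightarrow> ring_rel (poly_rel S)"
  unfolding ring_rel_def[of "poly_rel S"] poly_rel_def coeff_mult coeff_diff
  by (auto simp: coeff_1 intro: ring_rel_one ring_rel_zero ring_rel_diff ring_rel_sum ring_rel_mult)

lemma poly_rel_pCons:
  "poly_rel S (pCons a p) (pCons b q) \<longleftrightarrow> S a b \<and> poly_rel S p q"
  by (auto simp: poly_rel_def coeff_pCons split: nat.splits)

lemma poly_rel_0: "ring_rel S \<Longrightarrow> poly_rel S 0 0"
  by (simp add: poly_rel_def ring_rel_zero)

lemma poly_rel_const: "ring_rel S \<Longrightarrow> S a b \<Longrightarrow> poly_rel S [:a:] [:b:]"
  by (simp add: poly_rel_pCons poly_rel_0)

lemma poly_rel_monom: "ring_rel S \<Longrightarrow> S a b \<Longrightarrow> poly_rel S (monom a n) (monom b n)"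
  by (auto simp: poly_rel_def ring_rel_zero)

lemma poly_rel_of_int: "ring_rel S \<Longrightarrow> poly_rel S (of_int_poly p) (of_int_poly p)"
  by (auto simp: poly_rel_def coeff_map_poly intro: ring_rel_of_int)

lemma poly_eq_sum_le:
  fixes p :: "'a::comm_ring_1 poly"
  shows "degree p \<le> n \<Longrightarrow> poly p x = (\<Sum>i\<le>n. coeff p i * x ^ i)"
  unfolding poly_altdef[of p]
  by (rule sum.mono_neutral_left) (auto simp: not_le coeff_eq_0)

lemma poly_rel_eval:
  assumes "ring_rel S" "poly_rel S p q" "S a b"
  shows "S (poly p a) (poly q b)"
proof -
  define n where "n = max (degree p) (degree q)"
  have "S (\<Sum>i\<le>n. coeff p i * a ^ i) (\<Sum>i\<le>n. coeff q i * b ^ i)"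
    using assms(2,3)
    by (intro ring_rel_sum[OF assms(1)] ring_rel_mult[OF assms(1)] ring_rel_power[OF assms(1)])
       (auto simp: poly_rel_def)
  moreover have "poly p a = (\<Sum>i\<le>n. coeff p i * a ^ i)" "poly q b = (\<Sum>i\<le>n. coeff q i * b ^ i)"
    unfolding n_def by (rule poly_eq_sum_le, simp)+
  ultimately show ?thesis by simp
qed

text \<open>Relating 0 only to 0, in both directions, makes the relation the graph of an isomorphism
  between two subrings: applied to differences, the condition gives functionality and
  injectivity.\<close>

definition emb_rel :: "('a::field \<Rightarrow> 'b::field \<Rightarrow> bool) \<Rightarrow> bool" where
  "emb_rel S \<longleftrightarrow> ring_rel S \<and> (\<forall>a b. S a b \<longrightarrow> (a = 0 \<longleftrightarrow> b = 0))"

lemma emb_relD: "emb_rel S \<Longrightarrow> ring_rel S" "emb_rel S \<Longrightarrow> S a b \<Longrightarrow> a = 0 \<longleftrightarrow> b = 0"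
  unfolding emb_rel_def by auto

lemma emb_rel_conversep: "emb_rel S \<Longrightarrow> emb_rel S\<inverse>\<inverse>"
  unfolding emb_rel_def by (auto intro: ring_rel_conversep)

lemma emb_rel_functional: "emb_rel S \<Longrightarrow> S a b \<Longrightarrow> S a c \<Longrightarrow> b = c"
  using ring_rel_diff[of S a b a c] emb_relD[of S] by force

lemma emb_rel_inj: "emb_rel S \<Longrightarrow> S a c \<Longrightarrow> S b c \<Longrightarrow> a = b"
  using ring_rel_diff[of S a c b c] emb_relD[of S] by force

text \<open>The induced isomorphism between the fields of fractions. A maximal partial isomorphism
  coincides with it and is thus closed under inverses, as polynomial division over its domain
  requires.\<close>

definition frac_rel :: "('a::field \<Rightarrow> 'b::field \<Rightarrow> bool) \<Rightarrow> 'a \<Rightarrow> 'b \<Rightarrow> bool" where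
  "frac_rel S a b \<longleftrightarrow> (\<exists>u v w z. S u v \<and> S w z \<and> w \<noteq> 0 \<and> z \<noteq> 0 \<and> a = u / w \<and> b = v / z)"

lemma frac_relI: "S u v \<Longrightarrow> S w z \<Longrightarrow> w \<noteq> 0 \<Longrightarrow> z \<noteq> 0 \<Longrightarrow> a = u / w \<Longrightarrow> b = v / z \<Longrightarrow> frac_rel S a b"
  unfolding frac_rel_def by blast

lemma emb_rel_frac:
  assumes "emb_rel S"
  shows "emb_rel (frac_rel S)" "S \<le> frac_rel S"
proof -
  note R = emb_relD(1)[OF assms]
  have "frac_rel S (a - c) (b - d) \<and> frac_rel S (a * c) (b * d)"
    if "frac_rel S a b" "frac_rel S c d" for a b c d
  proof -
    from that(1) obtain u v w z where 1: "S u v" "S w z" "w \<noteq> 0" "z \<noteq> 0" "a = u / w" "b = v / z"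
      unfolding frac_rel_def by blast
    from that(2) obtain u' v' w' z' where 2: "S u' v'" "S w' z'" "w' \<noteq> 0" "z' \<noteq> 0" "c = u' / w'" "d = v' / z'"
      unfolding frac_rel_def by blast
    have "frac_rel S (a - c) (b - d)"
    proof (rule frac_relI)
      show "S (u * w' - u' * w) (v * z' - v' * z)" "S (w * w') (z * z')"
        using 1 2 by (intro ring_rel_diff[OF R] ring_rel_mult[OF R]; simp)+
    qed (use 1 2 in \<open>auto simp: field_simps\<close>)
    moreover have "frac_rel S (a * c) (b * d)"
    proof (rule frac_relI)
      show "S (u * u') (v * v')" "S (w * w') (z * z')"
        using 1 2 by (intro ring_rel_mult[OF R]; simp)+
    qed (use 1 2 in \<open>auto simp: field_simps\<close>)
    ultimately show ?thesis by blast
  qed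
  moreover have "frac_rel S 1 1"
    by (rule frac_relI[of S 1 1 1 1]) (auto intro: ring_rel_one[OF R])
  ultimately have "ring_rel (frac_rel S)" unfolding ring_rel_def by blast
  then show "emb_rel (frac_rel S)"
    unfolding emb_rel_def using emb_relD(2)[OF assms] by (auto simp: frac_rel_def)
  show "S \<le> frac_rel S"
    by (auto intro!: frac_relI[where w=1 and z=1] ring_rel_one[OF R])
qed

lemma frac_rel_inverse:
  assumes "emb_rel S" "frac_rel S a b"
  shows "frac_rel S (inverse a) (inverse b)"
proof -
  from assms(2) obtain u v w z where 1: "S u v" "S w z" "w \<noteq> 0" "z \<noteq> 0" "a = u / w" "b = v / z"
    unfolding frac_rel_def by blast
  show ?thesis
  proof (cases "u = 0")
    case True
    then have "a = 0" "b = 0" using emb_relD(2)[OF assms(1) 1(1)] 1 by auto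
    then show ?thesis using assms by simp
  next
    case False
    then have "v \<noteq> 0" using emb_relD(2)[OF assms(1) 1(1)] by simp
    with 1 False show ?thesis by (intro frac_relI[of S w z u v]) (auto simp: field_simps)
  qed
qed

lemma poly_rel_degree:
  assumes "emb_rel S" "poly_rel S p q"
  shows "degree p = degree q" "p = 0 \<longleftrightarrow> q = 0"
proof -
  have *: "coeff p i = 0 \<longleftrightarrow> coeff q i = 0" for i
    using assms emb_relD(2) unfolding poly_rel_def by blast
  show "p = 0 \<longleftrightarrow> q = 0" by (simp add: poly_eq_iff *)
  show "degree p = degree q" unfolding degree_def by (simp add: *)
qed

text \<open>Related polynomials have equal degrees, so leading terms can be cancelled on both sides
  at once, and one induction on the left degree yields related quotients and remainders.\<close>

lemma poly_rel_division:
  assumes "emb_rel S" and inv: "\<forall>a b. S a b \<longrightarrow> S (inverse a) (inverse b)"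
    and f: "poly_rel S f1 f2" "f1 \<noteq> 0" and g: "poly_rel S g1 g2"
  shows "\<exists>q1 q2 r1 r2. poly_rel S q1 q2 \<and> poly_rel S r1 r2 \<and> g1 = q1 * f1 + r1 \<and> g2 = q2 * f2 + r2 \<and>
    (r1 = 0 \<or> degree r1 < degree f1)"
  using g
proof (induction "degree g1" arbitrary: g1 g2 rule: less_induct)
  case less
  note R = emb_relD(1)[OF assms(1)]
  note PR = ring_rel_poly_rel[OF R]
  show ?case
  proof (cases "g1 = 0 \<or> degree g1 < degree f1")
    case True
    then show ?thesis using less.prems poly_rel_0[OF R]
      by (intro exI[of _ 0] exI[of _ g1] exI[of _ g2]) auto
  next
    case False
    then have g0: "g1 \<noteq> 0" and dg: "degree f1 \<le> degree g1" by auto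
    have f20: "f2 \<noteq> 0" and df: "degree f2 = degree f1" using poly_rel_degree[OF assms(1) f(1)] f(2) by auto
    have g20: "g2 \<noteq> 0" and dg2: "degree g2 = degree g1" using poly_rel_degree[OF assms(1) less.prems] g0 by auto
    define c1 where "c1 = lead_coeff g1 * inverse (lead_coeff f1)"
    define c2 where "c2 = lead_coeff g2 * inverse (lead_coeff f2)"
    have c: "S c1 c2" unfolding c1_def c2_def using f(1) less.prems inv
      by (intro ring_rel_mult[OF R]) (auto simp: poly_rel_def df dg2)
    define n where "n = degree g1 - degree f1"
    define m1 where "m1 = monom c1 n"
    define m2 where "m2 = monom c2 n"
    have m: "poly_rel S m1 m2" unfolding m1_def m2_def by (rule poly_rel_monom[OF R c])
    define h1 where "h1 = g1 - m1 * f1"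
    define h2 where "h2 = g2 - m2 * f2"
    have h: "poly_rel S h1 h2" unfolding h1_def h2_def
      by (intro ring_rel_diff[OF PR] ring_rel_mult[OF PR] less.prems m f)
    have c10: "c1 \<noteq> 0" using g0 f(2) by (simp add: c1_def)
    have dm: "degree (m1 * f1) = degree g1"
      using c10 f(2) dg by (simp add: m1_def degree_mult_eq degree_monom_eq monom_eq_0_iff n_def)
    have "lead_coeff (m1 * f1) = c1 * lead_coeff f1"
      by (simp add: lead_coeff_mult m1_def degree_monom_eq c10)
    then have lm: "coeff (m1 * f1) (degree g1) = lead_coeff g1"
      using f(2) by (simp add: dm c1_def)
    have "h1 = 0 \<or> degree h1 < degree g1"
    proof (rule ccontr)
      assume "\<not> ?thesis"
      moreover have "degree h1 \<le> degree g1" unfolding h1_def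
        by (rule degree_diff_le) (auto simp: dm)
      ultimately have "degree h1 = degree g1" "h1 \<noteq> 0" by auto
      then have "coeff h1 (degree g1) \<noteq> 0" by (metis leading_coeff_0_iff)
      then show False using lm by (simp add: h1_def)
    qed
    then obtain q1 q2 r1 r2 where qr: "poly_rel S q1 q2" "poly_rel S r1 r2" "h1 = q1 * f1 + r1"
      "h2 = q2 * f2 + r2" "r1 = 0 \<or> degree r1 < degree f1"
    proof
      assume "h1 = 0"
      moreover then have "h2 = 0" using poly_rel_degree[OF assms(1) h] by simp
      ultimately show ?thesis using that[of 0 0 0 0] poly_rel_0[OF R] by auto
    next
      assume "degree h1 < degree g1"
      from less.hyps[OF this h] show ?thesis using that by blast
    qed
    show ?thesis
      by (rule exI[of _ "q1 + m1"], rule exI[of _ "q2 + m2"], rule exI[of _ r1], rule exI[of _ r2])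
         (use qr m h1_def h2_def in \<open>auto simp: algebra_simps intro: ring_rel_add[OF PR]\<close>)
  qed
qed

text \<open>Minimality of \<open>f1\<close> makes the pair \<open>(f1, f2)\<close> irreducible on both sides, so that
  \<open>x \<mapsto> y\<close> extends \<open>S\<close>.\<close>

lemma emb_rel_adjoin:
  assumes S: "emb_rel S" and inv: "\<forall>a b. S a b \<longrightarrow> S (inverse a) (inverse b)"
    and f: "poly_rel S f1 f2" "f1 \<noteq> 0" "poly f1 x = 0"
    and min: "\<forall>g1 g2. poly_rel S g1 g2 \<longrightarrow> g1 \<noteq> 0 \<longrightarrow> poly g1 x = 0 \<longrightarrow> degree f1 \<le> degree g1"
    and y: "poly f2 y = 0"
  shows "\<exists>S'. emb_rel S' \<and> S \<le> S' \<and> S' x y"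
proof -
  note R = emb_relD(1)[OF S]
  note PR = ring_rel_poly_rel[OF R]
  note div = poly_rel_division[OF S inv]
  have x_dvd: "\<exists>q1 q2. poly_rel S q1 q2 \<and> g1 = q1 * f1 \<and> g2 = q2 * f2"
    if g: "poly_rel S g1 g2" "poly g1 x = 0" for g1 g2
  proof -
    obtain q1 q2 r1 r2 where qr: "poly_rel S q1 q2" "poly_rel S r1 r2" "g1 = q1 * f1 + r1"
      "g2 = q2 * f2 + r2" "r1 = 0 \<or> degree r1 < degree f1"
      using div[OF f(1,2) g(1)] by blast
    have "poly r1 x = 0" using qr g f by simp
    then have "r1 = 0" using min qr(2,5) by force
    moreover then have "r2 = 0" using poly_rel_degree[OF S qr(2)] by simp
    ultimately show ?thesis using qr by auto
  qed
  \<comment> \<open>A related pair \<open>(h1, h2)\<close> of least degree with \<open>h2\<close>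
    vanishing at \<open>y\<close> divides both \<open>(f1, f2)\<close> and \<open>(g1, g2)\<close>,
    so it suffices that \<open>h1\<close> vanishes at \<open>x\<close>.\<close>
  have y_dvd: "poly g1 x = 0" if g: "poly_rel S g1 g2" "poly g2 y = 0" for g1 g2
  proof (cases "g1 = 0")
    case False
    define P where "P = (\<lambda>n. \<exists>h1 h2. poly_rel S h1 h2 \<and> h1 \<noteq> 0 \<and> poly h2 y = 0 \<and> degree h1 = n)"
    have "P (degree g1)" unfolding P_def using g False by blast
    then have "P (LEAST n. P n)" by (rule LeastI)
    then obtain h1 h2 where h: "poly_rel S h1 h2" "h1 \<noteq> 0" "poly h2 y = 0" "degree h1 = (LEAST n. P n)"
      unfolding P_def by blast
    have hmin: "degree h1 \<le> degree k1" if "poly_rel S k1 k2" "k1 \<noteq> 0" "poly k2 y = 0" for k1 k2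
    proof -
      have "P (degree k1)" unfolding P_def by (intro exI[of _ k1] exI[of _ k2]) (simp add: that)
      then show ?thesis unfolding h(4) by (rule Least_le)
    qed
    have h_dvd: "\<exists>q1 q2. poly_rel S q1 q2 \<and> k1 = q1 * h1 \<and> k2 = q2 * h2"
      if k: "poly_rel S k1 k2" "poly k2 y = 0" for k1 k2
    proof -
      obtain q1 q2 r1 r2 where qr: "poly_rel S q1 q2" "poly_rel S r1 r2" "k1 = q1 * h1 + r1"
        "k2 = q2 * h2 + r2" "r1 = 0 \<or> degree r1 < degree h1"
        using div[OF h(1,2) k(1)] by blast
      have "poly r2 y = 0" using qr k h by simp
      then have "r1 = 0" using hmin[OF qr(2)] qr(5) by force
      moreover then have "r2 = 0" using poly_rel_degree[OF S qr(2)] by simp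
      ultimately show ?thesis using qr by auto
    qed
    obtain q1 q2 where q: "poly_rel S q1 q2" "f1 = q1 * h1" "f2 = q2 * h2" using h_dvd[OF f(1) y] by blast
    have q0: "q1 \<noteq> 0" using q f by auto
    \<comment> \<open>Otherwise the cofactor \<open>q1\<close> vanishes at \<open>x\<close>;
      minimality of \<open>f1\<close> then makes \<open>h1\<close> a nonzero constant, and so is its
      partner \<open>h2\<close>, which cannot vanish at \<open>y\<close>.\<close>
    have "poly h1 x = 0"
    proof (rule ccontr)
      assume "poly h1 x \<noteq> 0"
      then have "poly q1 x = 0" using f(3) q by simp
      then have "degree f1 \<le> degree q1" using min q(1) q0 by blast
      then have "degree h1 = 0" using q(2) h(2) q0 by (simp add: degree_mult_eq)
      then have "degree h2 = 0" "h2 \<noteq> 0" using poly_rel_degree[OF S h(1)] h(2) by auto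
      then obtain c where "h2 = [:c:]" "c \<noteq> 0" by (metis degree_eq_zeroE pCons_0_0)
      then show False using h(3) by simp
    qed
    moreover obtain k1 where "g1 = k1 * h1" using h_dvd[OF g] by blast
    ultimately show ?thesis by simp
  qed simp
  define S' where "S' = (\<lambda>a b. \<exists>g1 g2. poly_rel S g1 g2 \<and> a = poly g1 x \<and> b = poly g2 y)"
  have "ring_rel S'"
    unfolding ring_rel_def
  proof (intro conjI allI impI)
    show "S' 1 1" unfolding S'_def by (intro exI[of _ 1]) (auto intro: ring_rel_one[OF PR])
    fix a b c d assume "S' a b" "S' c d"
    then obtain g1 g2 h1 h2 where g: "poly_rel S g1 g2" "a = poly g1 x" "b = poly g2 y"
      "poly_rel S h1 h2" "c = poly h1 x" "d = poly h2 y"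
      unfolding S'_def by blast
    show "S' (a - c) (b - d)" unfolding S'_def
      by (rule exI[of _ "g1 - h1"], rule exI[of _ "g2 - h2"]) (use g in \<open>auto intro: ring_rel_diff[OF PR]\<close>)
    show "S' (a * c) (b * d)" unfolding S'_def
      by (rule exI[of _ "g1 * h1"], rule exI[of _ "g2 * h2"]) (use g in \<open>auto intro: ring_rel_mult[OF PR]\<close>)
  qed
  moreover have "a = 0 \<longleftrightarrow> b = 0" if ab: "S' a b" for a b
  proof -
    obtain g1 g2 where g: "poly_rel S g1 g2" "a = poly g1 x" "b = poly g2 y" using ab unfolding S'_def by blast
    show ?thesis using x_dvd[OF g(1)] y_dvd[OF g(1)] g y by auto
  qed
  ultimately have "emb_rel S'" unfolding emb_rel_def by blast
  moreover have "S \<le> S'"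
    unfolding S'_def by (auto intro!: exI[of _ "[:_:]"] poly_rel_const[OF R])
  moreover have "S' x y" unfolding S'_def
    by (rule exI[of _ "[:0,1:]"], rule exI[of _ "[:0,1:]"])
       (simp add: poly_rel_pCons poly_rel_0 ring_rel_zero ring_rel_one R)
  ultimately show ?thesis by (intro exI[of _ S'] conjI)
qed

lemma algebraic_int_poly:
  assumes "algebraic (x :: complex)"
  obtains p :: "int poly" where "p \<noteq> 0" "poly (of_int_poly p) x = 0"
proof -
  obtain p where p: "\<forall>i. coeff p i \<in> \<int>" "p \<noteq> 0" "poly p x = 0"
    using assms unfolding algebraic_def by blast
  define q where "q = map_poly (\<lambda>z. \<lfloor>Re z\<rfloor>) p"
  have "of_int_poly q = p"
  proof (rule poly_eqI)
    fix i
    obtain c where "coeff p i = of_int c" using p(1) Ints_cases by blast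
    then show "coeff (of_int_poly q) i = coeff p i" by (simp add: q_def coeff_map_poly)
  qed
  with p that[of q] show ?thesis by auto
qed

text \<open>Take a least-degree polynomial over the domain that annihilates \<open>x\<close> and
  carry its coefficients across. The complex numbers are algebraically closed, so the image has a
  root \<open>y\<close>; adjoining the pair of \<open>x\<close> and \<open>y\<close> must not
  enlarge a maximal relation.\<close>

lemma emb_rel_maximal_dom:
  fixes S :: "complex \<Rightarrow> complex \<Rightarrow> bool"
  assumes S: "emb_rel S" and max: "\<And>S'. emb_rel S' \<Longrightarrow> S \<le> S' \<Longrightarrow> S' = S"
    and x: "algebraic x"
  shows "\<exists>y. S x y"
proof -
  note R = emb_relD(1)[OF S]
  have inv: "\<forall>a b. S a b \<longrightarrow> S (inverse a) (inverse b)"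
    using frac_rel_inverse[OF S] max[OF emb_rel_frac[OF S]] by simp
  obtain p :: "int poly" where p: "p \<noteq> 0" "poly (of_int_poly p) x = 0" using algebraic_int_poly[OF x] by blast
  define P where "P = (\<lambda>n. \<exists>h1 h2. poly_rel S h1 h2 \<and> h1 \<noteq> 0 \<and> poly h1 x = 0 \<and> degree h1 = n)"
  have "P (degree (of_int_poly p :: complex poly))" unfolding P_def
    by (rule exI[of _ "of_int_poly p"], rule exI[of _ "of_int_poly p"]) (use p in \<open>auto intro: poly_rel_of_int[OF R]\<close>)
  then have "P (LEAST n. P n)" by (rule LeastI)
  then obtain h1 h2 where h: "poly_rel S h1 h2" "h1 \<noteq> 0" "poly h1 x = 0" "degree h1 = (LEAST n. P n)"
    unfolding P_def by blast
  have hmin: "\<forall>k1 k2. poly_rel S k1 k2 \<longrightarrow> k1 \<noteq> 0 \<longrightarrow> poly k1 x = 0 \<longrightarrow> degree h1 \<le> degree k1"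
  proof (intro allI impI)
    fix k1 k2 assume "poly_rel S k1 k2" "k1 \<noteq> 0" "poly k1 x = 0"
    then have "P (degree k1)" unfolding P_def by (intro exI[of _ k1] exI[of _ k2]) simp
    then show "degree h1 \<le> degree k1" unfolding h(4) by (rule Least_le)
  qed
  have "degree h1 \<noteq> 0"
  proof
    assume "degree h1 = 0"
    then obtain c where "h1 = [:c:]" by (rule degree_eq_zeroE)
    with h(2,3) show False by simp
  qed
  then have "degree h2 \<noteq> 0" using poly_rel_degree[OF S h(1)] by simp
  then have "\<not> constant (poly h2)" by (simp add: constant_degree)
  then obtain y where y: "poly h2 y = 0" using fundamental_theorem_of_algebra by blast
  obtain S' where "emb_rel S'" "S \<le> S'" "S' x y"
    using emb_rel_adjoin[OF S inv h(1-3) hmin y] by blast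
  then have "S x y" using max[of S'] by simp
  then show ?thesis ..
qed

lemma emb_rel_maximal_extension:
  assumes "emb_rel S0"
  shows "\<exists>S. emb_rel S \<and> S0 \<le> S \<and> (\<forall>S'. emb_rel S' \<longrightarrow> S \<le> S' \<longrightarrow> S' = S)"
proof -
  define A where "A = {T. emb_rel (\<lambda>a b. (a, b) \<in> T) \<and> {(a, b). S0 a b} \<subseteq> T}"
  have "\<exists>M\<in>A. \<forall>X\<in>A. M \<subseteq> X \<longrightarrow> X = M"
  proof (rule subset_Zorn_nonempty)
    have "{(a, b). S0 a b} \<in> A" using assms by (simp add: A_def)
    then show "A \<noteq> {}" by blast
    fix C assume C: "C \<noteq> {}" "subset.chain A C"
    have CA: "T \<in> A" if "T \<in> C" for T using C(2) that by (auto simp: subset.chain_def)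
    have two: "\<exists>T\<in>C. u \<in> T \<and> v \<in> T" if "u \<in> \<Union>C" "v \<in> \<Union>C" for u v
      using that C(2) unfolding subset.chain_def by blast
    have "ring_rel (\<lambda>a b. (a, b) \<in> \<Union>C)"
      unfolding ring_rel_def
    proof (intro conjI allI impI)
      obtain T where "T \<in> C" using C by blast
      then show "(1, 1) \<in> \<Union>C" using CA[of T] ring_rel_one unfolding A_def emb_rel_def by fastforce
      fix a b c d assume "(a, b) \<in> \<Union>C" "(c, d) \<in> \<Union>C"
      then obtain T where T: "T \<in> C" "(a, b) \<in> T" "(c, d) \<in> T" using two by blast
      then have "ring_rel (\<lambda>a b. (a, b) \<in> T)" using CA unfolding A_def emb_rel_def by blast
      from ring_rel_diff[OF this T(2,3)] ring_rel_mult[OF this T(2,3)] T(1)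
      show "(a - c, b - d) \<in> \<Union>C" "(a * c, b * d) \<in> \<Union>C" by blast+
    qed
    moreover obtain T where "T \<in> C" using C(1) by blast
    moreover have "a = 0 \<longleftrightarrow> b = 0" if "(a, b) \<in> \<Union>C" for a b
      using that CA unfolding A_def emb_rel_def by blast
    ultimately show "\<Union>C \<in> A" using CA[of T] unfolding A_def emb_rel_def by blast
  qed
  then obtain M where M: "M \<in> A" "\<And>X. X \<in> A \<Longrightarrow> M \<subseteq> X \<Longrightarrow> X = M" by blast
  show ?thesis
  proof (intro exI conjI allI impI)
    show "emb_rel (\<lambda>a b. (a, b) \<in> M)" "S0 \<le> (\<lambda>a b. (a, b) \<in> M)" using M(1) by (auto simp: A_def)
    fix S' assume S': "emb_rel S'" "(\<lambda>a b. (a, b) \<in> M) \<le> S'"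
    have "{(a, b). S' a b} \<in> A" "M \<subseteq> {(a, b). S' a b}" using S' M(1) by (auto simp: A_def)
    then have "{(a, b). S' a b} = M" using M(2) by blast
    then show "S' = (\<lambda>a b. (a, b) \<in> M)" by auto
  qed
qed

section \<open>Algebraic numbers and their automorphisms\<close>

text \<open>The determinant trick: \<open>z\<close> is an eigenvalue of the integer matrix of its action.\<close>

lemma algebraic_int_finite_module:
  fixes v :: "'i \<Rightarrow> complex"
  assumes K: "finite K" "k0 \<in> K" "v k0 \<noteq> 0"
    and comb: "\<And>k. k \<in> K \<Longrightarrow> \<exists>a. z * v k = (\<Sum>l\<in>K. of_int (a l) * v l)"
  shows "algebraic_int z"
proof -
  obtain a where a: "\<And>k. k \<in> K \<Longrightarrow> z * v k = (\<Sum>l\<in>K. of_int (a k l) * v l)"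
    using comb by metis
  obtain e where e: "bij_betw e {0..<card K} K" using ex_bij_betw_nat_finite[OF K(1)] by blast
  define n where "n = card K"
  have eK: "e i \<in> K" if "i < n" for i using e that unfolding bij_betw_def n_def by auto
  define A where "A = Matrix.mat n n (\<lambda>(i,j). a (e i) (e j))"
  define C where "C = (map_mat of_int A :: complex Matrix.mat)"
  define w where "w = Matrix.vec n (\<lambda>i. v (e i))"
  have A: "A \<in> carrier_mat n n" unfolding A_def by simp
  have C: "C \<in> carrier_mat n n" unfolding C_def using A by simp
  have "C *\<^sub>v w = z \<cdot>\<^sub>v w"
  proof (rule eq_vecI)
    fix i assume "i < dim_vec (z \<cdot>\<^sub>v w)"
    then have i: "i < n" by (simp add: w_def)
    have "vec_index (C *\<^sub>v w) i = (\<Sum>j = 0..<n. of_int (a (e i) (e j)) * v (e j))"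
      using i by (simp add: C_def A_def w_def scalar_prod_def)
    also have "\<dots> = (\<Sum>l\<in>K. of_int (a (e i) l) * v l)"
      using e unfolding n_def by (rule sum.reindex_bij_betw)
    also have "\<dots> = z * v (e i)" using a[OF eK[OF i]] by simp
    finally show "vec_index (C *\<^sub>v w) i = vec_index (z \<cdot>\<^sub>v w) i" using i by (simp add: w_def)
  qed (simp add: C_def A_def w_def)
  moreover have "w \<noteq> 0\<^sub>v n"
  proof
    assume w0: "w = 0\<^sub>v n"
    obtain i where "i < n" "e i = k0" using e K(2) unfolding bij_betw_def n_def by force
    then have "vec_index w i = v k0" by (simp add: w_def)
    with w0 \<open>i < n\<close> K(3) show False by simp
  qed
  ultimately have "eigenvector C w z" unfolding eigenvector_def using C by (simp add: w_def)
  then have "poly (char_poly C) z = 0"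
    using eigenvalue_root_char_poly[OF C] unfolding eigenvalue_def by blast
  moreover have "char_poly C = of_int_poly (char_poly A)"
    unfolding C_def by (rule of_int_hom.char_poly_hom[OF A])
  moreover have "lead_coeff (char_poly A) = 1" using degree_monic_char_poly[OF A] by simp
  ultimately show ?thesis
    unfolding algebraic_int_altdef_ipoly by (intro exI[of _ "char_poly A"]) simp
qed

text \<open>The products \<open>x ^ i * y ^ j\<close> with exponents below the degrees of
  \<open>p\<close> and \<open>q\<close> span a module that is stable under \<open>x\<close> and
  \<open>y\<close>, since the monic equations rewrite the top powers. The determinant trick then
  applies to the sum and to the product.\<close>

lemma algebraic_int_add_mult:
  fixes x y :: complex
  assumes "algebraic_int x" "algebraic_int y"
  shows "algebraic_int (x + y) \<and> algebraic_int (x * y)"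
proof -
  obtain p where p: "poly (of_int_poly p) x = 0" "lead_coeff p = 1"
    using assms(1) unfolding algebraic_int_altdef_ipoly by blast
  obtain q where q: "poly (of_int_poly q) y = 0" "lead_coeff q = 1"
    using assms(2) unfolding algebraic_int_altdef_ipoly by blast
  define K where "K = {..<degree p} \<times> {..<degree q}"
  define v where "v = (\<lambda>(i, j). x ^ i * y ^ j)"
  define C where "C = (\<lambda>w. \<exists>a. w = (\<Sum>l\<in>K. of_int (a l) * v l))"
  have finK: "finite K" by (simp add: K_def)
  have pos: "0 < degree r" if "poly (of_int_poly r) t = 0" "lead_coeff r = 1" for r :: "int poly" and t :: complex
  proof (rule ccontr)
    assume "\<not> 0 < degree r"
    then obtain c where "r = [:c:]" by (metis degree_eq_zeroE gr0I)
    with that show False by simp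
  qed
  have C_add: "C (u + w)" if "C u" "C w" for u w
  proof -
    obtain a b where "u = (\<Sum>l\<in>K. of_int (a l) * v l)" "w = (\<Sum>l\<in>K. of_int (b l) * v l)"
      using \<open>C u\<close> \<open>C w\<close> unfolding C_def by blast
    then have "u + w = (\<Sum>l\<in>K. of_int (a l + b l) * v l)" by (simp add: sum.distrib algebra_simps)
    then show ?thesis unfolding C_def by (intro exI[of _ "\<lambda>l. a l + b l"])
  qed
  have C_smult: "C (of_int c * u)" if "C u" for u c
  proof -
    obtain a where "u = (\<Sum>l\<in>K. of_int (a l) * v l)" using \<open>C u\<close> unfolding C_def by blast
    then have "of_int c * u = (\<Sum>l\<in>K. of_int (c * a l) * v l)" by (simp add: sum_distrib_left algebra_simps)
    then show ?thesis unfolding C_def by (intro exI[of _ "\<lambda>l. c * a l"])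
  qed
  have C_0: "C 0" unfolding C_def by (rule exI[of _ "\<lambda>_. 0"]) simp
  have C_sum: "C (sum f I)" if "\<And>i. i \<in> I \<Longrightarrow> C (f i)" for f and I :: "nat set"
    using that by (induction I rule: infinite_finite_induct) (auto intro: C_add C_0)
  have C_gen: "C (v k)" if "k \<in> K" for k
  proof -
    have "v k = (\<Sum>l\<in>K. of_int (if l = k then 1 else 0) * v l)"
      using that finK by (subst sum.remove[of _ k]) auto
    then show ?thesis unfolding C_def by (intro exI[of _ "\<lambda>l. if l = k then 1 else 0"])
  qed
  have top: "t ^ degree r = (\<Sum>i<degree r. of_int (- coeff r i) * t ^ i)"
    if "poly (of_int_poly r) t = 0" "lead_coeff r = 1" for r :: "int poly" and t :: complex
  proof -
    have "0 = (\<Sum>i\<le>degree r. of_int (coeff r i) * t ^ i)"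
      using that(1) by (simp add: poly_altdef coeff_map_poly)
    also have "\<dots> = t ^ degree r + (\<Sum>i<degree r. of_int (coeff r i) * t ^ i)"
      using that(2) by (simp add: lessThan_Suc_atMost[symmetric])
    finally show ?thesis by (simp add: sum_negf eq_neg_iff_add_eq_0)
  qed
  have C_x: "C (x * v k)" if k: "k \<in> K" for k
  proof -
    obtain i j where ij: "k = (i, j)" "i < degree p" "j < degree q" using k unfolding K_def by blast
    show ?thesis
    proof (cases "Suc i < degree p")
      case True
      then show ?thesis using C_gen[of "(Suc i, j)"] ij by (simp add: v_def K_def mult.assoc)
    next
      case False
      then have "Suc i = degree p" using ij by simp
      then have "x * v k = x ^ degree p * y ^ j" using ij by (simp add: v_def flip: power_Suc)
      also have "\<dots> = (\<Sum>i<degree p. of_int (- coeff p i) * v (i, j))"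
        unfolding top[OF p] by (simp add: v_def sum_distrib_right mult.assoc)
      also have "C \<dots>" using ij by (intro C_sum C_smult C_gen) (simp add: K_def)
      finally show ?thesis .
    qed
  qed
  have C_y: "C (y * v k)" if k: "k \<in> K" for k
  proof -
    obtain i j where ij: "k = (i, j)" "i < degree p" "j < degree q" using k unfolding K_def by blast
    show ?thesis
    proof (cases "Suc j < degree q")
      case True
      then show ?thesis using C_gen[of "(i, Suc j)"] ij by (simp add: v_def K_def algebra_simps)
    next
      case False
      then have "Suc j = degree q" using ij by simp
      then have "y * v k = x ^ i * y ^ degree q" using ij by (auto simp add: v_def simp flip: power_Suc)
      also have "\<dots> = (\<Sum>j<degree q. of_int (- coeff q j) * v (i, j))"
        unfolding top[OF q] by (simp add: v_def sum_distrib_left algebra_simps)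
      also have "C \<dots>" using ij by (intro C_sum C_smult C_gen) (simp add: K_def)
      finally show ?thesis .
    qed
  qed
  have C_x': "C (x * u)" if "C u" for u
  proof -
    obtain a where "u = (\<Sum>l\<in>K. of_int (a l) * v l)" using \<open>C u\<close> unfolding C_def by blast
    then have "x * u = (\<Sum>l\<in>K. of_int (a l) * (x * v l))" by (simp add: sum_distrib_left algebra_simps)
    moreover have "C (\<Sum>l\<in>T. of_int (a l) * (x * v l))" if "T \<subseteq> K" for T
      using finite_subset[OF that finK] that by induction (auto intro: C_0 C_add C_smult C_x)
    ultimately show ?thesis by simp
  qed
  have in_K: "(0, 0) \<in> K" "v (0, 0) \<noteq> 0" using pos[OF p] pos[OF q] by (auto simp: K_def v_def)
  have "algebraic_int (x + y)"
  proof (rule algebraic_int_finite_module[where v = v, OF finK in_K])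
    fix k assume "k \<in> K"
    then have "C ((x + y) * v k)" using C_add[OF C_x C_y] by (simp add: distrib_right)
    then show "\<exists>a. (x + y) * v k = (\<Sum>l\<in>K. of_int (a l) * v l)" unfolding C_def .
  qed
  moreover have "algebraic_int (x * y)"
  proof (rule algebraic_int_finite_module[where v = v, OF finK in_K])
    fix k assume "k \<in> K"
    then have "C ((x * y) * v k)" using C_x'[OF C_y] by (simp add: mult.assoc)
    then show "\<exists>a. (x * y) * v k = (\<Sum>l\<in>K. of_int (a l) * v l)" unfolding C_def .
  qed
  ultimately show ?thesis by blast
qed

lemma algebraic_int_diff: "algebraic_int x \<Longrightarrow> algebraic_int y \<Longrightarrow> algebraic_int (x - y)" for x y :: complex
  using algebraic_int_add_mult[of x "- y"] algebraic_int_minus[of y] by simp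

section \<open>From algebraic integers to algebraic numbers by clearing denominators\<close>

lemma algebraic_scale_to_int:
  assumes "algebraic (x :: complex)"
  obtains n :: int where "n \<noteq> 0" "algebraic_int (of_int n * x)"
proof -
  obtain p :: "int poly" where p: "p \<noteq> 0" "poly (of_int_poly p) x = 0"
    using algebraic_int_poly[OF assms] by blast
  define c where "c = lead_coeff p"
  define d where "d = degree p"
  have "d \<noteq> 0"
  proof
    assume "d = 0"
    then obtain c where "p = [:c:]" unfolding d_def by (rule degree_eq_zeroE)
    with p show False by simp
  qed
  \<comment> \<open>This is \<open>c ^ (d - 1) * p (T / c)\<close> in the variable \<open>T\<close>:
    its coefficients stay integral, and it is monic because \<open>c\<close> is the leading
    coefficient of \<open>p\<close>.\<close>
  define q where "q = monom 1 d + (\<Sum>i<d. monom (coeff p i * c ^ (d - 1 - i)) i)"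
  have cq: "coeff q i = (if i = d then 1 else if i < d then coeff p i * c ^ (d - 1 - i) else 0)" for i
    by (auto simp: q_def coeff_sum)
  have dq: "degree q = d"
    using cq le_degree[of q d] degree_le[of d q] by (intro antisym) auto
  have "poly (of_int_poly q) (of_int c * x) = (\<Sum>i\<le>d. of_int (coeff q i) * (of_int c * x) ^ i)"
    unfolding poly_altdef by (simp add: dq coeff_map_poly)
  also have "\<dots> = (\<Sum>i\<le>d. of_int (c ^ (d - 1)) * (of_int (coeff p i) * x ^ i))"
  proof (rule sum.cong)
    fix i assume "i \<in> {..d}"
    then consider "i = d" | "i < d" by force
    then show "of_int (coeff q i) * (of_int c * x) ^ i = of_int (c ^ (d - 1)) * (of_int (coeff p i) * x ^ i)"
    proof cases
      case 1
      then have "of_int c ^ i = (of_int c ^ (d - 1) * of_int (coeff p i) :: complex)"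
        using \<open>d \<noteq> 0\<close> by (simp add: c_def d_def flip: power_Suc2)
      then show ?thesis using 1 by (simp add: cq power_mult_distrib)
    next
      case 2
      then have "(of_int c ^ (d - 1) :: complex) = of_int c ^ (d - 1 - i) * of_int c ^ i"
        by (simp flip: power_add)
      then show ?thesis using 2 by (simp add: cq power_mult_distrib)
    qed
  qed simp
  also have "\<dots> = of_int (c ^ (d - 1)) * poly (of_int_poly p) x"
    unfolding poly_altdef by (simp add: d_def coeff_map_poly sum_distrib_left)
  finally have "poly (of_int_poly q) (of_int c * x) = 0" using p(2) by simp
  moreover have "lead_coeff q = 1" by (simp add: dq cq)
  ultimately have "algebraic_int (of_int c * x)" unfolding algebraic_int_altdef_ipoly by blast
  moreover have "c \<noteq> 0" using p(1) by (simp add: c_def)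
  ultimately show ?thesis using that by blast
qed

lemma algebraic_of_scale:
  assumes "algebraic (of_int n * x :: complex)" "n \<noteq> 0"
  shows "algebraic x"
proof -
  obtain p :: "int poly" where p: "p \<noteq> 0" "poly (of_int_poly p) (of_int n * x) = 0"
    using algebraic_int_poly[OF assms(1)] by blast
  define d where "d = degree p"
  define q where "q = (\<Sum>i\<le>d. monom (of_int (coeff p i * n ^ i) :: complex) i)"
  have cq: "coeff q i = of_int (coeff p i * n ^ i)" for i
    by (cases "i \<le> d") (auto simp: q_def coeff_sum coeff_eq_0 d_def intro!: sum.neutral)
  have "poly q x = poly (of_int_poly p) (of_int n * x)"
    unfolding q_def poly_sum poly_monom
    by (simp add: poly_altdef[of "of_int_poly p"] coeff_map_poly d_def power_mult_distrib mult.assoc)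
  moreover have "coeff q d \<noteq> 0" unfolding cq using p(1) assms(2) by (simp add: d_def)
  moreover have "q \<noteq> 0" using \<open>coeff q d \<noteq> 0\<close> by auto
  ultimately show ?thesis using p(2) by (intro algebraicI[of q]) (auto simp only: cq Ints_of_int)
qed

lemma algebraic_diff_mult:
  fixes x y :: complex
  assumes "algebraic x" "algebraic y"
  shows "algebraic (x - y)" "algebraic (x * y)"
proof -
  obtain n where n: "n \<noteq> 0" "algebraic_int (of_int n * x)" using algebraic_scale_to_int[OF assms(1)] .
  obtain m where m: "m \<noteq> 0" "algebraic_int (of_int m * y)" using algebraic_scale_to_int[OF assms(2)] .
  have i: "algebraic_int (of_int k :: complex)" for k by (simp add: int_imp_algebraic_int)
  have "algebraic_int (of_int m * (of_int n * x) - of_int n * (of_int m * y))"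
    using n m i algebraic_int_add_mult by (blast intro: algebraic_int_diff)
  then have "algebraic (of_int (m * n) * (x - y))" by (auto simp: algebra_simps dest: algebraic_int_imp_algebraic)
  then show "algebraic (x - y)" by (rule algebraic_of_scale) (use n m in simp)
  have "algebraic_int ((of_int n * x) * (of_int m * y))" using n m algebraic_int_add_mult by blast
  then have "algebraic (of_int (m * n) * (x * y))" by (auto simp: algebra_simps dest: algebraic_int_imp_algebraic)
  then show "algebraic (x * y)" by (rule algebraic_of_scale) (use n m in simp)
qed

lemma algebraic_add: "algebraic x \<Longrightarrow> algebraic y \<Longrightarrow> algebraic (x + y)" for x y :: complex
  using algebraic_diff_mult(1)[of x "- y"] algebraic_minus[of y] by simp

lemma algebraic_divide: "algebraic x \<Longrightarrow> algebraic y \<Longrightarrow> algebraic (x / y)" for x y :: complex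
  using algebraic_diff_mult(2)[of x "inverse y"] algebraic_inverse[of y] by (simp add: field_simps)

text \<open>Automorphisms of the field of algebraic numbers, extended by the identity so that
  they are permutations of \<^typ>\<open>complex\<close>.\<close>

definition alg_auts :: "(complex \<Rightarrow> complex) set" where
  "alg_auts = {s. bij s \<and> (\<forall>x. algebraic (s x) \<longleftrightarrow> algebraic x) \<and> (\<forall>x. \<not> algebraic x \<longrightarrow> s x = x) \<and>
     (\<forall>x y. algebraic x \<longrightarrow> algebraic y \<longrightarrow> s (x - y) = s x - s y \<and> s (x * y) = s x * s y) \<and> s 1 = 1}"

lemma alg_autsD:
  assumes "s \<in> alg_auts"
  shows "bij s" "algebraic (s x) \<longleftrightarrow> algebraic x" "\<not> algebraic x \<Longrightarrow> s x = x" "s 1 = 1"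
    "algebraic x \<Longrightarrow> algebraic y \<Longrightarrow> s (x - y) = s x - s y"
    "algebraic x \<Longrightarrow> algebraic y \<Longrightarrow> s (x * y) = s x * s y"
  using assms unfolding alg_auts_def by blast+

lemma alg_auts_closed: "id \<in> alg_auts" "s \<in> alg_auts \<Longrightarrow> inv s \<in> alg_auts"
  "s \<in> alg_auts \<Longrightarrow> t \<in> alg_auts \<Longrightarrow> s \<circ> t \<in> alg_auts"
proof -
  show "id \<in> alg_auts" by (simp add: alg_auts_def)
  show "s \<circ> t \<in> alg_auts" if "s \<in> alg_auts" "t \<in> alg_auts"
    using that by (auto simp: alg_auts_def intro: bij_comp)
  assume s: "s \<in> alg_auts"
  note sD = alg_autsD[OF s]
  have i1: "s (inv s x) = x" and i2: "inv s (s x) = x" for x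
    using sD(1) by (auto simp: bij_is_inj bij_is_surj surj_f_inv_f)
  have alg: "algebraic (inv s x) \<longleftrightarrow> algebraic x" for x using sD(2)[of "inv s x"] i1 by simp
  show "inv s \<in> alg_auts"
    unfolding alg_auts_def mem_Collect_eq
  proof (intro conjI allI impI)
    show "bij (inv s)" by (rule bij_imp_bij_inv[OF sD(1)])
    show "algebraic (inv s x) \<longleftrightarrow> algebraic x" for x by (rule alg)
    show "inv s x = x" if "\<not> algebraic x" for x using sD(3)[OF that] i2 by metis
    show "inv s 1 = 1" using i2[of 1] sD(4) by simp
    fix x y :: complex assume xy: "algebraic x" "algebraic y"
    then show "inv s (x - y) = inv s x - inv s y" "inv s (x * y) = inv s x * inv s y"
      using sD(5,6)[of "inv s x" "inv s y"] alg i1 i2 by metis+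
  qed
qed

lemma emb_rel_alg_auts:
  assumes "s \<in> alg_auts"
  shows "emb_rel (\<lambda>a b. algebraic a \<and> b = s a)"
proof -
  note sD = alg_autsD[OF assms]
  have "s 0 = 0" using sD(5)[of 0 0] by simp
  then have "a = 0 \<longleftrightarrow> s a = 0" for a using bij_is_inj[OF sD(1)] by (metis injD)
  then show ?thesis
    unfolding emb_rel_def ring_rel_def using sD by (auto simp: algebraic_diff_mult)
qed

lemma emb_rel_algebraic:
  fixes S :: "complex \<Rightarrow> complex \<Rightarrow> bool"
  assumes "emb_rel S" "S a b" "algebraic a"
  shows "algebraic b"
proof -
  obtain p :: "int poly" where p: "p \<noteq> 0" "poly (of_int_poly p) a = 0"
    using algebraic_int_poly[OF assms(3)] by blast
  have "S (poly (of_int_poly p) a) (poly (of_int_poly p) b)"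
    using poly_rel_eval[of S, OF _ poly_rel_of_int[of S] assms(2)] emb_relD(1)[OF assms(1)] by simp
  then have "poly (of_int_poly p) b = 0" using p emb_relD(2)[OF assms(1)] by auto
  then show ?thesis using p by (intro algebraicI[of "of_int_poly p"]) (auto simp: coeff_map_poly)
qed

text \<open>A maximal extension has every algebraic number in its domain. Its converse is maximal
  too, so the same holds for the range, and integer polynomials show that algebraic numbers
  correspond to algebraic numbers.\<close>

lemma alg_auts_extension:
  fixes S0 :: "complex \<Rightarrow> complex \<Rightarrow> bool"
  assumes "emb_rel S0"
  shows "\<exists>s\<in>alg_auts. \<forall>a b. algebraic a \<longrightarrow> S0 a b \<longrightarrow> s a = b"
proof -
  obtain S where S: "emb_rel S" "S0 \<le> S" and max: "\<And>S'. emb_rel S' \<Longrightarrow> S \<le> S' \<Longrightarrow> S' = S"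
    using emb_rel_maximal_extension[OF assms] by blast
  have dom: "\<exists>b. S a b" if "algebraic a" for a
    by (rule emb_rel_maximal_dom[OF S(1) max that])
  have max': "S' = S\<inverse>\<inverse>" if "emb_rel S'" "S\<inverse>\<inverse> \<le> S'" for S'
  proof -
    have "S'\<inverse>\<inverse> = S" using max[OF emb_rel_conversep[OF that(1)]] that(2) by auto
    then show ?thesis by auto
  qed
  have ran: "\<exists>a. S a b" if "algebraic b" for b
    using emb_rel_maximal_dom[OF emb_rel_conversep[OF S(1)] max' that] by simp
  have alg: "algebraic a \<longleftrightarrow> algebraic b" if "S a b" for a b
    using emb_rel_algebraic[OF S(1) that] emb_rel_algebraic[OF emb_rel_conversep[OF S(1)], of b a] that by auto
  \<comment> \<open>The maximal relation may also be defined at transcendental numbers; its values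
    there are discarded in favour of the identity.\<close>
  define s where "s = (\<lambda>a. if algebraic a then THE b. S a b else a)"
  have s_eq: "s a = b" if "algebraic a" "S a b" for a b
    using that emb_rel_functional[OF S(1)] by (auto simp: s_def)
  have Ss: "S a (s a)" if "algebraic a" for a
    using dom[OF that] s_eq[OF that] by auto
  have sn: "s a = a" if "\<not> algebraic a" for a using that by (simp add: s_def)
  have salg: "algebraic (s a) \<longleftrightarrow> algebraic a" for a
    using alg[OF Ss] sn by (cases "algebraic a") auto
  note R = emb_relD(1)[OF S(1)]
  have "s \<in> alg_auts"
    unfolding alg_auts_def mem_Collect_eq
  proof (intro conjI allI impI)
    show "bij s"
    proof (rule bijI)
      show "inj s"
      proof (rule injI)
        fix x y assume xy: "s x = s y"
        then have "algebraic x \<longleftrightarrow> algebraic y" using salg by metis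
        then show "x = y" using xy sn[of x] sn[of y] Ss[of x] Ss[of y] emb_rel_inj[OF S(1)] by metis
      qed
      show "surj s"
      proof -
        have "\<exists>x. s x = y" for y
        proof (cases "algebraic y")
          case True
          then obtain x where "S x y" using ran by blast
          then show ?thesis using s_eq alg True by blast
        qed (use sn in blast)
        then show ?thesis unfolding surj_def by metis
      qed
    qed
    show "algebraic (s x) \<longleftrightarrow> algebraic x" for x by (rule salg)
    show "s x = x" if "\<not> algebraic x" for x by (rule sn[OF that])
    show "s 1 = 1" using s_eq[OF _ ring_rel_one[OF R]] by simp
    fix x y :: complex assume "algebraic x" "algebraic y"
    then show "s (x - y) = s x - s y" "s (x * y) = s x * s y"
      using Ss by (auto intro!: s_eq algebraic_diff_mult ring_rel_diff[OF R] ring_rel_mult[OF R])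
  qed
  moreover have "s a = b" if "algebraic a" "S0 a b" for a b using s_eq that S(2) by blast
  ultimately show ?thesis by blast
qed

text \<open>The minimal polynomial \<open>f\<close> of \<open>z\<close> over the rationals has
  degree at least 2, so \<open>f / (X - z)\<close> has a root \<open>y\<close>. It differs from
  \<open>z\<close>, since a double root would also annihilate the derivative, which is rational and
  of smaller degree. Mapping \<open>z\<close> to \<open>y\<close> then extends the identity of the
  rationals.\<close>

lemma alg_auts_move_irrational:
  assumes z: "algebraic z" "z \<notin> \<rat>"
  shows "\<exists>s\<in>alg_auts. s z \<noteq> z"
proof -
  define Q where "Q = (\<lambda>a b :: complex. a = b \<and> a \<in> \<rat>)"
  have Q: "emb_rel Q" unfolding emb_rel_def ring_rel_def Q_def by auto
  have inv: "\<forall>a b. Q a b \<longrightarrow> Q (inverse a) (inverse b)" by (auto simp: Q_def)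
  have eq: "p = q" if "poly_rel Q p q" for p q using that by (simp add: poly_rel_def Q_def poly_eq_iff)
  define P where "P = (\<lambda>n. \<exists>h. poly_rel Q h h \<and> h \<noteq> 0 \<and> poly h z = 0 \<and> degree h = n)"
  obtain p :: "int poly" where p: "p \<noteq> 0" "poly (of_int_poly p) z = 0"
    using algebraic_int_poly[OF z(1)] by blast
  have "P (degree (of_int_poly p :: complex poly))" unfolding P_def
    by (rule exI[of _ "of_int_poly p"]) (use p in \<open>auto intro: poly_rel_of_int[OF emb_relD(1)[OF Q]]\<close>)
  then have "P (LEAST n. P n)" by (rule LeastI)
  then obtain f where f: "poly_rel Q f f" "f \<noteq> 0" "poly f z = 0" "degree f = (LEAST n. P n)"
    unfolding P_def by blast
  have fmin: "degree f \<le> degree k" if "poly_rel Q k k" "k \<noteq> 0" "poly k z = 0" for k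
  proof -
    have "P (degree k)" unfolding P_def using that by blast
    then show ?thesis unfolding f(4) by (rule Least_le)
  qed
  have cf: "coeff f i \<in> \<rat>" for i using f(1) by (simp add: poly_rel_def Q_def)
  obtain g where g: "f = [:- z, 1:] * g" using f(3) unfolding poly_eq_0_iff_dvd by blast
  have g0: "g \<noteq> 0" using g f(2) by auto
  have df: "degree f = Suc (degree g)" unfolding g using g0 by (subst degree_mult_eq) auto
  have "degree g \<noteq> 0"
  proof
    assume "degree g = 0"
    then obtain c where c: "g = [:c:]" by (rule degree_eq_zeroE)
    then have "f = [:- z * c, c:]" "c \<noteq> 0" using g g0 by auto
    then have "- z * c \<in> \<rat>" "c \<in> \<rat>" using cf[of 0] cf[of 1] by auto
    then have "- (- z * c / c) \<in> \<rat>" by (intro Rats_minus_iff[THEN iffD2] Rats_divide)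
    then show False using z(2) \<open>c \<noteq> 0\<close> by simp
  qed
  then have "\<not> constant (poly g)" by (simp add: constant_degree)
  then obtain y where y: "poly g y = 0" using fundamental_theorem_of_algebra by blast
  have "y \<noteq> z"
  proof
    assume "y = z"
    then have "poly (pderiv f) z = 0" using y unfolding g pderiv_mult by simp
    moreover have "poly_rel Q (pderiv f) (pderiv f)"
      using cf by (auto simp: poly_rel_def Q_def coeff_pderiv simp del: of_nat_Suc)
    moreover have "pderiv f \<noteq> 0" using df by (simp add: pderiv_eq_0_iff)
    ultimately have "degree f \<le> degree (pderiv f)" using fmin by blast
    then show False using df by (simp add: degree_pderiv)
  qed
  have "\<forall>g1 g2. poly_rel Q g1 g2 \<longrightarrow> g1 \<noteq> 0 \<longrightarrow> poly g1 z = 0 \<longrightarrow> degree f \<le> degree g1"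
    using fmin eq by blast
  then obtain S where S: "emb_rel S" "S z y"
    using emb_rel_adjoin[OF Q inv f(1-3), of y] y g by auto
  then show ?thesis using alg_auts_extension[OF S(1)] z(1) \<open>y \<noteq> z\<close> by metis
qed

section \<open>Derived series of permutation groups\<close>

definition perm_group :: "('a \<Rightarrow> 'a) set \<Rightarrow> bool" where
  "perm_group H \<longleftrightarrow> id \<in> H \<and> (\<forall>s\<in>H. bij s \<and> inv s \<in> H) \<and> (\<forall>s\<in>H. \<forall>t\<in>H. s \<circ> t \<in> H)"

lemma perm_groupD:
  assumes "perm_group H"
  shows "id \<in> H" "s \<in> H \<Longrightarrow> bij s" "s \<in> H \<Longrightarrow> inv s \<in> H" "s \<in> H \<Longrightarrow> t \<in> H \<Longrightarrow> s \<circ> t \<in> H"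
  using assms unfolding perm_group_def by auto

lemma perm_group_inv_apply:
  assumes "perm_group H" "s \<in> H"
  shows "inv s (s x) = x" "s (inv s x) = x"
  using perm_groupD(2)[OF assms]
  by (auto simp: bij_is_inj bij_is_surj surj_f_inv_f)

lemma perm_group_funpow: "perm_group H \<Longrightarrow> s \<in> H \<Longrightarrow> s ^^ n \<in> H"
  by (induction n) (auto intro: perm_groupD)

text \<open>Inverses come from these two clauses already: the inverse of a commutator is the
  commutator with its arguments exchanged.\<close>

inductive_set perm_derived :: "('a \<Rightarrow> 'a) set \<Rightarrow> ('a \<Rightarrow> 'a) set" for H where
  commutator: "s \<in> H \<Longrightarrow> t \<in> H \<Longrightarrow> s \<circ> t \<circ> inv s \<circ> inv t \<in> perm_derived H"
| product: "s \<in> perm_derived H \<Longrightarrow> t \<in> perm_derived H \<Longrightarrow> s \<circ> t \<in> perm_derived H"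

lemma perm_derived_subset:
  assumes "perm_group H"
  shows "perm_derived H \<subseteq> H"
proof
  fix s assume "s \<in> perm_derived H"
  then show "s \<in> H" by induction (blast intro: perm_groupD[OF assms])+
qed

lemma perm_group_derived:
  assumes "perm_group H"
  shows "perm_group (perm_derived H)"
  unfolding perm_group_def
proof (intro conjI ballI)
  have "id \<circ> id \<circ> inv id \<circ> inv id \<in> perm_derived H"
    by (intro perm_derived.commutator perm_groupD(1)[OF assms])
  then show "id \<in> perm_derived H" by (simp add: inv_id)
next
  fix s assume "s \<in> perm_derived H"
  then show "bij s" using perm_derived_subset[OF assms] perm_groupD(2)[OF assms] by blast
next
  fix s assume "s \<in> perm_derived H"
  then show "inv s \<in> perm_derived H"
  proof induction
    case (commutator s t)
    note b = perm_groupD(2)[OF assms commutator(1)] perm_groupD(2)[OF assms commutator(2)]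
    have "inv (s \<circ> t \<circ> inv s \<circ> inv t) = t \<circ> s \<circ> inv t \<circ> inv s"
      using b by (simp add: o_inv_distrib bij_comp bij_imp_bij_inv inv_inv_eq o_assoc)
    then show ?case using perm_derived.commutator[OF commutator(2,1)] by (simp only:)
  next
    case (product s t)
    then have "bij s" "bij t" using perm_derived_subset[OF assms] perm_groupD(2)[OF assms] by blast+
    then show ?case using product by (simp only: o_inv_distrib) (rule perm_derived.product)
  qed
qed (auto intro: perm_derived.product)

text \<open>Asking only that \<open>g\<close> normalise \<open>H\<close> lets the induction along
  the derived series keep one \<open>g\<close> from the whole group, which makes every term normal
  there.\<close>

lemma perm_derived_conj:
  assumes H: "perm_group H" and g: "bij g"
    and conj: "\<And>h. h \<in> H \<Longrightarrow> g \<circ> h \<circ> inv g \<in> H"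
    and s: "s \<in> perm_derived H"
  shows "g \<circ> s \<circ> inv g \<in> perm_derived H"
  using s
proof induction
  case (commutator s t)
  note b = perm_groupD(2)[OF H commutator(1)] perm_groupD(2)[OF H commutator(2)]
  have i: "inv g (g x) = x" for x using g by (simp add: bij_is_inj)
  have "g \<circ> (s \<circ> t \<circ> inv s \<circ> inv t) \<circ> inv g =
    (g \<circ> s \<circ> inv g) \<circ> (g \<circ> t \<circ> inv g) \<circ> inv (g \<circ> s \<circ> inv g) \<circ> inv (g \<circ> t \<circ> inv g)"
    using b g by (simp add: o_inv_distrib bij_comp bij_imp_bij_inv inv_inv_eq fun_eq_iff i)
  then show ?case by (simp only:) (intro perm_derived.commutator conj commutator)
next
  case (product s t)
  have i: "inv g (g x) = x" for x using g by (simp add: bij_is_inj)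
  have "g \<circ> (s \<circ> t) \<circ> inv g = (g \<circ> s \<circ> inv g) \<circ> (g \<circ> t \<circ> inv g)" by (simp add: fun_eq_iff i)
  then show ?case using perm_derived.product[OF product(3,4)] by (simp only:)
qed

abbreviation derived_series :: "('a \<Rightarrow> 'a) set \<Rightarrow> nat \<Rightarrow> ('a \<Rightarrow> 'a) set" where
  "derived_series H n \<equiv> (perm_derived ^^ n) H"

lemma perm_group_derived_series: "perm_group H \<Longrightarrow> perm_group (derived_series H n)"
  by (induction n) (auto intro: perm_group_derived)

lemma derived_series_antimono:
  assumes "perm_group H" "m \<le> n"
  shows "derived_series H n \<subseteq> derived_series H m"
  using assms(2)
proof (induction n rule: dec_induct)
  case (step n)
  then show ?case using perm_derived_subset[OF perm_group_derived_series[OF assms(1)], of n] by auto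
qed simp

lemma derived_series_conj:
  assumes "perm_group H" "g \<in> H" "s \<in> derived_series H n"
  shows "g \<circ> s \<circ> inv g \<in> derived_series H n"
  using assms(3)
proof (induction n arbitrary: s)
  case 0
  then show ?case using assms(1,2) by (simp only: funpow_0) (blast intro: perm_groupD)
next
  case (Suc n)
  have "s \<in> perm_derived (derived_series H n)" using Suc.prems by simp
  from perm_derived_conj[OF perm_group_derived_series[OF assms(1)] perm_groupD(2)[OF assms(1,2)] Suc.IH this]
  have "g \<circ> s \<circ> inv g \<in> perm_derived (derived_series H n)" .
  then show ?case by (simp add: comp_def)
qed

section \<open>Orbits of a map of prime period\<close>

lemma funpow_prime_period:
  fixes s :: "'a \<Rightarrow> 'a"
  assumes "prime q" "(s ^^ q) x = x" "(s ^^ k) x = x" "\<not> q dvd k"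
  shows "s x = x"
proof -
  have mul: "(s ^^ (m * n)) x = x" if "(s ^^ m) x = x" for m n
    using funpow_mod_eq[OF that, of "m * n"] by simp
  have "coprime k q" using prime_imp_coprime[OF assms(1,4)] by (metis coprime_commute)
  then obtain a where "[k * a = Suc 0] (mod q)" using cong_solve_coprime_nat by blast
  then have "k * a mod q = 1" using prime_gt_1_nat[OF assms(1)] by (simp add: cong_def)
  moreover have "(s ^^ (k * a mod q)) x = x"
    using funpow_mod_eq[OF assms(2), of "k * a"] mul[OF assms(3), of a] by simp
  ultimately show ?thesis by simp
qed

lemma inj_on_funpow_prime:
  fixes s :: "'a \<Rightarrow> 'a"
  assumes "prime q" "(s ^^ q) x = x" "s x \<noteq> x"
  shows "inj_on (\<lambda>i. (s ^^ i) x) {..<q}"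
proof -
  have *: False if ij: "i < j" "j < q" "(s ^^ i) x = (s ^^ j) x" for i j
  proof -
    have "(s ^^ (q - j + i)) x = (s ^^ (q - j)) ((s ^^ i) x)" by (simp add: funpow_add)
    also have "\<dots> = (s ^^ (q - j + j)) x" unfolding ij(3) by (simp add: funpow_add)
    also have "\<dots> = x" using ij assms(2) by simp
    finally have "(s ^^ (q - j + i)) x = x" .
    moreover have "\<not> q dvd (q - j + i)" using ij by (auto dest!: dvd_imp_le)
    ultimately show False using funpow_prime_period[OF assms(1,2)] assms(3) by blast
  qed
  show ?thesis
  proof (rule inj_onI)
    fix i j assume "i \<in> {..<q}" "j \<in> {..<q}" "(s ^^ i) x = (s ^^ j) x"
    then show "i = j" using *[of i j] *[of j i] by (cases i j rule: linorder_cases) auto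
  qed
qed

lemma card_funpow_orbit:
  fixes s :: "'a \<Rightarrow> 'a"
  assumes "prime q" "(s ^^ q) x = x" "s x \<noteq> x"
  shows "finite (range (\<lambda>i. (s ^^ i) x))" "card (range (\<lambda>i. (s ^^ i) x)) = q"
proof -
  have "range (\<lambda>i. (s ^^ i) x) = (\<lambda>i. (s ^^ i) x) ` {..<q}"
  proof (intro equalityI subsetI)
    fix y assume "y \<in> range (\<lambda>i. (s ^^ i) x)"
    then obtain i where "y = (s ^^ i) x" by blast
    then have "y = (s ^^ (i mod q)) x" using funpow_mod_eq[OF assms(2), of i] by simp
    then show "y \<in> (\<lambda>i. (s ^^ i) x) ` {..<q}" using prime_gt_0_nat[OF assms(1)] by auto
  qed auto
  then show "finite (range (\<lambda>i. (s ^^ i) x))" "card (range (\<lambda>i. (s ^^ i) x)) = q"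
    by (simp_all add: card_image[OF inj_on_funpow_prime[OF assms]])
qed

lemma prime_dvd_card_moved:
  fixes s :: "'a \<Rightarrow> 'a"
  assumes q: "prime q" and X: "finite X" "s ` X \<subseteq> X" and per: "\<And>x. x \<in> X \<Longrightarrow> (s ^^ q) x = x"
  shows "x \<in> X \<Longrightarrow> s x \<noteq> x \<Longrightarrow> range (\<lambda>i. (s ^^ i) x) \<subseteq> {x \<in> X. s x \<noteq> x}"
    and "q dvd card {x \<in> X. s x \<noteq> x}"
proof -
  define M where "M = {x \<in> X. s x \<noteq> x}"
  define O' where "O' = (\<lambda>x. range (\<lambda>i. (s ^^ i) x))"
  have X': "(s ^^ i) x \<in> X" if "x \<in> X" for i x
    using that X(2) by (induction i) auto
  have sub: "O' x \<subseteq> M" if x: "x \<in> M" for x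
  proof
    fix y assume "y \<in> O' x"
    then obtain i where y: "y = (s ^^ i) x" unfolding O'_def by blast
    have "s y \<noteq> y"
    proof
      assume "s y = y"
      then have fy: "(s ^^ k) y = y" for k by (induction k) auto
      \<comment> \<open>Since \<open>q * i\<close> steps return to \<open>x\<close>, the remaining
        \<open>q * i - i\<close> steps lead from \<open>y\<close> back to \<open>x\<close> and
        replace an inverse of \<open>s ^^ i\<close>.\<close>
      have "(s ^^ q) x = x" using per x by (simp add: M_def)
      from funpow_mod_eq[OF this, of "q * i"] have "(s ^^ (q * i)) x = x" by simp
      moreover have "(s ^^ (q * i)) x = (s ^^ (q * i - i + i)) x" using prime_gt_0_nat[OF q] by simp
      ultimately have "x = (s ^^ (q * i - i)) y" by (simp only: y funpow_add comp_def)
      then have "x = y" using fy by simp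
      then show False using \<open>s y = y\<close> x M_def by simp
    qed
    then show "y \<in> M" using x y X' by (simp add: M_def)
  qed
  show "x \<in> X \<Longrightarrow> s x \<noteq> x \<Longrightarrow> range (\<lambda>i. (s ^^ i) x) \<subseteq> {x \<in> X. s x \<noteq> x}"
    using sub[of x] unfolding O'_def M_def by simp
  have trans: "O' y \<subseteq> O' x" if m: "y \<in> O' x" for x y
  proof
    obtain i where y: "y = (s ^^ i) x" using m unfolding O'_def by blast
    fix z assume "z \<in> O' y"
    then obtain j where "z = (s ^^ j) y" unfolding O'_def by blast
    then have "z = (s ^^ (j + i)) x" by (simp add: y funpow_add)
    then show "z \<in> O' x" unfolding O'_def by blast
  qed
  have sym: "x \<in> O' y" if m: "x \<in> M" "y \<in> O' x" for x y
  proof -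
    obtain i where y: "y = (s ^^ i) x" using m(2) unfolding O'_def by blast
    have "(s ^^ q) x = x" using per m by (simp add: M_def)
    from funpow_mod_eq[OF this, of "q * i"] have "(s ^^ (q * i)) x = x" by simp
    moreover have "(s ^^ (q * i)) x = (s ^^ (q * i - i + i)) x" using prime_gt_0_nat[OF q] by simp
    ultimately have "x = (s ^^ (q * i - i)) y" by (simp only: y funpow_add comp_def)
    then show ?thesis unfolding O'_def by blast
  qed
  have self: "x \<in> O' x" for x unfolding O'_def by (rule image_eqI[of _ _ 0]) auto
  have MU: "M = \<Union>(O' ` M)" using self sub by blast
  have fin: "finite M" unfolding M_def using X by simp
  have "q dvd card (\<Union>(O' ` M))"
  proof (rule dvd_partition)
    show "finite (\<Union>(O' ` M))" using fin MU by simp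
    show "\<forall>c\<in>O' ` M. q dvd card c"
    proof
      fix c assume "c \<in> O' ` M"
      then obtain x where "x \<in> X" "s x \<noteq> x" "c = range (\<lambda>i. (s ^^ i) x)" unfolding O'_def M_def by auto
      then show "q dvd card c" using card_funpow_orbit(2)[OF q per] by simp
    qed
    show "\<forall>c1\<in>O' ` M. \<forall>c2\<in>O' ` M. c1 \<noteq> c2 \<longrightarrow> c1 \<inter> c2 = {}"
    proof (intro ballI impI, rule ccontr)
      fix c1 c2 assume "c1 \<in> O' ` M" "c2 \<in> O' ` M" "c1 \<noteq> c2" "c1 \<inter> c2 \<noteq> {}"
      then obtain x y z where z: "x \<in> M" "y \<in> M" "c1 = O' x" "c2 = O' y" "z \<in> O' x" "z \<in> O' y" by blast
      then have "O' x = O' z" "O' y = O' z" using trans sym by blast+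
      then show False using z \<open>c1 \<noteq> c2\<close> by simp
    qed
  qed
  then show "q dvd card {x \<in> X. s x \<noteq> x}" using MU unfolding M_def by simp
qed

text \<open>The number of moved points is a positive multiple of \<open>q\<close> below
  \<open>2 * q\<close>, so there is room for a single orbit only.\<close>

lemma moved_eq_orbit:
  fixes s :: "'a \<Rightarrow> 'a"
  assumes q: "prime q" and X: "finite X" "s ` X \<subseteq> X" and per: "\<And>x. x \<in> X \<Longrightarrow> (s ^^ q) x = x"
    and card: "card X < 2 * q" and x: "x \<in> X" "s x \<noteq> x"
  shows "card {x \<in> X. s x \<noteq> x} = q" "{x \<in> X. s x \<noteq> x} = range (\<lambda>i. (s ^^ i) x)"
proof -
  define M where "M = {x \<in> X. s x \<noteq> x}"
  have fin: "finite M" using X by (simp add: M_def)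
  have "q dvd card M" unfolding M_def by (rule prime_dvd_card_moved(2)[OF q X per])
  then obtain k where k: "card M = q * k" by blast
  have "card M \<le> card X" unfolding M_def using X by (intro card_mono) auto
  then have "q * k < q * 2" using card k by linarith
  then have "k < 2" by simp
  moreover have "card M \<noteq> 0" using fin x by (auto simp: M_def)
  ultimately have "card M = q" using k by (cases k) auto
  then show "card {x \<in> X. s x \<noteq> x} = q" unfolding M_def .
  have "range (\<lambda>i. (s ^^ i) x) = M"
    using prime_dvd_card_moved(1)[OF q X per x] card_funpow_orbit[OF q per[OF x(1)] x(2)] fin \<open>card M = q\<close>
    by (intro card_subset_eq) (auto simp: M_def)
  then show "{x \<in> X. s x \<noteq> x} = range (\<lambda>i. (s ^^ i) x)" unfolding M_def by simp
qed


lemma two_le_card_obtain: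
  assumes "2 \<le> card A"
  obtains x y where "x \<in> A" "y \<in> A" "x \<noteq> y"
proof -
  obtain T where "T \<subseteq> A" "card T = 2" using obtain_subset_with_card_n[OF assms] by blast
  then show ?thesis using that by (auto simp: card_2_iff)
qed

text \<open>Take the first term of the derived series that fixes two points. Invariance under \<open>d\<close> and
  \<open>b\<close> forces it to be trivial on \<open>X\<close>, so its predecessor \<open>N\<close> acts through an abelian group.
  The seven points moved by \<open>b\<close> lie in one \<open>N\<close>-orbit, on which \<open>N\<close> is regular. The 5-cycle
  \<open>c = d ^^ 3\<close> fixes two points of it, so some \<open>t \<noteq> id\<close> in \<open>N\<close> commutes with \<open>c\<close> there. On the five
  points moved by \<open>c\<close> this \<open>t\<close> is a power of \<open>c\<close>, hence \<open>t ^^ 5 = id\<close>, which is impossible on the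
  at most four fixed points of \<open>c\<close>.\<close>

lemma derived_series_fixes_at_most_one:
  fixes G :: "('a \<Rightarrow> 'a) set"
  assumes G: "perm_group G" and X: "finite X" "card X = 9" and GX: "\<And>g x. g \<in> G \<Longrightarrow> x \<in> X \<Longrightarrow> g x \<in> X"
    and b: "b \<in> G" "\<And>x. x \<in> X \<Longrightarrow> (b ^^ 7) x = x" "b x7 \<noteq> x7" "x7 \<in> X"
    and d: "d \<in> G" "\<And>x. x \<in> X \<Longrightarrow> (d ^^ 15) x = x"
      "\<And>x y. x \<in> X \<Longrightarrow> y \<in> X \<Longrightarrow> d x = x \<Longrightarrow> d y = y \<Longrightarrow> x = y"
      "(d ^^ 3) x5 \<noteq> x5" "x5 \<in> X"
    and n: "x \<in> X" "y \<in> X" "\<And>g. g \<in> derived_series G n \<Longrightarrow> g x = x"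
      "\<And>g. g \<in> derived_series G n \<Longrightarrow> g y = y"
  shows "x = y"
proof (rule ccontr)
  assume xy: "x \<noteq> y"
  define Z where "Z = (\<lambda>n. {x \<in> X. \<forall>g\<in>derived_series G n. g x = x})"
  define P where "P = (\<lambda>n. \<exists>x\<in>Z n. \<exists>y\<in>Z n. x \<noteq> y)"
  note D = perm_group_derived_series[OF G]
  note invs = perm_group_inv_apply[OF G]
  have "P n" unfolding P_def Z_def using n xy by blast
  then have PL: "P (LEAST n. P n)" by (rule LeastI)
  \<comment> \<open>The whole group contains \<open>d\<close>, which has at most one fixed point;
    hence the first term fixing two points has a predecessor.\<close>
  have "\<not> P 0" unfolding P_def Z_def using d(1,3) by auto
  with PL obtain m where m: "(LEAST n. P n) = Suc m" by (metis not0_implies_Suc)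
  have Pm: "\<not> P m" using not_less_Least[of m P] m by simp
  have PS: "P (Suc m)" using PL m by simp
  define N where "N = derived_series G m"
  have NG: "g \<in> G" if "g \<in> N" for g
    using derived_series_antimono[OF G, of 0 m] that unfolding N_def by auto
  note NX = GX[OF NG]
  note Ngrp = D[of m, folded N_def]
  have inj: "g u = g v \<Longrightarrow> u = v" if "g \<in> G" for g u v
    using invs[OF that] by metis
  define W where "W = Z (Suc m)"
  have WX: "W \<subseteq> X" by (auto simp: W_def Z_def)
  have finW: "finite W" using WX X finite_subset by blast
  have W_inv: "g z \<in> W" if g: "g \<in> G" and z: "z \<in> W" for g z
  proof -
    have "h (g z) = g z" if h: "h \<in> derived_series G (Suc m)" for h
    proof -
      have "inv g \<circ> h \<circ> inv (inv g) \<in> derived_series G (Suc m)"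
        by (rule derived_series_conj[OF G perm_groupD(3)[OF G g] h])
      then have "inv g (h (inv (inv g) z)) = z" using z unfolding W_def Z_def by force
      then have "inv g (h (g z)) = z" using perm_groupD(2)[OF G g] by (simp add: inv_inv_eq)
      then show ?thesis using invs[OF g] by metis
    qed
    then show ?thesis using g z GX unfolding W_def Z_def by blast
  qed
  have gW: "g ` W = W" if "g \<in> G" for g
    using W_inv[OF that] inj[OF that] finW by (intro card_subset_eq card_image) (auto intro: inj_onI)
  \<comment> \<open>On an invariant pair \<open>d ^^ 2\<close> is the identity. As 15 is odd,
    \<open>d ^^ 15 = id\<close> forces \<open>d\<close> to fix both points, one more than it
    may.\<close>
  have two: False if T: "T \<subseteq> X" "card T = 2" "d ` T \<subseteq> T" for T
  proof -
    obtain u v where uv: "T = {u, v}" "u \<noteq> v" using T(2) by (auto simp: card_2_iff)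
    have fixed: "d w = w" if w: "w \<in> T" for w
    proof -
      have "d (d w) = w"
        using w T(3) uv inj[OF d(1), of u v] by auto
      then have "(d ^^ 2) w = w" by (simp add: numeral_2_eq_2)
      from funpow_mod_eq[OF this, of 15] have "d w = (d ^^ 15) w" by simp
      then show ?thesis using d(2) w T(1) by auto
    qed
    then show False using d(3)[of u v] uv T(1) by auto
  qed
  have bX: "b ` X \<subseteq> X" using GX[OF b(1)] by auto
  have dX: "d ` X \<subseteq> X" using GX[OF d(1)] by auto
  define M7 where "M7 = {x \<in> X. b x \<noteq> x}"
  have M7: "card M7 = 7" "M7 = range (\<lambda>i. (b ^^ i) u)" if "u \<in> M7" for u
    using moved_eq_orbit[of 7 X b u] X bX b(2) that unfolding M7_def by auto
  have x7: "x7 \<in> M7" using b by (simp add: M7_def)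
  have cX7: "card (X - M7) = 2" using X M7(1)[OF x7] by (subst card_Diff_subset) (auto simp: M7_def)
  \<comment> \<open>If \<open>W\<close> avoids the 7-cycle, it is a \<open>d\<close>-invariant pair.
    If \<open>W\<close> meets the 7-cycle, it contains it, and at most two points remain: two would
    again be an invariant pair, and a single one would be fixed by all of \<open>G\<close> and so
    lie in \<open>W\<close>.\<close>
  have "W = X"
  proof (rule ccontr)
    assume WnX: "W \<noteq> X"
    show False
    proof (cases "M7 \<inter> W = {}")
      case True
      then have sub: "W \<subseteq> X - M7" using WX by blast
      obtain u v where "u \<in> W" "v \<in> W" "u \<noteq> v" using PS unfolding P_def W_def by blast
      then have "card {u, v} \<le> card W" using finW by (intro card_mono) auto
      then have "2 \<le> card W" using \<open>u \<noteq> v\<close> by simp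
      moreover have "card W \<le> 2" using card_mono[OF _ sub] X cX7 by simp
      ultimately show False using two[OF WX] gW[OF d(1)] by simp
    next
      case False
      then obtain u where u: "u \<in> M7" "u \<in> W" by blast
      have "(b ^^ i) u \<in> W" for i using W_inv[OF perm_group_funpow[OF G b(1)]] u by blast
      then have "M7 \<subseteq> W" using M7(2)[OF u(1)] by blast
      then have cc: "card (X - W) \<le> 2" using card_mono[of "X - M7" "X - W"] X cX7 by auto
      have dXW: "g ` (X - W) \<subseteq> X - W" if "g \<in> G" for g
        using gW[OF that] inj[OF that] GX[OF that] by blast
      have "card (X - W) \<noteq> 2" using two[of "X - W"] dXW[OF d(1)] by blast
      moreover have "card (X - W) \<noteq> 0" using WnX WX X by auto
      ultimately have "card (X - W) = 1" using cc by linarith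
      then obtain w where w: "X - W = {w}" by (auto simp: card_1_singleton_iff)
      have "g w = w" if "g \<in> derived_series G (Suc m)" for g
        using dXW[of g] derived_series_antimono[OF G, of 0 "Suc m"] that w by auto
      then have "w \<in> W" using w unfolding W_def Z_def by blast
      then show False using w by blast
    qed
  qed
  then have triv: "g u = u" if "g \<in> perm_derived N" "u \<in> X" for g u
    using that unfolding W_def Z_def N_def by auto
  have comm: "s (t u) = t (s u)" if st: "s \<in> N" "t \<in> N" and u: "u \<in> X" for s t u
  proof -
    have "(s \<circ> t \<circ> inv s \<circ> inv t) (t (s u)) = t (s u)"
      by (rule triv[OF perm_derived.commutator[OF st]]) (use NX st u in blast)
    then show ?thesis using invs NG st by simp
  qed
  have comm_pow: "(s ^^ i) (t u) = t ((s ^^ i) u)" if st: "s \<in> N" "t \<in> N" and u: "u \<in> X" for s t u i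
    using comm[OF perm_group_funpow[OF Ngrp st(1)] st(2) u] .
  define O' where "O' = (\<lambda>u. {t u | t. t \<in> N})"
  have O'X: "O' u \<subseteq> X" if "u \<in> X" for u using that NX by (auto simp: O'_def)
  have O'self: "u \<in> O' u" for u using perm_groupD(1)[OF Ngrp] unfolding O'_def by (auto intro!: exI[of _ id])
  have O'trans: "w \<in> O' v" if uw: "u \<in> O' v" "w \<in> O' u" for u v w
  proof -
    obtain s t where st: "s \<in> N" "t \<in> N" "u = s v" "w = t u" using uw unfolding O'_def by blast
    then have "w = (t \<circ> s) v" by simp
    then show ?thesis unfolding O'_def using perm_groupD(4)[OF Ngrp st(2,1)] by blast
  qed
  have O'sym: "u \<in> O' v" if vu: "v \<in> O' u" for u v
  proof -
    obtain s where s: "s \<in> N" "v = s u" using vu unfolding O'_def by blast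
    then have "u = inv s v" using invs NG by simp
    then show ?thesis unfolding O'_def using perm_groupD(3)[OF Ngrp s(1)] by blast
  qed
  have O'conj: "g v \<in> O' (g u)" if g: "g \<in> G" and vu: "v \<in> O' u" for g u v
  proof -
    obtain s where s: "s \<in> N" "v = s u" using vu unfolding O'_def by blast
    have "g \<circ> s \<circ> inv g \<in> N" using derived_series_conj[OF G g] s(1) unfolding N_def by blast
    moreover have "g v = (g \<circ> s \<circ> inv g) (g u)" using s invs[OF g] by simp
    ultimately show ?thesis unfolding O'_def by blast
  qed
  \<comment> \<open>The predecessor term \<open>N\<close> does not fix two points, so it moves one
    of any two points of the 7-cycle.\<close>
  obtain s0 t0 where s0: "s0 \<in> M7" "t0 \<in> N" "t0 s0 \<noteq> s0"
  proof -
    have "card M7 = 7" using M7(1)[OF x7] .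
    then obtain u v where "u \<in> M7" "v \<in> M7" "u \<noteq> v"
      using two_le_card_obtain[of M7] by auto
    then have "u \<notin> Z m \<or> v \<notin> Z m" using Pm unfolding P_def by blast
    then show ?thesis using that \<open>u \<in> M7\<close> \<open>v \<in> M7\<close> unfolding Z_def N_def M7_def by blast
  qed
  have s0X: "s0 \<in> X" using s0 by (simp add: M7_def)
  define B where "B = O' s0"
  have BX: "B \<subseteq> X" unfolding B_def by (rule O'X[OF s0X])
  have finB: "finite B" using BX X finite_subset by blast
  have t0B: "t0 s0 \<in> B" unfolding B_def O'_def using s0 by blast
  \<comment> \<open>\<open>G\<close> permutes the \<open>N\<close>-orbits. If \<open>t0 s0\<close>
    is fixed by \<open>b\<close>, the orbit through it is \<open>b\<close>-invariant. Otherwise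
    \<open>t0 s0\<close> equals \<open>(b ^^ k) s0\<close> with \<open>k\<close> prime to 7, so the
    orbit is invariant under \<open>b ^^ k\<close>, a generator of the 7-cycle.\<close>
  have "M7 \<subseteq> B"
  proof (cases "t0 s0 \<in> M7")
    case False
    then have "b (t0 s0) = t0 s0" using BX t0B by (auto simp: M7_def)
    then have fb: "(b ^^ i) (t0 s0) = t0 s0" for i by (induction i) auto
    have "(b ^^ i) s0 \<in> B" for i
    proof -
      have "t0 s0 \<in> O' ((b ^^ i) s0)"
        using O'conj[OF perm_group_funpow[OF G b(1), of i], of "t0 s0" s0] t0B unfolding fb B_def by simp
      then show ?thesis using O'trans O'sym t0B unfolding B_def by blast
    qed
    then show ?thesis using M7(2)[OF s0(1)] by blast
  next
    case True
    then obtain k where k: "t0 s0 = (b ^^ k) s0" using M7(2)[OF s0(1)] by blast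
    have "\<not> 7 dvd k"
    proof
      assume "7 dvd k"
      then have "(b ^^ k) s0 = s0" using funpow_mod_eq[OF b(2)[OF s0X], of k] by auto
      then show False using k s0 by simp
    qed
    then have "coprime k 7" using prime_imp_coprime[of 7 k] by (simp add: coprime_commute)
    then obtain a where a: "[k * a = Suc 0] (mod 7)" using cong_solve_coprime_nat by blast
    have "(b ^^ (k * j)) s0 \<in> B" for j
    proof (induction j)
      case 0 then show ?case using O'self by (simp add: B_def)
    next
      case (Suc j)
      have "(b ^^ k) ((b ^^ (k * j)) s0) \<in> O' ((b ^^ k) s0)"
        using O'conj[OF perm_group_funpow[OF G b(1)]] Suc unfolding B_def by blast
      then have "(b ^^ (k * Suc j)) s0 \<in> O' (t0 s0)" by (simp add: k funpow_add)
      then show ?case using t0B O'trans unfolding B_def by blast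
    qed
    note kj = this
    have "(b ^^ i) s0 \<in> B" for i
    proof -
      have "[k * (a * i) = Suc 0 * i] (mod 7)" using cong_scalar_right[OF a, of i] by (simp add: mult.assoc)
      then have "(b ^^ i) s0 = (b ^^ (k * (a * i))) s0"
        using funpow_mod_eq[OF b(2)[OF s0X], of i] funpow_mod_eq[OF b(2)[OF s0X], of "k * (a * i)"]
        by (simp add: cong_def)
      then show ?thesis using kj by simp
    qed
    then show ?thesis using M7(2)[OF s0(1)] by blast
  qed
  then have cXB: "card (X - B) \<le> 2" using card_mono[of "X - M7" "X - B"] X cX7 by auto
  define c where "c = d ^^ 3"
  have c: "c \<in> G" unfolding c_def by (rule perm_group_funpow[OF G d(1)])
  have cX: "c ` X \<subseteq> X" using GX[OF c] by auto
  have c5: "(c ^^ 5) u = u" if "u \<in> X" for u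
    using d(2)[OF that] by (simp add: c_def funpow_mult)
  define M5 where "M5 = {x \<in> X. c x \<noteq> x}"
  have M5: "card M5 = 5" "M5 = range (\<lambda>i. (c ^^ i) u)" if "u \<in> M5" for u
    using moved_eq_orbit[of 5 X c u] X cX c5 that unfolding M5_def by auto
  have x5: "x5 \<in> M5" using d by (simp add: M5_def c_def)
  have M5X: "M5 \<subseteq> X" by (auto simp: M5_def)
  have cX5: "card (X - M5) = 4" using X M5(1)[OF x5] by (subst card_Diff_subset) (auto simp: M5_def)
  \<comment> \<open>Four points are fixed by \<open>c\<close>, and at most two points lie outside
    \<open>B\<close>.\<close>
  obtain o1 o2 where o: "o1 \<in> B - M5" "o2 \<in> B - M5" "o1 \<noteq> o2"
  proof -
    have "card (X - M5) \<le> card ((B - M5) \<union> (X - B))" using finB X(1) by (intro card_mono) auto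
    then have "card (X - M5) \<le> card (B - M5) + card (X - B)"
      using card_Un_le[of "B - M5" "X - B"] by linarith
    then have "2 \<le> card (B - M5)" using cXB cX5 by simp
    then show ?thesis using that by (rule two_le_card_obtain)
  qed
  have oX: "o1 \<in> X" "o2 \<in> X" using o BX by auto
  have co: "c o1 = o1" "c o2 = o2" using o oX by (auto simp: M5_def)
  have BO: "B = O' u" if "u \<in> B" for u using that O'trans O'sym unfolding B_def by blast
  have cB: "c u \<in> B" if "u \<in> B" for u
    using O'conj[OF c, of u o1] that BO[of o1] o co by auto
  obtain t where t: "t \<in> N" "t o1 = o2" using BO[of o1] o unfolding O'_def by blast
  have tB: "t u \<in> B" if "u \<in> B" for u using BO[OF that] t(1) unfolding O'_def by blast
  \<comment> \<open>The conjugate of \<open>t\<close> by \<open>c\<close> also lies in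
    \<open>N\<close> and takes \<open>o1\<close> to \<open>o2\<close>. An element of a commutative
    transitive group is determined by one value, so it agrees with \<open>t\<close> on all of
    \<open>B\<close>.\<close>
  have tc: "t (c u) = c (t u)" if u: "u \<in> B" for u
  proof -
    define t' where "t' = c \<circ> t \<circ> inv c"
    have t': "t' \<in> N" using derived_series_conj[OF G c] t(1) unfolding N_def t'_def by blast
    have "inv c o1 = o1" using invs[OF c] co by metis
    then have t'o: "t' o1 = o2" by (simp add: t'_def t(2) co)
    obtain r where r: "r \<in> N" "c u = r o1" using BO[of o1] cB[OF u] o unfolding O'_def by blast
    have "t (c u) = r (t o1)" using comm[OF t(1) r(1) oX(1)] r(2) by simp
    also have "\<dots> = r (t' o1)" using t t'o by simp
    also have "\<dots> = t' (c u)" using comm[OF t' r(1) oX(1)] r(2) by simp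
    also have "\<dots> = c (t u)" using invs[OF c] by (simp add: t'_def)
    finally show ?thesis .
  qed
  have cB_pow: "(c ^^ i) u \<in> B" if "u \<in> B" for u i using that cB by (induction i) auto
  have tc_pow: "t ((c ^^ i) u) = (c ^^ i) (t u)" if u: "u \<in> B" for u i
    using u by (induction i) (auto simp: tc cB_pow)
  have tB_pow: "(t ^^ i) u \<in> B" if "u \<in> B" for u i using that tB by (induction i) auto
  have ct_pow: "c ((t ^^ i) u) = (t ^^ i) (c u)" if u: "u \<in> B" for u i
    using u by (induction i) (auto simp: tc[symmetric] tB_pow)
  have "M5 \<inter> B \<noteq> {}"
  proof
    assume "M5 \<inter> B = {}"
    then have "card M5 \<le> card (X - B)" using M5X X by (intro card_mono) auto
    then show False using cXB M5(1)[OF x5] by simp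
  qed
  then obtain u where u: "u \<in> M5" "u \<in> B" by blast
  have "c (t u) \<noteq> t u"
  proof
    assume "c (t u) = t u"
    then have "t (c u) = t u" using tc[OF u(2)] by simp
    then have "c u = u" using inj[OF NG[OF t(1)]] by blast
    then show False using u by (simp add: M5_def)
  qed
  then have "t u \<in> M5" using tB[OF u(2)] BX by (auto simp: M5_def)
  then obtain k where k: "t u = (c ^^ k) u" using M5(2)[OF u(1)] by blast
  have ti: "(t ^^ i) u = (c ^^ (k * i)) u" for i
  proof (induction i)
    case (Suc i)
    have "(t ^^ Suc i) u = (c ^^ (k * i)) (t u)" using Suc tc_pow[OF u(2)] by simp
    also have "\<dots> = (c ^^ (k * i + k)) u" by (simp add: k funpow_add)
    finally show ?case by (simp add: add.commute)
  qed simp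
  have t5u: "(t ^^ 5) u = u"
    using ti[of 5] funpow_mod_eq[OF c5, of u "k * 5"] u BX by auto
  obtain r where r: "r \<in> N" "o1 = r u" using BO[OF u(2)] o unfolding O'_def by blast
  have uX: "u \<in> X" using u BX by blast
  \<comment> \<open>The period 5 passes from \<open>u\<close> to \<open>o1\<close> along an element
    of \<open>N\<close>, because \<open>N\<close> commutes. As \<open>t\<close> moves
    \<open>o1\<close> to \<open>o2\<close>, five distinct points arise, all fixed by
    \<open>c\<close>.\<close>
  have t5o: "(t ^^ 5) o1 = o1" using comm_pow[OF t(1) r(1) uX, of 5] t5u r(2) by simp
  have "inj_on (\<lambda>i. (t ^^ i) o1) {..<5}"
    by (rule inj_on_funpow_prime[OF _ t5o]) (use t o in auto)
  then have "card ((\<lambda>i. (t ^^ i) o1) ` {..<5}) = 5" by (simp add: card_image)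
  moreover have "(\<lambda>i. (t ^^ i) o1) ` {..<5} \<subseteq> X - M5"
    using ct_pow[of o1] tB_pow[of o1] o co BX by (auto simp: M5_def)
  ultimately show False using card_mono[of "X - M5" "(\<lambda>i. (t ^^ i) o1) ` {..<5}"] X cX5 by simp
qed

section \<open>Radicals are fixed by a derived subgroup\<close>

lemma perm_group_alg_auts: "perm_group alg_auts"
  unfolding perm_group_def using alg_auts_closed alg_autsD(1) by blast

lemma alg_auts_hom:
  assumes s: "s \<in> alg_auts" and alg: "algebraic x" "algebraic y"
  shows "s (x + y) = s x + s y" "s (x - y) = s x - s y" "s (x * y) = s x * s y"
    "s (x ^ n) = s x ^ n" "s (of_int k) = of_int k" "s (x / y) = s x / s y" "s 0 = 0"
proof -
  note R = emb_relD(1)[OF emb_rel_alg_auts[OF s]]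
  show "s (x + y) = s x + s y" using ring_rel_add[OF R, of x "s x" y "s y"] alg by simp
  show "s (x - y) = s x - s y" "s (x * y) = s x * s y" using alg_autsD(5,6)[OF s alg] by auto
  show "s (x ^ n) = s x ^ n" using ring_rel_power[OF R, of x "s x" n] alg by simp
  show "s (of_int k) = of_int k" using ring_rel_of_int[OF R, of k] by simp
  show s0: "s 0 = 0" using ring_rel_zero[OF R] by simp
  show "s (x / y) = s x / s y"
  proof (cases "y = 0")
    case True then show ?thesis by (simp add: s0)
  next
    case False
    then have "s y \<noteq> 0" using s0 bij_is_inj[OF alg_autsD(1)[OF s]] by (metis injD)
    moreover have "s x = s (x / y) * s y"
      using alg_autsD(6)[OF s algebraic_divide[OF alg] alg(2)] False by simp
    ultimately show ?thesis by (simp add: field_simps)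
  qed
qed

lemma algebraic_pow_root: "algebraic (x ^ k) \<Longrightarrow> k > 0 \<Longrightarrow> algebraic (x :: complex)"
  by (rule algebraic_root[of "x ^ k" "monom 1 k"]) (auto simp: poly_monom degree_monom_eq)

text \<open>All \<open>k\<close>-th roots of unity are powers of one of them, on which an
  automorphism acts by raising to a power; such exponents commute.\<close>

lemma alg_auts_commute_root_of_unity:
  assumes s: "s \<in> alg_auts" and t: "t \<in> alg_auts" and k: "k > 0" and z: "z ^ k = 1"
  shows "s (t z) = t (s z)"
proof -
  define e where "e = exp (2 * of_real pi * \<i> / of_nat k)"
  have pow: "\<exists>j. w = e ^ j" if "w ^ k = 1" for w
  proof -
    have "w \<in> {w. w ^ k = 1}" using that by simp
    then obtain j where "w = exp (2 * of_real pi * \<i> * of_nat j / of_nat k)"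
      using complex_roots_unity[of k] k by auto
    then have "w = e ^ j" by (simp add: e_def exp_of_nat_mult[symmetric] mult_ac)
    then show ?thesis ..
  qed
  have "e ^ k = 1" using k by (simp add: e_def exp_of_nat_mult[symmetric])
  then have e: "algebraic e" using algebraic_pow_root[of e k] k by simp
  have "(s e) ^ k = 1" "(t e) ^ k = 1"
    using alg_auts_hom(4)[OF s e e, of k] alg_auts_hom(4)[OF t e e, of k] \<open>e ^ k = 1\<close> alg_autsD(4)[OF s] alg_autsD(4)[OF t] by auto
  then obtain a b where ab: "s e = e ^ a" "t e = e ^ b" using pow by metis
  obtain j where "z = e ^ j" using pow[OF z] ..
  then show ?thesis
    by (simp add: alg_auts_hom(4)[OF s e e] alg_auts_hom(4)[OF t e e] ab mult_ac flip: power_mult)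
qed

lemma commutator_fixes:
  assumes H: "perm_group H" and s: "s \<in> H" "t \<in> H" and c: "s (t (inv s (inv t z))) = t (s (inv s (inv t z)))"
  shows "(s \<circ> t \<circ> inv s \<circ> inv t) z = z"
  using c perm_group_inv_apply[OF H s(1)] perm_group_inv_apply[OF H s(2)] by simp

lemma derived_fixes_root_of_unity:
  assumes "s \<in> perm_derived alg_auts" "k > 0" "z ^ k = 1"
  shows "s z = z"
  using assms(1)
proof induction
  case (commutator s t)
  note i = alg_auts_closed(2)[OF commutator(1)] alg_auts_closed(2)[OF commutator(2)]
  have z: "algebraic z" using algebraic_pow_root[of z k] assms by simp
  have z': "algebraic (inv t z)" using alg_autsD(2)[OF i(2)] z by simp
  have "(inv s (inv t z)) ^ k = 1"
    using alg_auts_hom(4)[OF i(1) z' z', of k] alg_auts_hom(4)[OF i(2) z z, of k] assms(3) alg_autsD(4)[OF i(1)] alg_autsD(4)[OF i(2)]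
    by simp
  from alg_auts_commute_root_of_unity[OF commutator assms(2) this]
  show ?case by (rule commutator_fixes[OF perm_group_alg_auts commutator])
qed simp

text \<open>The members of the first derived group fix all roots of unity, so they act on a \<open>k\<close>-th root
  of a fixed number by multiplication with roots of unity, and these actions commute.\<close>

lemma derived_fixes_root:
  assumes k: "k > 0" and z: "algebraic z"
    and fixed: "\<And>s. s \<in> derived_series alg_auts (Suc n) \<Longrightarrow> s (z ^ k) = z ^ k"
    and s: "s \<in> derived_series alg_auts (Suc (Suc n))"
  shows "s z = z"
proof -
  define H where "H = derived_series alg_auts (Suc n)"
  have H: "perm_group H" unfolding H_def by (rule perm_group_derived_series[OF perm_group_alg_auts])
  have HG: "s \<in> alg_auts" if "s \<in> H" for s
    using derived_series_antimono[OF perm_group_alg_auts, of 0 "Suc n"] that unfolding H_def by auto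
  have HD: "s \<in> perm_derived alg_auts" if "s \<in> H" for s
    using derived_series_antimono[OF perm_group_alg_auts, of 1 "Suc n"] that unfolding H_def by auto
  \<comment> \<open>Stated for every \<open>w\<close> sharing its \<open>k\<close>-th power with
    \<open>z\<close>, since the commutator of \<open>s\<close> and \<open>t\<close> is evaluated via
    the point \<open>inv s (inv t z)\<close>.\<close>
  have comm: "s (t w) = t (s w)" if st: "s \<in> H" "t \<in> H" and w: "w ^ k = z ^ k" "algebraic w" for s t w
  proof (cases "w = 0")
    case True
    then show ?thesis using alg_auts_hom(7)[OF HG[OF st(1)] z z] alg_auts_hom(7)[OF HG[OF st(2)] z z] by simp
  next
    case False
    have chi: "\<exists>c. r w = c * w \<and> c ^ k = 1 \<and> algebraic c" if r: "r \<in> H" for r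
    proof -
      have "(r w) ^ k = w ^ k"
        using alg_auts_hom(4)[OF HG[OF r] w(2) w(2), of k] fixed[OF r[unfolded H_def]] w(1) by simp
      then have "(r w / w) ^ k = 1" using False by (simp add: power_divide)
      moreover have "algebraic (r w / w)" using w(2) alg_autsD(2)[OF HG[OF r]] by (intro algebraic_divide) auto
      ultimately show ?thesis using False by (intro exI[of _ "r w / w"]) auto
    qed
    obtain a where a: "s w = a * w" "a ^ k = 1" "algebraic a" using chi[OF st(1)] by blast
    obtain b where b: "t w = b * w" "b ^ k = 1" "algebraic b" using chi[OF st(2)] by blast
    have "s (t w) = b * (a * w)"
      using alg_auts_hom(3)[OF HG[OF st(1)] b(3) w(2)] derived_fixes_root_of_unity[OF HD[OF st(1)] k b(2)] a b by simp
    moreover have "t (s w) = a * (b * w)"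
      using alg_auts_hom(3)[OF HG[OF st(2)] a(3) w(2)] derived_fixes_root_of_unity[OF HD[OF st(2)] k a(2)] a b by simp
    ultimately show ?thesis by simp
  qed
  have "s \<in> perm_derived H" using s unfolding H_def by simp
  then show ?thesis
  proof induction
    case (commutator s t)
    note i = perm_groupD(3)[OF H commutator(1)] perm_groupD(3)[OF H commutator(2)]
    have z': "algebraic (inv t z)" using alg_autsD(2)[OF HG[OF i(2)]] z by simp
    have z'': "algebraic (inv s (inv t z))" using alg_autsD(2)[OF HG[OF i(1)]] z' by simp
    have "(inv s (inv t z)) ^ k = z ^ k"
      using alg_auts_hom(4)[OF HG[OF i(1)] z' z', of k] alg_auts_hom(4)[OF HG[OF i(2)] z z, of k]
        fixed[OF i(1)[unfolded H_def]] fixed[OF i(2)[unfolded H_def]] by simp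
    from comm[OF commutator this z''] show ?case by (rule commutator_fixes[OF H commutator])
  qed simp
qed

lemma cnj_alg_aut: "(\<lambda>z. if algebraic z then cnj z else z) \<in> alg_auts" (is "?c \<in> _")
proof -
  have "?c (?c z) = z" for z by simp
  then have "bij ?c" by (intro o_bij[of ?c]) (simp_all add: fun_eq_iff)
  then show ?thesis unfolding alg_auts_def
    using algebraic_diff_mult by auto
qed

theorem radical_computable_fixed:
  assumes "z \<in> radical_computable"
  shows "algebraic z \<and> (\<exists>n. \<forall>s\<in>derived_series alg_auts n. s z = z)"
  using assms
proof induction
  case (int_const k)
  have "s (of_int k) = of_int k" if "s \<in> derived_series alg_auts 0" for s
    using alg_auts_hom(5)[of s 0 0 k] that by simp
  then show ?case using algebraic_of_int by blast
next
  case (root k z)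
  then obtain n where n: "\<And>s. s \<in> derived_series alg_auts n \<Longrightarrow> s (z ^ k) = z ^ k" by blast
  have z: "algebraic z" using root algebraic_pow_root by blast
  \<comment> \<open>The first additional term guarantees that roots of unity are fixed even if
    \<open>n\<close> is 0; the second contains the commutators, which act trivially on the
    root.\<close>
  have "s z = z" if "s \<in> derived_series alg_auts (Suc (Suc n))" for s
  proof (rule derived_fixes_root[OF root(1) z _ that])
    show "r (z ^ k) = z ^ k" if "r \<in> derived_series alg_auts (Suc n)" for r
      using n derived_series_antimono[OF perm_group_alg_auts, of n "Suc n"] that by auto
  qed
  then show ?case using z by blast
next
  case (conj x)
  then obtain n where n: "\<And>s. s \<in> derived_series alg_auts n \<Longrightarrow> s x = x" by blast
  define c where "c = (\<lambda>z. if algebraic z then cnj z else z)"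
  have c: "c \<in> alg_auts" unfolding c_def by (rule cnj_alg_aut)
  have cc: "c (c z) = z" for z by (simp add: c_def)
  then have ci: "inv c = c" by (intro inv_equality) (auto simp only:)
  have "s (cnj x) = cnj x" if s: "s \<in> derived_series alg_auts n" for s
  proof -
    \<comment> \<open>Conjugation is itself an automorphism, and the terms of the derived series are
      normal.\<close>
    have "c \<circ> s \<circ> inv c \<in> derived_series alg_auts n"
      by (rule derived_series_conj[OF perm_group_alg_auts c s])
    then have "c (s (c x)) = x" using n[of "c \<circ> s \<circ> inv c"] ci by simp
    then have "s (c x) = c x" using cc by metis
    then show ?thesis using conj by (simp add: c_def)
  qed
  then show ?case using conj by auto
next
  case (add x y)
  then obtain m n where mn: "\<forall>s\<in>derived_series alg_auts m. s x = x" "\<forall>s\<in>derived_series alg_auts n. s y = y" by blast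
  have "s (x + y) = x + y" if "s \<in> derived_series alg_auts (max m n)" for s
    using that mn add alg_auts_hom(1)[of s x y] derived_series_antimono[OF perm_group_alg_auts, of _ "max m n"]
    by (metis funpow_0 le0 max.cobounded1 max.cobounded2 subsetD)
  then show ?case using add algebraic_add by blast
next
  case (diff x y)
  then obtain m n where mn: "\<forall>s\<in>derived_series alg_auts m. s x = x" "\<forall>s\<in>derived_series alg_auts n. s y = y" by blast
  have "s (x - y) = x - y" if "s \<in> derived_series alg_auts (max m n)" for s
    using that mn diff alg_auts_hom(2)[of s x y] derived_series_antimono[OF perm_group_alg_auts, of _ "max m n"]
    by (metis funpow_0 le0 max.cobounded1 max.cobounded2 subsetD)
  then show ?case using diff algebraic_diff_mult by blast
next
  case (mult x y)
  then obtain m n where mn: "\<forall>s\<in>derived_series alg_auts m. s x = x" "\<forall>s\<in>derived_series alg_auts n. s y = y" by blast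
  have "s (x * y) = x * y" if "s \<in> derived_series alg_auts (max m n)" for s
    using that mn mult alg_auts_hom(3)[of s x y] derived_series_antimono[OF perm_group_alg_auts, of _ "max m n"]
    by (metis funpow_0 le0 max.cobounded1 max.cobounded2 subsetD)
  then show ?case using mult algebraic_diff_mult by blast
next
  case (divide x y)
  then obtain m n where mn: "\<forall>s\<in>derived_series alg_auts m. s x = x" "\<forall>s\<in>derived_series alg_auts n. s y = y" by blast
  have "s (x / y) = x / y" if "s \<in> derived_series alg_auts (max m n)" for s
    using that mn divide alg_auts_hom(6)[of s x y] derived_series_antimono[OF perm_group_alg_auts, of _ "max m n"]
    by (metis funpow_0 le0 max.cobounded1 max.cobounded2 subsetD)
  then show ?case using divide algebraic_divide by blast
qed

section \<open>Frobenius automorphisms\<close>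

lemma algebraic_int_of_int: "algebraic_int (of_int n :: complex)"
  and algebraic_int_of_nat: "algebraic_int (of_nat k :: complex)"
  by (intro int_imp_algebraic_int; simp)+

lemma ring_rel_algebraic_int: "ring_rel (\<lambda>a b :: complex. a = b \<and> algebraic_int a)"
  unfolding ring_rel_def using algebraic_int_of_int[of 1] algebraic_int_add_mult algebraic_int_diff by auto

lemma algebraic_int_power: "algebraic_int x \<Longrightarrow> algebraic_int (x ^ n)" for x :: complex
  using ring_rel_power[OF ring_rel_algebraic_int, of x x n] by simp

text \<open>A prime ideal over \<open>p\<close> in the ring of all algebraic integers; this one ring
  serves all polynomials, so no number field has to be singled out.\<close>

locale prime_over =
  fixes p :: nat and m :: "complex set"
  assumes prime: "prime p"
    and alg_int: "x \<in> m \<Longrightarrow> algebraic_int x"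
    and diff: "x \<in> m \<Longrightarrow> y \<in> m \<Longrightarrow> x - y \<in> m"
    and smult: "x \<in> m \<Longrightarrow> algebraic_int r \<Longrightarrow> r * x \<in> m"
    and p_in: "of_nat p \<in> m"
    and one: "1 \<notin> m"
    and prime_ideal: "algebraic_int x \<Longrightarrow> algebraic_int y \<Longrightarrow> x * y \<in> m \<Longrightarrow> x \<in> m \<or> y \<in> m"

text \<open>A maximal ideal above \<open>p\<close> is obtained from Zorn's lemma. The ideal
  generated by \<open>p\<close> is proper because \<open>1 / p\<close> is rational but no integer,
  hence no algebraic integer.\<close>

lemma prime_over_exists:
  assumes p: "prime p"
  shows "\<exists>m. prime_over p m"
proof -
  define ideal where "ideal = (\<lambda>I :: complex set. (\<forall>x\<in>I. algebraic_int x) \<and> (\<forall>x\<in>I. \<forall>y\<in>I. x - y \<in> I) \<and>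
     (\<forall>x\<in>I. \<forall>r. algebraic_int r \<longrightarrow> r * x \<in> I))"
  define A where "A = {I. ideal I \<and> of_nat p \<in> I \<and> 1 \<notin> I}"
  have "\<exists>M\<in>A. \<forall>X\<in>A. M \<subseteq> X \<longrightarrow> X = M"
  proof (rule subset_Zorn_nonempty)
    define I0 where "I0 = {r * of_nat p :: complex | r. algebraic_int r}"
    have "ideal I0"
      unfolding ideal_def
    proof (intro conjI ballI allI impI)
      fix x assume "x \<in> I0"
      then obtain r where r: "x = r * of_nat p" "algebraic_int r" unfolding I0_def by blast
      show "algebraic_int x" unfolding r(1) using r(2) algebraic_int_add_mult algebraic_int_of_nat by blast
      show "s * x \<in> I0" if "algebraic_int s" for s
        unfolding I0_def using r that algebraic_int_add_mult by (auto simp: mult.assoc[symmetric])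
      fix y assume "y \<in> I0"
      then obtain s where s: "y = s * of_nat p" "algebraic_int s" unfolding I0_def by blast
      then have "x - y = (r - s) * of_nat p" using r by (simp add: left_diff_distrib)
      then show "x - y \<in> I0" unfolding I0_def using algebraic_int_diff[OF r(2) s(2)] by blast
    qed
    moreover have "of_nat p \<in> I0" unfolding I0_def using algebraic_int_of_nat[of 1] by force
    moreover have "1 \<notin> I0"
    proof
      assume "1 \<in> I0"
      then obtain r :: complex where r: "1 = r * of_nat p" "algebraic_int r" unfolding I0_def by blast
      then have "r = 1 / of_nat p" using prime_gt_0_nat[OF p] by (simp add: field_simps)
      then have "r \<in> \<rat>" by simp
      then have "r \<in> \<int>" using r(2) rational_algebraic_int_is_int by blast
      then obtain k where "r = of_int k" by (rule Ints_cases)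
      then have "(of_int 1 :: complex) = of_int (k * int p)" using r(1) by simp
      then have "1 = k * int p" by (simp only: of_int_eq_iff)
      then have "int p dvd 1" by (metis dvd_triv_right)
      then show False using prime_gt_1_nat[OF p] by simp
    qed
    ultimately show "A \<noteq> {}" unfolding A_def by blast
    fix C assume C: "C \<noteq> {}" "subset.chain A C"
    have CA: "T \<in> A" if "T \<in> C" for T using C(2) that by (auto simp: subset.chain_def)
    have two: "\<exists>T\<in>C. u \<in> T \<and> v \<in> T" if "u \<in> \<Union>C" "v \<in> \<Union>C" for u v
      using that C(2) unfolding subset.chain_def by blast
    have "ideal (\<Union>C)"
      unfolding ideal_def
    proof (intro conjI ballI allI impI)
      fix x assume x: "x \<in> \<Union>C"
      then obtain T where T: "T \<in> C" "x \<in> T" by blast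
      then show "algebraic_int x" using CA unfolding A_def ideal_def by blast
      show "r * x \<in> \<Union>C" if "algebraic_int r" for r using T CA that unfolding A_def ideal_def by blast
      fix y assume "y \<in> \<Union>C"
      then obtain T where "T \<in> C" "x \<in> T" "y \<in> T" using two x by blast
      then show "x - y \<in> \<Union>C" using CA unfolding A_def ideal_def by blast
    qed
    then show "\<Union>C \<in> A" using CA C(1) unfolding A_def by blast
  qed
  then obtain M where M: "M \<in> A" "\<And>X. X \<in> A \<Longrightarrow> M \<subseteq> X \<Longrightarrow> X = M" by blast
  have idM: "x \<in> M \<Longrightarrow> algebraic_int x" "x \<in> M \<Longrightarrow> y \<in> M \<Longrightarrow> x - y \<in> M"
    "x \<in> M \<Longrightarrow> algebraic_int r \<Longrightarrow> r * x \<in> M" for x y r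
    using M(1) unfolding A_def ideal_def by blast+
  have pM: "of_nat p \<in> M" "1 \<notin> M" using M(1) unfolding A_def by blast+
  have zero: "0 \<in> M" using idM(2)[OF pM(1) pM(1)] by simp
  have addM: "x + y \<in> M" if "x \<in> M" "y \<in> M" for x y
    using idM(2)[OF that(1) idM(2)[OF zero that(2)]] by simp
  \<comment> \<open>Modulo a maximal ideal every element outside it is invertible; multiplying two
    such identities shows that the ideal is prime.\<close>
  have unit: "\<exists>i\<in>M. \<exists>r. algebraic_int r \<and> 1 = i + r * a" if a: "algebraic_int a" "a \<notin> M" for a
  proof (rule ccontr)
    assume no: "\<not> ?thesis"
    define J where "J = {i + r * a | i r. i \<in> M \<and> algebraic_int r}"
    have "ideal J"
      unfolding ideal_def
    proof (intro conjI ballI allI impI)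
      fix x assume "x \<in> J"
      then obtain i r where r: "x = i + r * a" "i \<in> M" "algebraic_int r" unfolding J_def by blast
      show "algebraic_int x" unfolding r(1) using r a idM(1) algebraic_int_add_mult by blast
      show "s * x \<in> J" if s: "algebraic_int s" for s
      proof -
        have "s * x = s * i + (s * r) * a" by (simp add: r algebra_simps)
        then show ?thesis unfolding J_def using idM(3)[OF r(2) s] algebraic_int_add_mult s r(3) by blast
      qed
      fix y assume "y \<in> J"
      then obtain j s where s: "y = j + s * a" "j \<in> M" "algebraic_int s" unfolding J_def by blast
      then have "x - y = (i - j) + (r - s) * a" using r by (simp add: algebra_simps)
      then show "x - y \<in> J" unfolding J_def using idM(2)[OF r(2) s(2)] algebraic_int_diff[OF r(3) s(3)] by blast
    qed
    moreover have "M \<subseteq> J"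
    proof
      fix x assume "x \<in> M"
      moreover have "x = x + 0 * a" by simp
      ultimately show "x \<in> J" unfolding J_def using algebraic_int_0 by blast
    qed
    moreover have "1 \<notin> J" using no unfolding J_def by blast
    ultimately have "J \<in> A" unfolding A_def using pM by blast
    then have "J = M" using M(2) \<open>M \<subseteq> J\<close> by blast
    moreover have "a \<in> J" unfolding J_def using zero algebraic_int_of_int[of 1] by force
    ultimately show False using a by simp
  qed
  have "x \<in> M \<or> y \<in> M" if xy: "algebraic_int x" "algebraic_int y" "x * y \<in> M" for x y
  proof (rule ccontr)
    assume "\<not> ?thesis"
    then obtain i r j s where ir: "i \<in> M" "algebraic_int r" "1 = i + r * x" "j \<in> M" "algebraic_int s" "1 = j + s * y"
      using unit[of x] unit[of y] xy by blast
    have "1 = (i + r * x) * (j + s * y)" using ir by simp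
    also have "\<dots> = (j + s * y) * i + ((r * x) * j + (r * s) * (x * y))" by (simp add: algebra_simps)
    also have "\<dots> \<in> M"
      by (intro addM idM(3) ir(1,2,4,5) xy algebraic_int_add_mult[THEN conjunct1]
          algebraic_int_add_mult[THEN conjunct2] idM(1)[OF ir(4)])
    finally show False using pM by simp
  qed
  then have "prime_over p M" using idM pM p by unfold_locales auto
  then show ?thesis ..
qed

context prime_over
begin

lemma zero: "0 \<in> m"
  using diff[OF p_in p_in] by simp

lemma uminus: "x \<in> m \<Longrightarrow> - x \<in> m"
  using diff[OF zero] by fastforce

lemma add: "x \<in> m \<Longrightarrow> y \<in> m \<Longrightarrow> x + y \<in> m"
  using diff[of x "- y"] uminus[of y] by simp

lemma smult_right: "x \<in> m \<Longrightarrow> algebraic_int r \<Longrightarrow> x * r \<in> m"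
  using smult[of x r] by (simp add: mult.commute)

lemma sum_in: "(\<And>i. i \<in> I \<Longrightarrow> f i \<in> m) \<Longrightarrow> sum f I \<in> m"
  by (induction I rule: infinite_finite_induct) (auto intro: add zero)

lemma of_int_in_iff: "of_int k \<in> m \<longleftrightarrow> int p dvd k"
proof
  assume k: "of_int k \<in> m"
  show "int p dvd k"
  proof (rule ccontr)
    assume "\<not> int p dvd k"
    then have "coprime (int p) k" using prime by (simp add: prime_imp_coprime)
    then obtain u v where uv: "u * int p + v * k = 1"
      using bezout_int[of "int p" k] by (auto simp: coprime_iff_gcd_eq_1)
    have "of_int u * of_nat p + of_int v * of_int k \<in> m"
      by (intro add smult k p_in algebraic_int_of_int)
    moreover have "of_int u * of_nat p + of_int v * of_int k = (of_int (u * int p + v * k) :: complex)" by simp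
    ultimately show False using one uv by simp
  qed
next
  assume "int p dvd k"
  then obtain j where "k = int p * j" by blast
  then show "of_int k \<in> m" using smult[OF p_in algebraic_int_of_int[of j]] by (simp add: mult.commute)
qed

lemma freshman:
  assumes "algebraic_int x" "algebraic_int y"
  shows "(x + y) ^ p - x ^ p - y ^ p \<in> m"
proof -
  have "(x + y) ^ p = (\<Sum>k\<le>p. of_nat (p choose k) * x ^ k * y ^ (p - k))" by (rule binomial_ring)
  also have "\<dots> = (\<Sum>k\<in>{..p} - {0, p}. of_nat (p choose k) * x ^ k * y ^ (p - k)) +
      (\<Sum>k\<in>{0, p}. of_nat (p choose k) * x ^ k * y ^ (p - k))"
    by (rule sum.subset_diff) auto
  also have "(\<Sum>k\<in>{0, p}. of_nat (p choose k) * x ^ k * y ^ (p - k)) = y ^ p + x ^ p"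
    using prime_gt_0_nat[OF prime] by simp
  finally have "(x + y) ^ p - x ^ p - y ^ p = (\<Sum>k\<in>{..p} - {0, p}. of_nat (p choose k) * x ^ k * y ^ (p - k))"
    by simp
  also have "\<dots> \<in> m"
  proof (rule sum_in)
    fix k assume "k \<in> {..p} - {0, p}"
    then have "p dvd (p choose k)" using prime by (intro dvd_choose_prime) auto
    then have "(of_nat (p choose k) :: complex) \<in> m" using of_int_in_iff[of "int (p choose k)"] by simp
    then show "of_nat (p choose k) * x ^ k * y ^ (p - k) \<in> m"
      using assms by (intro smult_right algebraic_int_power)
  qed
  finally show ?thesis .
qed

text \<open>A relation because \<open>b\<close> is determined by \<open>a\<close> only modulo
  \<open>m\<close>. Lifted to polynomials it acts on the coefficients and leaves the variable
  alone.\<close>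

definition frob :: "complex \<Rightarrow> complex \<Rightarrow> bool" where
  "frob a b \<longleftrightarrow> algebraic_int a \<and> algebraic_int b \<and> b - a ^ p \<in> m"

lemma ring_rel_frob: "ring_rel frob"
  unfolding ring_rel_def
proof (intro conjI allI impI)
  show "frob 1 1" unfolding frob_def using algebraic_int_of_int[of 1] zero by simp
  fix a b c d assume "frob a b" "frob c d"
  then have ab: "algebraic_int a" "algebraic_int b" "b - a ^ p \<in> m"
    and cd: "algebraic_int c" "algebraic_int d" "d - c ^ p \<in> m" by (auto simp: frob_def)
  \<comment> \<open>Splitting \<open>a\<close> as \<open>(a - c) + c\<close> gives compatibility
    with differences and avoids the sign \<open>(- 1) ^ p\<close>.\<close>
  have "((a - c) + c) ^ p - (a - c) ^ p - c ^ p \<in> m"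
    by (intro freshman algebraic_int_diff ab cd)
  from add[OF diff[OF ab(3) cd(3)] this] have "(b - d) - (a - c) ^ p \<in> m" by (simp add: algebra_simps)
  then show "frob (a - c) (b - d)" unfolding frob_def using ab cd by (auto intro: algebraic_int_diff)
  have "d * (b - a ^ p) + a ^ p * (d - c ^ p) \<in> m"
    by (intro add smult ab cd algebraic_int_power)
  then have "b * d - (a * c) ^ p \<in> m" by (simp add: algebra_simps power_mult_distrib)
  then show "frob (a * c) (b * d)" unfolding frob_def using ab cd algebraic_int_add_mult by auto
qed

text \<open>If both factors had a coefficient outside \<open>m\<close>, take the first such indices
  \<open>i\<close> and \<open>j\<close>: in coefficient \<open>i + j\<close> of the product exactly
  one summand lies outside \<open>m\<close>.\<close>

lemma gauss_lemma:
  assumes f: "\<And>i. algebraic_int (coeff f i)" and g: "\<And>i. algebraic_int (coeff g i)"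
    and fg: "\<And>i. coeff (f * g) i \<in> m"
  shows "(\<forall>i. coeff f i \<in> m) \<or> (\<forall>i. coeff g i \<in> m)"
proof (rule ccontr)
  assume "\<not> ?thesis"
  then have ex: "\<exists>i. coeff f i \<notin> m" "\<exists>i. coeff g i \<notin> m" by auto
  define i where "i = (LEAST i. coeff f i \<notin> m)"
  define j where "j = (LEAST i. coeff g i \<notin> m)"
  have i: "coeff f i \<notin> m" "\<And>k. k < i \<Longrightarrow> coeff f k \<in> m"
    unfolding i_def using LeastI_ex[OF ex(1)] not_less_Least by blast+
  have j: "coeff g j \<notin> m" "\<And>k. k < j \<Longrightarrow> coeff g k \<in> m"
    unfolding j_def using LeastI_ex[OF ex(2)] not_less_Least by blast+
  have "coeff (f * g) (i + j) = coeff f i * coeff g j + (\<Sum>k\<in>{..i + j} - {i}. coeff f k * coeff g (i + j - k))"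
    unfolding coeff_mult by (subst sum.remove[of _ i]) auto
  moreover have "(\<Sum>k\<in>{..i + j} - {i}. coeff f k * coeff g (i + j - k)) \<in> m"
  proof (rule sum_in)
    fix k assume k: "k \<in> {..i + j} - {i}"
    show "coeff f k * coeff g (i + j - k) \<in> m"
    proof (cases "k < i")
      case True
      then show ?thesis using i(2) g smult_right by blast
    next
      case False
      then have "i + j - k < j" using k by auto
      then show ?thesis using j(2) f smult by blast
    qed
  qed
  ultimately have "coeff f i * coeff g j \<in> m" using diff[OF fg[of "i + j"]] by fastforce
  then show False using prime_ideal f g i j by blast
qed

lemma gauss_lemma_prod:
  assumes "finite T" "\<And>q i. q \<in> T \<Longrightarrow> algebraic_int (coeff (f q) i)"
    and "\<And>i. coeff (prod f T) i \<in> m"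
  shows "\<exists>q\<in>T. \<forall>i. coeff (f q) i \<in> m"
  using assms
proof (induction T)
  case empty
  then have "coeff 1 0 \<in> m" by (metis prod.empty)
  then show ?case using one by simp
next
  case (insert q T)
  have "poly_rel (\<lambda>a b :: complex. a = b \<and> algebraic_int a) (prod f T) (prod f T)"
    using insert.prems(1) by (intro ring_rel_prod[OF ring_rel_poly_rel[OF ring_rel_algebraic_int]]) (auto simp: poly_rel_def)
  then have "algebraic_int (coeff (prod f T) i)" for i by (simp add: poly_rel_def)
  moreover have "coeff (f q * prod f T) i \<in> m" for i using insert by simp
  ultimately have "(\<forall>i. coeff (f q) i \<in> m) \<or> (\<forall>i. coeff (prod f T) i \<in> m)"
    using insert.prems(1) by (intro gauss_lemma) auto
  then show ?case using insert by blast
qed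

text \<open>The conjugates of \<open>\<Sum>x. x t ^ idx x\<close> are the roots of a polynomial \<open>P\<close> over \<open>\<int>[t]\<close>. As the
  Frobenius map fixes \<open>P\<close> modulo \<open>m\<close>, it sends one root to a root modulo \<open>m\<close>, and Gauss' lemma
  picks a conjugate congruent to \<open>\<Sum>x. x ^ p t ^ idx x\<close>.\<close>

theorem frobenius_automorphism:
  assumes X: "finite X" "\<And>x. x \<in> X \<Longrightarrow> algebraic_int x" and inv: "\<And>s x. s \<in> alg_auts \<Longrightarrow> x \<in> X \<Longrightarrow> s x \<in> X"
  shows "\<exists>s\<in>alg_auts. \<forall>x\<in>X. s x - x ^ p \<in> m"
proof -
  obtain idx :: "complex \<Rightarrow> nat" where idx: "inj_on idx X" using finite_imp_inj_to_nat_seg[OF X(1)] by blast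
  \<comment> \<open>Injectivity of \<open>idx\<close> gives each point its own exponent, so the
    coefficients of \<open>th s\<close> record the value of \<open>s\<close> at every point of
    \<open>X\<close>.\<close>
  define th where "th = (\<lambda>h. \<Sum>x\<in>X. monom (h x :: complex) (idx x))"
  have cth: "coeff (th h) (idx x) = h x" if "x \<in> X" for h x
  proof -
    have "coeff (th h) (idx x) = (\<Sum>y\<in>X. if y = x then h y else 0)"
      unfolding th_def coeff_sum using idx that by (intro sum.cong) (auto dest: inj_onD)
    then show ?thesis using X(1) that by simp
  qed
  define T where "T = th ` alg_auts"
  \<comment> \<open>Infinitely many automorphisms yield finitely many conjugates, as only their
    restriction to \<open>X\<close> enters.\<close>
  have "T \<subseteq> th ` (X \<rightarrow>\<^sub>E X)"
  proof
    fix q assume "q \<in> T"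
    then obtain s where s: "s \<in> alg_auts" "q = th s" unfolding T_def by blast
    then have "q = th (restrict s X)" by (simp add: th_def)
    moreover have "restrict s X \<in> X \<rightarrow>\<^sub>E X" using inv[OF s(1)] by auto
    ultimately show "q \<in> th ` (X \<rightarrow>\<^sub>E X)" by blast
  qed
  then have finT: "finite T" using X(1) finite_PiE by (meson finite_imageI finite_subset)
  define P where "P = (\<Prod>q\<in>T. [:- q, 1:])"
  have th_rel: "poly_rel S (th h) (th k)" if "ring_rel S" "\<And>x. x \<in> X \<Longrightarrow> S (h x) (k x)" for S h k
    unfolding th_def by (intro ring_rel_sum[OF ring_rel_poly_rel[OF that(1)]] poly_rel_monom that)
  have lin_rel: "poly_rel (poly_rel S) [:- q, 1:] [:- r, 1:]" if S: "ring_rel S" and "poly_rel S q r" for S q r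
  proof -
    note PS = ring_rel_poly_rel[OF S]
    show ?thesis using that ring_rel_uminus[OF PS] ring_rel_one[OF PS] poly_rel_0[OF PS]
      by (simp add: poly_rel_pCons)
  qed
  have T_int: "poly_rel (\<lambda>a b :: complex. a = b \<and> algebraic_int a) q q" if "q \<in> T" for q
    using that inv X(2) unfolding T_def by (auto intro!: th_rel ring_rel_algebraic_int)
  have "poly_rel (poly_rel (\<lambda>a b :: complex. a = b \<and> algebraic_int a)) P P"
    unfolding P_def
    by (intro ring_rel_prod[OF ring_rel_poly_rel[OF ring_rel_poly_rel[OF ring_rel_algebraic_int]]] lin_rel T_int
        ring_rel_algebraic_int)
  then have P_int: "algebraic_int (coeff (coeff P k) l)" for k l by (simp add: poly_rel_def)
  \<comment> \<open>Composition with \<open>s\<close> permutes \<open>T\<close>, hence the linear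
    factors of \<open>P\<close>.\<close>
  have P_fixed: "s (coeff (coeff P k) l) = coeff (coeff P k) l" if s: "s \<in> alg_auts" for s k l
  proof -
    note R = emb_relD(1)[OF emb_rel_alg_auts[OF s]]
    have s0: "s 0 = 0" using ring_rel_zero[OF R] by simp
    have inj_s: "inj s" using alg_autsD(1)[OF s] by (rule bij_is_inj)
    have "map_poly s q \<in> T" if q: "q \<in> T" for q
    proof -
      obtain t where t: "t \<in> alg_auts" "q = th t" using q unfolding T_def by blast
      have "poly_rel (\<lambda>a b. algebraic a \<and> b = s a) (th t) (th (s \<circ> t))"
        using inv[OF t(1)] X(2) by (intro th_rel R) auto
      then have "map_poly s q = th (s \<circ> t)"
        using t(2) s0 by (simp add: poly_rel_def poly_eq_iff coeff_map_poly)
      then show ?thesis unfolding T_def using alg_auts_closed(3)[OF s t(1)] by blast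
    qed
    moreover have "inj_on (map_poly s) T"
    proof (rule inj_onI)
      fix q r assume "map_poly s q = map_poly s r"
      then have "s (coeff q i) = s (coeff r i)" for i using s0 by (metis coeff_map_poly)
      then show "q = r" using inj_s by (simp add: poly_eq_iff injD)
    qed
    ultimately have TT: "map_poly s ` T = T" using finT by (intro card_subset_eq card_image) auto
    have "(\<Prod>q\<in>T. [:- map_poly s q, 1:]) = P"
      unfolding P_def using prod.reindex[OF \<open>inj_on (map_poly s) T\<close>, of "\<lambda>q. [:- q, 1:]"] TT by simp
    moreover have "poly_rel (poly_rel (\<lambda>a b. algebraic a \<and> b = s a)) P (\<Prod>q\<in>T. [:- map_poly s q, 1:])"
      unfolding P_def
    proof (intro ring_rel_prod[OF ring_rel_poly_rel[OF ring_rel_poly_rel[OF R]]] lin_rel R)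
      fix q assume "q \<in> T"
      then show "poly_rel (\<lambda>a b. algebraic a \<and> b = s a) q (map_poly s q)"
        using T_int[of q] s0 by (auto simp: poly_rel_def coeff_map_poly)
    qed
    ultimately show ?thesis by (simp add: poly_rel_def)
  qed
  \<comment> \<open>An algebraic integer fixed by every automorphism is rational, hence an ordinary
    integer. This matters because \<open>frob\<close> relates each integer to itself, so
    \<open>P\<close> is related to \<open>P\<close>.\<close>
  have "coeff (coeff P k) l \<in> \<int>" for k l
  proof -
    have "coeff (coeff P k) l \<in> \<rat>"
      using alg_auts_move_irrational P_fixed P_int by blast
    then show ?thesis using P_int rational_algebraic_int_is_int by blast
  qed
  then have "poly_rel (poly_rel frob) P P"
    unfolding poly_rel_def using ring_rel_of_int[OF ring_rel_frob] by (metis Ints_cases)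
  moreover have "poly_rel frob (th id) (th (\<lambda>x. x ^ p))"
  proof (rule th_rel[OF ring_rel_frob])
    fix x assume "x \<in> X"
    then show "frob (id x) (x ^ p)" using X(2) zero by (simp add: frob_def algebraic_int_power)
  qed
  ultimately have "poly_rel frob (poly P (th id)) (poly P (th (\<lambda>x. x ^ p)))"
    by (rule poly_rel_eval[OF ring_rel_poly_rel[OF ring_rel_frob]])
  moreover have "poly P (th id) = 0"
  proof -
    have "th id \<in> T" unfolding T_def using alg_auts_closed(1) by blast
    then show ?thesis unfolding P_def poly_prod using finT by (auto intro: prod_zero)
  qed
  ultimately have "coeff (poly P (th (\<lambda>x. x ^ p))) i \<in> m" for i
    using prime_gt_0_nat[OF prime] by (simp add: poly_rel_def frob_def zero_power)
  then have "coeff (\<Prod>q\<in>T. th (\<lambda>x. x ^ p) - q) i \<in> m" for i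
    by (simp add: P_def poly_prod)
  moreover have "algebraic_int (coeff (th (\<lambda>x. x ^ p) - q) i)" if "q \<in> T" for q i
  proof -
    have "poly_rel (\<lambda>a b :: complex. a = b \<and> algebraic_int a) (th (\<lambda>x. x ^ p)) (th (\<lambda>x. x ^ p))"
      using X(2) by (intro th_rel ring_rel_algebraic_int) (auto intro: algebraic_int_power)
    then show ?thesis using T_int[OF that] by (auto simp: poly_rel_def intro: algebraic_int_diff)
  qed
  ultimately obtain q where q: "q \<in> T" "\<And>i. coeff (th (\<lambda>x. x ^ p) - q) i \<in> m"
    using gauss_lemma_prod[OF finT, of "\<lambda>q. th (\<lambda>x. x ^ p) - q"] by blast
  obtain s where s: "s \<in> alg_auts" "q = th s" using q(1) unfolding T_def by blast
  have "s x - x ^ p \<in> m" if "x \<in> X" for x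
    using uminus[OF q(2)[of "idx x"]] cth[OF that] by (simp add: s(2))
  then show ?thesis using s(1) by blast
qed

end

section \<open>The characteristic polynomial\<close>

text \<open>Expansion along the first row in executable form; skipping zero entries keeps the
  evaluation for a sparse matrix small.\<close>

fun laplace_det :: "'a::comm_ring_1 list list \<Rightarrow> 'a" where
  "laplace_det [] = 1"
| "laplace_det (r # rs) = (\<Sum>j\<leftarrow>[0..<length r].
     if r ! j = 0 then 0 else (- 1) ^ j * r ! j * laplace_det (map (\<lambda>x. take j x @ drop (Suc j) x) rs))"

lemma det_laplace_det:
  assumes "length rws = n" "\<And>r. r \<in> set rws \<Longrightarrow> length r = n"
  shows "Determinant.det (mat_of_rows_list n rws) = laplace_det rws"
  using assms
proof (induction n arbitrary: rws)
  case 0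
  then show ?case by (simp add: Determinant.det_dim_zero mat_of_rows_list_def)
next
  case (Suc n)
  then obtain r rs where rws: "rws = r # rs" by (cases rws) auto
  have lr: "length r = Suc n" and lrs: "length rs = n" and el: "\<And>x. x \<in> set rs \<Longrightarrow> length x = Suc n"
    using Suc.prems rws by auto
  define A where "A = mat_of_rows_list (Suc n) rws"
  have A: "A \<in> carrier_mat (Suc n) (Suc n)" using Suc.prems by (simp add: A_def mat_of_rows_list_def)
  have del: "mat_delete A 0 j = mat_of_rows_list n (map (\<lambda>x. take j x @ drop (Suc j) x) rs)" if "j < Suc n" for j
  proof (rule eq_matI)
    fix i k assume "i < dim_row (mat_of_rows_list n (map (\<lambda>x. take j x @ drop (Suc j) x) rs))"
      "k < dim_col (mat_of_rows_list n (map (\<lambda>x. take j x @ drop (Suc j) x) rs))"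
    then have ik: "i < n" "k < n" using lrs by (auto simp: mat_of_rows_list_def)
    then have "length (rs ! i) = Suc n" using el lrs by simp
    then show "mat_delete A 0 j $$ (i, k) = mat_of_rows_list n (map (\<lambda>x. take j x @ drop (Suc j) x) rs) $$ (i, k)"
      using ik that lrs by (simp add: mat_delete_def A_def mat_of_rows_list_def rws nth_append)
  qed (use A lrs in \<open>auto simp: mat_delete_def mat_of_rows_list_def\<close>)
  have "Determinant.det A = (\<Sum>j<Suc n. A $$ (0, j) * Determinant.cofactor A 0 j)"
    by (rule laplace_expansion_row[OF A]) simp
  also have "\<dots> = (\<Sum>j<Suc n. if r ! j = 0 then 0 else
      (- 1) ^ j * r ! j * laplace_det (map (\<lambda>x. take j x @ drop (Suc j) x) rs))"
  proof (rule sum.cong)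
    fix j assume "j \<in> {..<Suc n}"
    then have j: "j < Suc n" by simp
    have "Determinant.det (mat_delete A 0 j) = laplace_det (map (\<lambda>x. take j x @ drop (Suc j) x) rs)"
      unfolding del[OF j] using lrs el j by (intro Suc.IH) auto
    moreover have "A $$ (0, j) = r ! j" using j lrs by (simp add: A_def mat_of_rows_list_def rws)
    ultimately show "A $$ (0, j) * Determinant.cofactor A 0 j = (if r ! j = 0 then 0 else
      (- 1) ^ j * r ! j * laplace_det (map (\<lambda>x. take j x @ drop (Suc j) x) rs))"
      by (simp add: Determinant.cofactor_def)
  qed simp
  also have "\<dots> = laplace_det rws"
    by (simp add: rws lr interv_sum_list_conv_sum_set_nat atLeast0LessThan del: upt_Suc sum.lessThan_Suc)
  finally show ?case unfolding A_def .
qed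

text \<open>A path \<open>0 - 1 - 2 - 3 - 4 - 5\<close> attached to the triangle \<open>5, 7, 8\<close>, with a pendant vertex \<open>6\<close>
  at \<open>7\<close>. Modulo 5 the characteristic polynomial of its Laplacian has irreducible factors of degrees
  1, 1, 7, and modulo 7 of degrees 1, 3, 5.\<close>

definition nine_edges :: "(nat \<times> nat) list" where
  "nine_edges = [(0, 1), (1, 2), (2, 3), (3, 4), (4, 5), (5, 7), (5, 8), (6, 7), (7, 8)]"

definition nine_adj :: "nat \<Rightarrow> nat \<Rightarrow> bool" where
  "nine_adj i j \<longleftrightarrow> (i, j) \<in> set nine_edges \<or> (j, i) \<in> set nine_edges"

definition nine_deg :: "nat \<Rightarrow> nat" where
  "nine_deg i = length (filter (nine_adj i) [0..<9])"

definition lap_entry :: "nat \<Rightarrow> nat \<Rightarrow> int" where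
  "lap_entry i j = (if i = j then int (nine_deg i) else 0) - (if nine_adj i j then 1 else 0)"

text \<open>Three coefficients are visible in the graph: 0 from the all-ones kernel vector, 27 as
  nine vertices times three spanning trees, and -18 from the degree sum of nine edges.\<close>

definition lap_poly :: "int poly" where
  "lap_poly = [:0, 27, -304, 986, -1460, 1156, -520, 133, -18, 1:]"

lemma char_poly_lap_entry: "char_poly (Matrix.mat 9 9 (\<lambda>(i, j). lap_entry i j)) = lap_poly"
proof -
  define rws where "rws = map (\<lambda>i. map (\<lambda>j. [:- lap_entry i j, if i = j then 1 else 0:]) [0..<9]) [0..<9]"
  have "char_poly_matrix (Matrix.mat 9 9 (\<lambda>(i, j). lap_entry i j)) = mat_of_rows_list 9 rws"
    by (rule eq_matI) (auto simp: char_poly_matrix_def mat_of_rows_list_def rws_def)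
  then have "char_poly (Matrix.mat 9 9 (\<lambda>(i, j). lap_entry i j)) = laplace_det rws"
    unfolding char_poly_def by (simp only:) (rule det_laplace_det, auto simp: rws_def)
  also have "\<dots> = lap_poly" unfolding rws_def lap_poly_def by code_simp
  finally show ?thesis .
qed

text \<open>The determinant is built from matrix entries by ring operations, and congruence modulo
  \<open>k\<close> is a ring relation.\<close>

lemma char_poly_cong:
  fixes A B :: "int Matrix.mat"
  assumes A: "A \<in> carrier_mat n n" and B: "B \<in> carrier_mat n n"
    and AB: "\<And>i j. i < n \<Longrightarrow> j < n \<Longrightarrow> k dvd A $$ (i, j) - B $$ (i, j)"
  shows "[:k:] dvd char_poly A - char_poly B"
proof -
  define R where "R = (\<lambda>a b :: int poly. [:k:] dvd a - b)"
  have R: "ring_rel R"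
    unfolding ring_rel_def R_def
  proof (intro conjI allI impI)
    fix a b c d :: "int poly" assume d: "[:k:] dvd a - b" "[:k:] dvd c - d"
    have e: "(a - c) - (b - d) = (a - b) - (c - d)" by simp
    show "[:k:] dvd (a - c) - (b - d)" unfolding e by (rule dvd_diff[OF d])
    have "a * c - b * d = (a - b) * c + b * (c - d)" by (simp add: algebra_simps)
    then show "[:k:] dvd a * c - b * d" using d by simp
  qed simp
  have "R (char_poly_matrix A $$ (i, j)) (char_poly_matrix B $$ (i, j))" if "i < n" "j < n" for i j
    using AB[OF that] that A B
    by (auto simp: R_def char_poly_matrix_def const_poly_dvd_iff coeff_pCons dvd_diff_commute split: nat.splits)
  then have "R (char_poly A) (char_poly B)"
    unfolding char_poly_def Determinant.det_def'[OF char_poly_matrix_closed[OF A]]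
      Determinant.det_def'[OF char_poly_matrix_closed[OF B]]
    by (intro ring_rel_sum[OF R] ring_rel_mult[OF R] ring_rel_prod[OF R])
       (auto simp: R_def dest: permutes_in_image)
  then show ?thesis unfolding R_def .
qed

text \<open>Eigenvectors as plain functions of an index form the bridge between matrices indexed by
  numbers and those indexed by a finite type.\<close>

lemma root_char_poly_iff:
  fixes A :: "int Matrix.mat" and x :: complex
  assumes A: "A \<in> carrier_mat n n"
  shows "poly (of_int_poly (char_poly A)) x = 0 \<longleftrightarrow>
    (\<exists>w. (\<exists>i<n. w i \<noteq> 0) \<and> (\<forall>i<n. (\<Sum>j<n. of_int (A $$ (i, j)) * w j) = x * w i))"
proof -
  define C where "C = (map_mat of_int A :: complex Matrix.mat)"
  have C: "C \<in> carrier_mat n n" unfolding C_def using A by simp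
  have Cv: "vec_index (C *\<^sub>v v) i = (\<Sum>j<n. of_int (A $$ (i, j)) * vec_index v j)"
    if "i < n" "v \<in> carrier_vec n" for v i
    using that A by (simp add: C_def scalar_prod_def atLeast0LessThan)
  have "char_poly C = of_int_poly (char_poly A)" unfolding C_def by (rule of_int_hom.char_poly_hom[OF A])
  then have "poly (of_int_poly (char_poly A)) x = 0 \<longleftrightarrow> eigenvalue C x"
    using eigenvalue_root_char_poly[OF C, of x] by simp
  also have "\<dots> \<longleftrightarrow> (\<exists>w. (\<exists>i<n. w i \<noteq> 0) \<and> (\<forall>i<n. (\<Sum>j<n. of_int (A $$ (i, j)) * w j) = x * w i))"
  proof
    assume "eigenvalue C x"
    then obtain v where v: "v \<in> carrier_vec n" "v \<noteq> 0\<^sub>v n" "C *\<^sub>v v = x \<cdot>\<^sub>v v"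
      unfolding eigenvalue_def eigenvector_def using C by auto
    have "\<exists>i<n. vec_index v i \<noteq> 0"
    proof (rule ccontr)
      assume "\<not> ?thesis"
      then have "v = 0\<^sub>v n" using v(1) by (intro eq_vecI) auto
      then show False using v(2) by simp
    qed
    moreover have "(\<Sum>j<n. of_int (A $$ (i, j)) * vec_index v j) = x * vec_index v i" if "i < n" for i
      using Cv[OF that v(1)] v(1,3) that by simp
    ultimately show "\<exists>w. (\<exists>i<n. w i \<noteq> 0) \<and> (\<forall>i<n. (\<Sum>j<n. of_int (A $$ (i, j)) * w j) = x * w i)"
      by (intro exI[of _ "vec_index v"]) auto
  next
    assume "\<exists>w. (\<exists>i<n. w i \<noteq> 0) \<and> (\<forall>i<n. (\<Sum>j<n. of_int (A $$ (i, j)) * w j) = x * w i)"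
    then obtain w i0 where w: "i0 < n" "w i0 \<noteq> 0" "\<And>i. i < n \<Longrightarrow> (\<Sum>j<n. of_int (A $$ (i, j)) * w j) = x * w i"
      by blast
    define v where "v = Matrix.vec n w"
    have vc: "v \<in> carrier_vec n" by (simp add: v_def)
    have "C *\<^sub>v v = x \<cdot>\<^sub>v v"
    proof (rule eq_vecI)
      fix i assume "i < dim_vec (x \<cdot>\<^sub>v v)"
      then have i: "i < n" by (simp add: v_def)
      show "vec_index (C *\<^sub>v v) i = vec_index (x \<cdot>\<^sub>v v) i"
        unfolding Cv[OF i vc] using w(3)[OF i] i by (simp add: v_def)
    qed (use C in \<open>simp add: v_def\<close>)
    moreover have "v \<noteq> 0\<^sub>v n"
    proof
      assume "v = 0\<^sub>v n"
      then have "vec_index v i0 = 0" using w(1) by simp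
      then show False using w by (simp add: v_def)
    qed
    ultimately show "eigenvalue C x" unfolding eigenvalue_def eigenvector_def using vc C by (intro exI[of _ v]) auto
  qed
  finally show ?thesis .
qed

section \<open>Factorisation patterns modulo 5 and 7\<close>

lemma const_poly_dvd_code: "[:k:] dvd q \<longleftrightarrow> list_all (\<lambda>c. k dvd c) (coeffs q)" for k :: int
proof -
  have "list_all (\<lambda>c. k dvd c) (coeffs q) \<longleftrightarrow> (\<forall>c\<in>range (coeff q). k dvd c)"
    by (auto simp: list_all_iff range_coeff)
  then show ?thesis by (auto simp: const_poly_dvd_iff)
qed

text \<open>The lists are neither trimmed nor fully reduced, so the correctness statements are
  congruences modulo \<open>k\<close>.\<close>

fun poly_add_mod :: "int \<Rightarrow> int list \<Rightarrow> int list \<Rightarrow> int list" where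
  "poly_add_mod k [] ys = ys"
| "poly_add_mod k xs [] = xs"
| "poly_add_mod k (x # xs) (y # ys) = (x + y) mod k # poly_add_mod k xs ys"

fun poly_mult_mod :: "int \<Rightarrow> int list \<Rightarrow> int list \<Rightarrow> int list" where
  "poly_mult_mod k [] ys = []"
| "poly_mult_mod k (x # xs) ys = poly_add_mod k (map (\<lambda>y. x * y) ys) (0 # poly_mult_mod k xs ys)"

fun poly_power_mod :: "int \<Rightarrow> int list \<Rightarrow> nat \<Rightarrow> int list" where
  "poly_power_mod k xs 0 = [1]"
| "poly_power_mod k xs (Suc n) = poly_mult_mod k xs (poly_power_mod k xs n)"

lemma poly_add_mod: "[:k:] dvd Poly (poly_add_mod k xs ys) - (Poly xs + Poly ys)"
proof (induction k xs ys rule: poly_add_mod.induct)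
  case (3 k x xs y ys)
  have "k dvd (x + y) mod k - (x + y)" by (simp add: mod_eq_dvd_iff[symmetric])
  with 3 show ?case by (simp add: const_poly_dvd_iff coeff_pCons split: nat.splits)
qed auto

lemma poly_mult_mod: "[:k:] dvd Poly (poly_mult_mod k xs ys) - Poly xs * Poly ys"
proof (induction k xs ys rule: poly_mult_mod.induct)
  case (2 k x xs ys)
  have "Poly (map (\<lambda>y. x * y) ys) = Polynomial.smult x (Poly ys)" by (induction ys) auto
  with poly_add_mod[of k "map (\<lambda>y. x * y) ys" "0 # poly_mult_mod k xs ys"]
  have 1: "[:k:] dvd Poly (poly_mult_mod k (x # xs) ys) - (Polynomial.smult x (Poly ys) + [:0, 1:] * Poly (poly_mult_mod k xs ys))"
    by simp
  have "[:k:] dvd [:0, 1:] * (Poly (poly_mult_mod k xs ys) - Poly xs * Poly ys)"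
    using 2 by (rule dvd_mult)
  moreover have "u - (v + t * w) + t * (w - n) = u - (v + t * n)" for u v w n t :: "int poly"
    by (simp add: algebra_simps)
  moreover have "Poly (x # xs) * Poly ys = Polynomial.smult x (Poly ys) + [:0, 1:] * (Poly xs * Poly ys)"
    by simp
  ultimately show ?case using dvd_add[OF 1] by metis
qed simp

lemma poly_power_mod: "[:k:] dvd Poly (poly_power_mod k xs n) - Poly xs ^ n"
proof (induction n)
  case 0
  show ?case by (simp flip: one_pCons)
next
  case (Suc n)
  have "[:k:] dvd Poly xs * (Poly (poly_power_mod k xs n) - Poly xs ^ n)"
    using Suc by (rule dvd_mult)
  from dvd_add[OF poly_mult_mod[of k xs "poly_power_mod k xs n"] this]
  show ?case by (simp add: algebra_simps)
qed

text \<open>A certificate, on coefficient lists with the constant term first, that the iterated Frobenius map sends \<open>h\<close> to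
  \<open>X\<close> modulo \<open>p\<close> and \<open>g\<close>: each step gives \<open>h ^ p mod g\<close> and the quotient.\<close>

fun frob_chain :: "nat \<Rightarrow> int list \<Rightarrow> int list \<Rightarrow> (int list \<times> int list) list \<Rightarrow> bool" where
  "frob_chain p g h [] \<longleftrightarrow> h = [0, 1]"
| "frob_chain p g h ((h', q) # cs) \<longleftrightarrow>
     list_all (\<lambda>c. c mod int p = 0)
       (poly_add_mod (int p) (poly_power_mod (int p) h p)
         (map uminus (poly_add_mod (int p) h' (poly_mult_mod (int p) g q)))) \<and>
     frob_chain p g h' cs"

lemma frob_chain_step:
  assumes "frob_chain p g h ((h', q) # cs)"
  shows "[:int p:] dvd Poly h ^ p - (Poly h' + Poly g * Poly q)"
proof -
  define k where "k = int p"
  define r where "r = poly_add_mod k h' (poly_mult_mod k g q)"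
  define s where "s = poly_add_mod k (poly_power_mod k h p) (map uminus r)"
  have um: "Poly (map uminus xs) = - Poly xs" for xs :: "int list" by (induction xs) auto
  have "list_all (\<lambda>c. c mod k = 0) s" using assms by (simp add: k_def r_def s_def)
  then have "[:k:] dvd Poly s"
    by (induction s) (auto simp: const_poly_dvd_iff coeff_pCons dvd_eq_mod_eq_0 split: nat.splits)
  moreover have "[:k:] dvd Poly s - (Poly (poly_power_mod k h p) - Poly r)"
    using poly_add_mod[of k "poly_power_mod k h p" "map uminus r"] by (simp add: s_def um)
  moreover have "[:k:] dvd Poly (poly_power_mod k h p) - Poly h ^ p" by (rule poly_power_mod)
  moreover have "[:k:] dvd Poly r - (Poly h' + Poly (poly_mult_mod k g q))"
    unfolding r_def by (rule poly_add_mod)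
  moreover have "[:k:] dvd Poly (poly_mult_mod k g q) - Poly g * Poly q" by (rule poly_mult_mod)
  moreover have "d dvd b - (h + e)"
    if "d dvd s" "d dvd s - (a - r)" "d dvd a - b" "d dvd r - (h + c)" "d dvd c - e" for d s a r b h c e :: "int poly"
  proof -
    have "b - (h + e) = s - (s - (a - r)) - (a - b) + (r - (h + c)) + (c - e)" by simp
    then show ?thesis
      using dvd_add[OF dvd_add[OF dvd_diff[OF dvd_diff[OF that(1,2)] that(3)] that(4)] that(5)] by (simp only:)
  qed
  ultimately show ?thesis unfolding k_def by blast
qed

section \<open>Roots of integer polynomials modulo a prime ideal\<close>

context prime_over
begin

definition modrel :: "complex \<Rightarrow> complex \<Rightarrow> bool" where
  "modrel a b \<longleftrightarrow> algebraic_int a \<and> algebraic_int b \<and> a - b \<in> m"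

lemma ring_rel_modrel: "ring_rel modrel"
  unfolding ring_rel_def
proof (intro conjI allI impI)
  show "modrel 1 1" unfolding modrel_def using algebraic_int_of_int[of 1] zero by simp
  fix a b c d assume "modrel a b" "modrel c d"
  then have ab: "algebraic_int a" "algebraic_int b" "a - b \<in> m"
    and cd: "algebraic_int c" "algebraic_int d" "c - d \<in> m" by (auto simp: modrel_def)
  have "(a - c) - (b - d) \<in> m" using diff[OF ab(3) cd(3)] by (simp add: algebra_simps)
  then show "modrel (a - c) (b - d)" unfolding modrel_def using ab cd by (auto intro: algebraic_int_diff)
  have "c * (a - b) + b * (c - d) \<in> m" by (intro add smult ab cd)
  then have "a * c - b * d \<in> m" by (simp add: algebra_simps)
  then show "modrel (a * c) (b * d)" unfolding modrel_def using ab cd algebraic_int_add_mult by auto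
qed

lemma modrel_sym: "modrel a b \<Longrightarrow> modrel b a"
  unfolding modrel_def using uminus by fastforce

lemma modrel_trans: "modrel a b \<Longrightarrow> modrel b c \<Longrightarrow> modrel a c"
  unfolding modrel_def using add[of "a - b" "b - c"] by auto

lemma algebraic_int_ipoly: "algebraic_int x \<Longrightarrow> algebraic_int (poly (of_int_poly a) x)" for x :: complex
  using poly_rel_eval[OF ring_rel_algebraic_int poly_rel_of_int[OF ring_rel_algebraic_int], of x x a] by simp

lemma ipoly_modrel:
  assumes "[:int p:] dvd a - b" "algebraic_int x"
  shows "modrel (poly (of_int_poly a) x) (poly (of_int_poly b) x)"
proof -
  obtain r where "a - b = [:int p:] * r" using assms(1) by blast
  then have a: "a = b + [:int p:] * r" by (simp add: algebra_simps)
  have "poly (of_int_poly a) x - poly (of_int_poly b) x = of_nat p * poly (of_int_poly r) x"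
    unfolding a by (simp add: hom_distribs)
  also have "\<dots> \<in> m" by (intro smult_right p_in algebraic_int_ipoly assms)
  finally show ?thesis unfolding modrel_def using algebraic_int_ipoly[OF assms(2)] by blast
qed

text \<open>As \<open>g\<close> vanishes at \<open>x\<close> modulo \<open>m\<close>, each step of
  the certificate replaces the \<open>p\<close>-th power of the value of \<open>h\<close> by the
  value of \<open>h'\<close>; the chain ends with the polynomial \<open>X\<close>, so it leads back
  to \<open>x\<close>.\<close>

lemma frob_chain_power:
  assumes x: "algebraic_int x" and g: "poly (of_int_poly (Poly g)) x \<in> m"
    and "frob_chain p g h cs"
  shows "modrel (poly (of_int_poly (Poly h)) x ^ (p ^ length cs)) x"
  using assms(3)
proof (induction cs arbitrary: h)
  case Nil
  then show ?case using x zero by (simp add: modrel_def)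
next
  case (Cons c cs)
  obtain h' q where c: "c = (h', q)" by (cases c)
  have d: "[:int p:] dvd Poly h ^ p - (Poly h' + Poly g * Poly q)" and ch: "frob_chain p g h' cs"
    using Cons.prems frob_chain_step[of p g h h' q cs] by (auto simp: c)
  have "poly (of_int_poly (Poly h ^ p)) x = poly (of_int_poly (Poly h)) x ^ p"
    by (simp add: hom_distribs)
  moreover have "modrel (poly (of_int_poly (Poly h' + Poly g * Poly q)) x) (poly (of_int_poly (Poly h')) x)"
    unfolding modrel_def using smult_right[OF g algebraic_int_ipoly[OF x, of "Poly q"]]
      algebraic_int_ipoly[OF x, of "Poly h' + Poly g * Poly q"] algebraic_int_ipoly[OF x, of "Poly h'"]
    by (simp add: hom_distribs)
  ultimately have "modrel (poly (of_int_poly (Poly h)) x ^ p) (poly (of_int_poly (Poly h')) x)"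
    using modrel_trans[OF ipoly_modrel[OF d x]] by simp
  from ring_rel_power[OF ring_rel_modrel this, of "p ^ length cs"]
  have "modrel (poly (of_int_poly (Poly h)) x ^ (p ^ Suc (length cs))) (poly (of_int_poly (Poly h')) x ^ (p ^ length cs))"
    by (simp add: power_mult)
  from modrel_trans[OF this Cons.IH[OF ch]] show ?case by simp
qed

lemma frob_power_mult:
  assumes "modrel (x ^ (p ^ n)) x"
  shows "modrel (x ^ (p ^ (n * k))) x"
proof (induction k)
  case 0
  then show ?case using assms zero by (simp add: modrel_def)
next
  case (Suc k)
  from ring_rel_power[OF ring_rel_modrel this, of "p ^ n"]
  have "modrel (x ^ (p ^ (n * Suc k))) (x ^ (p ^ n))" by (simp add: power_add mult.commute flip: power_mult)
  then show ?case using assms modrel_trans by blast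
qed

lemma frob_chain_period:
  assumes "algebraic_int x" "poly (of_int_poly (Poly g)) x \<in> m" "frob_chain p g [0, 1] cs" "length cs * k = n"
  shows "modrel (x ^ (p ^ n)) x"
  using frob_power_mult[of x "length cs" k] frob_chain_power[OF assms(1-3)] assms(4) by simp

lemma linear_period:
  assumes "algebraic_int x" "modrel x (of_int c)"
  shows "modrel (x ^ (p ^ n)) x"
proof -
  have "modrel (x ^ p) (of_int c ^ p)" by (rule ring_rel_power[OF ring_rel_modrel assms(2)])
  \<comment> \<open>That \<open>frob\<close> relates integers to themselves is Fermat's little
    theorem.\<close>
  moreover have "frob (of_int c) (of_int c)" by (rule ring_rel_of_int[OF ring_rel_frob])
  then have "modrel (of_int c) (of_int c ^ p)"
    by (simp add: frob_def modrel_def algebraic_int_power)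
  ultimately have "modrel (x ^ (p ^ 1)) x" using assms(2) modrel_trans modrel_sym by (metis power_one_right)
  then show ?thesis using frob_power_mult[of x 1 n] by simp
qed

lemma prod_modrel_0:
  assumes "finite I" "\<And>i. i \<in> I \<Longrightarrow> algebraic_int (f i)" "prod f I \<in> m"
  shows "\<exists>i\<in>I. f i \<in> m"
  using assms
proof (induction I)
  case empty
  then show ?case using one by simp
next
  case (insert i I)
  have "algebraic_int (prod f I)"
    using ring_rel_prod[OF ring_rel_algebraic_int, of I f f] insert.prems(1) by simp
  then have "f i \<in> m \<or> prod f I \<in> m" using prime_ideal insert by auto
  then show ?case using insert by auto
qed

text \<open>Modulo \<open>p\<close> the product of all \<open>X - c\<close> is
  \<open>X ^ p - X\<close>, so a residue fixed by Frobenius is a root of some factor, that is, an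
  element of the prime field.\<close>

lemma frob_fixed_int:
  assumes x: "algebraic_int x" and fixed: "modrel (x ^ p) x"
    and cert: "[:int p:] dvd (\<Prod>c\<in>{0..<p}. [:- int c, 1:]) - ([:0, 1:] ^ p - [:0, 1:])"
  shows "\<exists>c<p. modrel x (of_nat c)"
proof -
  have "modrel (\<Prod>c\<in>{0..<p}. x - of_nat c) (x ^ p - x)"
    using ipoly_modrel[OF cert x] by (simp add: hom_distribs poly_prod)
  moreover have "modrel (x ^ p - x) (x - x)"
    using fixed zero by (auto simp: modrel_def intro: algebraic_int_diff)
  ultimately have "modrel (\<Prod>c\<in>{0..<p}. x - of_nat c) (x - x)" by (rule modrel_trans)
  then have "(\<Prod>c\<in>{0..<p}. x - of_nat c) \<in> m" by (simp add: modrel_def)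
  then obtain c where "c \<in> {0..<p}" "x - of_nat c \<in> m"
    using prod_modrel_0[of "{0..<p}" "\<lambda>c. x - of_nat c"] x algebraic_int_diff algebraic_int_of_nat by blast
  then show ?thesis using x algebraic_int_of_nat by (auto simp: modrel_def)
qed

text \<open>By the Bezout identity the derivative is invertible modulo \<open>m\<close> at every
  root, so roots are simple. At a root \<open>x\<close> the derivative is the product of the
  differences to the other roots, so none of these differences lies in \<open>m\<close>.\<close>

lemma simple_roots_mod:
  fixes f :: "int poly"
  assumes monic: "lead_coeff f = 1" and bezout: "[:int p:] dvd a * f + b * pderiv f - 1"
  defines "X \<equiv> {x :: complex. poly (of_int_poly f) x = 0}"
  shows "finite X" "card X = degree f" "\<And>x. x \<in> X \<Longrightarrow> algebraic_int x"
    "\<And>x y. x \<in> X \<Longrightarrow> y \<in> X \<Longrightarrow> modrel x y \<Longrightarrow> x = y"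
    "of_int_poly f = (\<Prod>z\<in>X. [:- z, 1:])"
proof -
  define F where "F = (of_int_poly f :: complex poly)"
  have F0: "F \<noteq> 0" and lF: "lead_coeff F = 1" using monic by (auto simp: F_def)
  show fin: "finite X" unfolding X_def using poly_roots_finite[OF F0] by (simp add: F_def)
  show int: "algebraic_int x" if "x \<in> X" for x
    using that monic unfolding X_def algebraic_int_altdef_ipoly by blast
  have deriv: "poly (pderiv F) x \<notin> m" if x: "x \<in> X" for x
  proof
    assume d: "poly (pderiv F) x \<in> m"
    have pd: "pderiv F = of_int_poly (pderiv f)" unfolding F_def by (simp add: of_int_hom.map_poly_pderiv)
    have "modrel (poly (of_int_poly (a * f + b * pderiv f)) x) (poly (of_int_poly 1) x)"
      by (rule ipoly_modrel[OF bezout int[OF x]])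
    then have "poly (of_int_poly b) x * poly (pderiv F) x - 1 \<in> m"
      using x by (simp add: modrel_def hom_distribs X_def pd)
    moreover have "poly (of_int_poly b) x * poly (pderiv F) x \<in> m"
      by (intro smult d algebraic_int_ipoly int x)
    ultimately show False using diff[of "poly (of_int_poly b) x * poly (pderiv F) x"] one by fastforce
  qed
  have rs: "rsquarefree F"
    unfolding rsquarefree_roots
  proof (intro allI notI)
    fix a assume a: "poly F a = 0 \<and> poly (pderiv F) a = 0"
    then have "a \<in> X" by (simp add: X_def F_def)
    then show False using deriv[of a] a zero by simp
  qed
  have XF: "X = {z. poly F z = 0}" by (simp add: X_def F_def)
  show "card X = degree f" using rsquarefree_card_degree[OF F0] rs by (simp add: XF F_def)
  have decomp: "F = (\<Prod>z\<in>X. [:- z, 1:])"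
    using complex_poly_decompose_rsquarefree[OF rs] lF by (simp add: XF)
  then show "of_int_poly f = (\<Prod>z\<in>X. [:- z, 1:])" by (simp add: F_def)
  show "x = y" if xy: "x \<in> X" "y \<in> X" "modrel x y" for x y
  proof (rule ccontr)
    assume ne: "x \<noteq> y"
    have "F = [:- x, 1:] * (\<Prod>z\<in>X - {x}. [:- z, 1:])"
      unfolding decomp using fin xy(1) by (rule prod.remove)
    then have "poly (pderiv F) x = poly (\<Prod>z\<in>X - {x}. [:- z, 1:]) x"
      by (simp only: pderiv_mult poly_add poly_mult) (simp add: pderiv_pCons)
    also have "\<dots> = (\<Prod>z\<in>X - {x}. x - z)" by (simp add: poly_prod)
    also have "\<dots> = (x - y) * (\<Prod>z\<in>X - {x} - {y}. x - z)"
      using fin xy ne by (intro prod.remove) auto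
    also have "\<dots> \<in> m"
    proof (rule smult_right)
      show "x - y \<in> m" using xy(3) by (simp add: modrel_def)
      show "algebraic_int (\<Prod>z\<in>X - {x} - {y}. x - z)"
        using ring_rel_prod[OF ring_rel_algebraic_int, of "X - {x} - {y}" "\<lambda>z. x - z" "\<lambda>z. x - z"]
          algebraic_int_diff int xy(1) by auto
    qed
    finally show False using deriv[OF xy(1)] by blast
  qed
qed

lemma funpow_modrel:
  assumes s: "\<And>x. x \<in> X \<Longrightarrow> s x \<in> X" "\<And>x. x \<in> X \<Longrightarrow> algebraic_int x" "\<And>x. x \<in> X \<Longrightarrow> s x - x ^ p \<in> m"
    and x: "x \<in> X"
  shows "modrel ((s ^^ n) x) (x ^ (p ^ n))"
proof (induction n)
  case 0
  then show ?case using x s zero by (simp add: modrel_def)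
next
  case (Suc n)
  have X: "(s ^^ n) x \<in> X" using x s(1) by (induction n) auto
  then have "modrel (s ((s ^^ n) x)) (((s ^^ n) x) ^ p)"
    using s algebraic_int_power by (simp add: modrel_def)
  moreover have "modrel (((s ^^ n) x) ^ p) ((x ^ (p ^ n)) ^ p)"
    by (rule ring_rel_power[OF ring_rel_modrel Suc])
  ultimately show ?case using modrel_trans by (simp add: mult.commute flip: power_mult)
qed

end

lemma alg_auts_root:
  assumes "s \<in> alg_auts" "lead_coeff f = 1" "poly (of_int_poly f) x = 0"
  shows "poly (of_int_poly f) (s x) = 0"
proof -
  note R = emb_relD(1)[OF emb_rel_alg_auts[OF assms(1)]]
  have "algebraic_int x" using assms(2,3) unfolding algebraic_int_altdef_ipoly by blast
  then have "algebraic x" by (rule algebraic_int_imp_algebraic)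
  then show ?thesis
    using poly_rel_eval[OF R poly_rel_of_int[OF R], of x "s x" f] assms(3) ring_rel_zero[OF R] by auto
qed

text \<open>Extended Euclid over the field with five elements for \<open>lap_poly\<close> and its
  derivative, whose degrees are 9 and 8 there: squarefreeness modulo 5.\<close>

lemma cert5_bezout: "[:int 5:] dvd [:-1, -1, -2, 2, 1, 1, -2, -1:] * lap_poly +
    [:-2, -2, -1, 2, -1, 0, -2, 0, -1:] * pderiv lap_poly - 1"
  unfolding const_poly_dvd_code lap_poly_def by code_simp

lemma cert7_bezout: "[:int 7:] dvd [:2, 3, -2, -2, -3, -2, -1, -1:] * lap_poly +
    [:-1, -3, -2, 0, -3, -1, -2, 3, -3:] * pderiv lap_poly - 1"
  unfolding const_poly_dvd_code lap_poly_def by code_simp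

lemma cert5_factor: "[:int 5:] dvd lap_poly - [:0, 1:] * [:1, 1:] * [:2, -1, 2, -2, -2, 2, 1, 1:]"
  unfolding const_poly_dvd_code lap_poly_def by code_simp

lemma cert7_factor: "[:int 7:] dvd lap_poly - [:0, 1:] * [:2, 0, 0, 1:] * [:3, 2, 3, 0, 3, 1:]"
  unfolding const_poly_dvd_code lap_poly_def by code_simp

lemma cert_fermat: "[:int 5:] dvd (\<Prod>c\<in>{0..<5}. [:- int c, 1:]) - ([:0, 1:] ^ 5 - [:0, 1:])"
  "[:int 7:] dvd (\<Prod>c\<in>{0..<7}. [:- int c, 1:]) - ([:0, 1:] ^ 7 - [:0, 1:])"
  unfolding const_poly_dvd_code by code_simp+

lemma cert5_chain: "frob_chain 5 [2, -1, 2, -2, -2, 2, 1, 1] [0, 1]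
  [([0, 0, 0, 0, 0, 1], []),
   ([1, 1, 0, -1, -1, -1, -2], [2, -2, 2, -2, 0, -2, 1, 1, 2, -1, 0, -1, 0, 2, 2, 0, -1, -1, 1]),
   ([-2, -1, 1, -1, 2, -1, 1], [-1, 0, -2, 1, -2, -2, 0, 1, -1, -1, -1, 0, -1, -2, 0, 0, -2, 1, 0, 1, 0, 2, 2, -2]),
   ([-1, 2, -1, -2, 0, 1, 1], [2, 0, 1, 1, -1, -1, 1, 2, -1, 0, -2, 0, -1, 2, 2, 0, 0, 1, 1, 2, 0, -1, -1, 1]),
   ([-1, 1, 2, -2, 0, 2, -1], [0, 2, 0, -1, -1, 0, 1, 0, -2, -1, -2, 0, 1, -1, 1, 0, -2, -1, -2, 2, 0, -1, -1, 1]),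
   ([2, 1, -2, 1, -1, -2, 1], [1, 0, 0, -2, -2, -1, 1, 2, -1, -2, 2, 2, -1, 2, 0, 0, -1, -2, 0, -2, 0, 1, 1, -1]),
   ([0, 1], [1, 0, -1, -2, 1, 1, 1, -1, -2, 0, -2, -1, 2, 2, 0, 0, 1, 2, 0, 2, 0, -1, -1, 1])]"
  by code_simp

lemma cert7_chain3: "frob_chain 7 [2, 0, 0, 1] [0, 1]
  [([0, -3], [0, -2, 0, 0, 1]), ([0, 2], [0, -1, 0, 0, -3]), ([0, 1], [0, 3, 0, 0, 2])]"
  by code_simp

lemma cert7_chain5: "frob_chain 7 [3, 2, 3, 0, 3, 1] [0, 1]
  [([1, -2, -3, 0, -2], [2, -3, 1]),
   ([1, 1, -2, 0, -2], [0, 2, -3, 0, -1, 1, -2, 3, 1, -2, 2, 3, 1, -2, -2, 2, 1, -1, 0, 2, -3, 3, -1, -2]),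
   ([1, 3, 0, -1], [0, -1, 3, -3, -1, 0, 3, -2, -2, -1, 2, 3, 1, -2, -2, 2, 1, -1, 0, 2, -3, 3, -1, -2]),
   ([1, -3, -2, 1, -3], [0, 1, 0, 1, -2, -3, -1, -1, 1, -3, 3, 0, 1, 2, -2, 3, -1]),
   ([0, 1], [-2, 1, -1, 2, -3, 2, 0, 0, 0, -1, 0, 1, -3, 2, -1, 0, -1, 2, 0, 3, -1, 1, 2, -3])]"
  by code_simp

text \<open>Differentiation respects congruences, so the certificate for \<open>lap_poly\<close>
  serves every polynomial congruent to it.\<close>

lemma bezout_cong:
  fixes f g :: "int poly"
  assumes fg: "[:k:] dvd f - g" and "[:k:] dvd a * g + b * pderiv g - 1"
  shows "[:k:] dvd a * f + b * pderiv f - 1"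
proof -
  obtain h where h: "f - g = [:k:] * h" using fg by blast
  then have "pderiv (f - g) = [:k:] * pderiv h" by (simp add: pderiv_smult)
  then have "pderiv f - pderiv g = [:k:] * pderiv h" by (simp only: pderiv_diff)
  then have d: "[:k:] dvd pderiv f - pderiv g" by (simp only: dvd_triv_left)
  have "a * f + b * pderiv f - 1 = (a * g + b * pderiv g - 1) + (a * (f - g) + b * (pderiv f - pderiv g))"
    by (simp add: algebra_simps)
  then show ?thesis
    using dvd_add[OF assms(2) dvd_add[OF dvd_mult[OF fg, of a] dvd_mult[OF d, of b]]] by (simp only:)
qed

lemma ipoly_mult: "poly (of_int_poly (a * b)) x = poly (of_int_poly a) x * poly (of_int_poly b) (x :: complex)"
  by (simp add: hom_distribs)

lemma const_poly_dvd_trans: "[:35:] dvd (q :: int poly) \<Longrightarrow> [:5:] dvd q" "[:35:] dvd q \<Longrightarrow> [:7:] dvd q"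
  by (auto simp: const_poly_dvd_iff intro: dvd_trans[rotated])

text \<open>The cubic and the quintic factor have no root in the field with seven elements; this
  pins down the fixed point of the Frobenius map at 7.\<close>

lemma lap_poly_root_mod7:
  assumes "c < 7" "(7::int) dvd poly lap_poly (int c)"
  shows "c = 0"
proof -
  have "c = 0 \<or> c = 1 \<or> c = 2 \<or> c = 3 \<or> c = 4 \<or> c = 5 \<or> c = 6" using assms(1) by linarith
  then show ?thesis using assms(2) by (auto simp: lap_poly_def)
qed

section \<open>Frobenius permutations of the roots of any monic polynomial congruent to
  \<open>lap_poly\<close> modulo 35\<close>

context
  fixes f :: "int poly" and X :: "complex set"
  assumes monic: "lead_coeff f = 1" and deg: "degree f = 9" and cong: "[:35:] dvd f - lap_poly"
  defines "X \<equiv> {x. poly (of_int_poly f) x = 0}"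
begin

lemma alg_auts_roots: "s \<in> alg_auts \<Longrightarrow> x \<in> X \<Longrightarrow> s x \<in> X"
  unfolding X_def using alg_auts_root[OF _ monic] by blast

lemma finite_roots: "finite X" and card_roots: "card X = 9"
  and roots_alg_int: "\<And>x. x \<in> X \<Longrightarrow> algebraic_int x"
proof -
  obtain m where "prime_over 5 m" using prime_over_exists[of 5] by auto
  then interpret prime_over 5 m .
  have "[:int 5:] dvd f - lap_poly" using const_poly_dvd_trans(1)[OF cong] by simp
  note b = bezout_cong[OF this cert5_bezout]
  show "finite X" "card X = 9" "\<And>x. x \<in> X \<Longrightarrow> algebraic_int x"
    using simple_roots_mod(1,2,3)[OF monic b] deg unfolding X_def by auto
qed

lemma seven_cycle:
  "\<exists>b\<in>alg_auts. (\<forall>x\<in>X. (b ^^ 7) x = x) \<and> (\<exists>x\<in>X. b x \<noteq> x)"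
proof -
  obtain m where "prime_over 5 m" using prime_over_exists[of 5] by auto
  then interpret prime_over 5 m .
  have c5: "[:int 5:] dvd f - lap_poly" using const_poly_dvd_trans(1)[OF cong] by simp
  note bz = bezout_cong[OF this cert5_bezout]
  note incong = simple_roots_mod(4)[OF monic bz, folded X_def]
  obtain b where b: "b \<in> alg_auts" "\<And>x. x \<in> X \<Longrightarrow> b x - x ^ 5 \<in> m"
  proof -
    have "\<exists>s\<in>alg_auts. \<forall>x\<in>X. s x - x ^ 5 \<in> m"
    proof (rule frobenius_automorphism[OF finite_roots])
      show "s x \<in> X" if "s \<in> alg_auts" "x \<in> X" for s x by (rule alg_auts_roots[OF that])
    qed (rule roots_alg_int)
    then show ?thesis using that by blast
  qed
  have bX: "b x \<in> X" if "x \<in> X" for x using alg_auts_roots[OF b(1) that] .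
  \<comment> \<open>As \<open>m\<close> is prime, a root reduces to 0, to -1 or to a root of the
    septic factor, for which the certificate chain has length 7.\<close>
  have per: "modrel (x ^ (5 ^ 7)) x" if x: "x \<in> X" for x
  proof -
    define g where "g = [:2, -1, 2, -2, -2, 2, 1, 1 :: int:]"
    have xi: "algebraic_int x" by (rule roots_alg_int[OF x])
    have "[:int 5:] dvd (f - lap_poly) + (lap_poly - [:0, 1:] * [:1, 1:] * g)"
      unfolding g_def by (rule dvd_add[OF c5 cert5_factor])
    then have "[:int 5:] dvd f - [:0, 1:] * [:1, 1:] * g" by (simp only: diff_add_cancel add_diff_eq)
    from ipoly_modrel[OF this xi] have "modrel 0 (x * (1 + x) * poly (of_int_poly g) x)"
      using x unfolding ipoly_mult by (simp add: X_def)
    from modrel_sym[OF this] have "x * (1 + x) * poly (of_int_poly g) x \<in> m" by (simp add: modrel_def)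
    moreover have "algebraic_int (1 + x)" "algebraic_int (poly (of_int_poly g) x)"
      using algebraic_int_add_mult[of 1 x] algebraic_int_of_int[of 1] xi algebraic_int_ipoly by auto
    moreover have "algebraic_int (x * (1 + x))" using algebraic_int_add_mult xi calculation(2) by blast
    ultimately consider "x \<in> m" | "1 + x \<in> m" | "poly (of_int_poly g) x \<in> m"
      using prime_ideal xi by blast
    then show ?thesis
    proof cases
      case 1
      then show ?thesis using xi by (intro linear_period[of x 0]) (auto simp: modrel_def)
    next
      case 2
      then show ?thesis using xi algebraic_int_of_int[of "-1"]
        by (intro linear_period[of x "-1"]) (auto simp: modrel_def add.commute)
    next
      case 3
      have "g = Poly [2, -1, 2, -2, -2, 2, 1, 1]" by (simp add: g_def)
      with 3 show ?thesis by (intro frob_chain_period[OF xi _ cert5_chain, of 1]) auto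
    qed
  qed
  have "(b ^^ 7) x = x" if x: "x \<in> X" for x
  proof (rule incong)
    show "(b ^^ 7) x \<in> X" using x bX by (auto simp: numeral_eq_Suc)
    show "modrel ((b ^^ 7) x) x"
      using modrel_trans[OF funpow_modrel[OF bX roots_alg_int b(2) x, of 7] per[OF x]] .
  qed (rule x)
  \<comment> \<open>If \<open>b\<close> fixed all nine roots, their pairwise distinct residues would
    all lie in the prime field, which has five elements.\<close>
  moreover have "\<exists>x\<in>X. b x \<noteq> x"
  proof (rule ccontr)
    assume no: "\<not> ?thesis"
    have "\<exists>c<5. modrel x (of_nat c)" if x: "x \<in> X" for x
    proof (rule frob_fixed_int[OF roots_alg_int[OF x]])
      have "modrel (b x) (x ^ 5)" using b(2)[OF x] roots_alg_int[OF x] roots_alg_int[OF bX[OF x]]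
        by (auto simp: modrel_def intro: algebraic_int_power)
      then show "modrel (x ^ 5) x" using no x modrel_sym by auto
    qed (rule cert_fermat)
    then obtain c where c: "\<And>x. x \<in> X \<Longrightarrow> c x < 5 \<and> modrel x (of_nat (c x))" by metis
    have "inj_on c X"
      by (rule inj_onI) (metis c incong modrel_sym modrel_trans)
    moreover have "c ` X \<subseteq> {..<5}" using c by blast
    ultimately have "card X \<le> card {..<5::nat}" by (intro card_inj_on_le) auto
    then show False using card_roots by simp
  qed
  ultimately show ?thesis using b(1) by blast
qed

lemma fifteen_cycle:
  "\<exists>d\<in>alg_auts. (\<forall>x\<in>X. (d ^^ 15) x = x) \<and> (\<forall>x\<in>X. \<forall>y\<in>X. d x = x \<longrightarrow> d y = y \<longrightarrow> x = y) \<and>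
     (\<exists>x\<in>X. (d ^^ 3) x \<noteq> x)"
proof -
  obtain m where "prime_over 7 m" using prime_over_exists[of 7] by auto
  then interpret prime_over 7 m .
  have c7: "[:int 7:] dvd f - lap_poly" using const_poly_dvd_trans(2)[OF cong] by simp
  note bz = bezout_cong[OF this cert7_bezout]
  note incong = simple_roots_mod(4)[OF monic bz, folded X_def]
  obtain d where d: "d \<in> alg_auts" "\<And>x. x \<in> X \<Longrightarrow> d x - x ^ 7 \<in> m"
  proof -
    have "\<exists>s\<in>alg_auts. \<forall>x\<in>X. s x - x ^ 7 \<in> m"
    proof (rule frobenius_automorphism[OF finite_roots])
      show "s x \<in> X" if "s \<in> alg_auts" "x \<in> X" for s x by (rule alg_auts_roots[OF that])
    qed (rule roots_alg_int)
    then show ?thesis using that by blast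
  qed
  have dX: "d x \<in> X" if "x \<in> X" for x using alg_auts_roots[OF d(1) that] .
  have dX': "(d ^^ n) x \<in> X" if "x \<in> X" for x n using that dX by (induction n) auto
  have dm: "modrel (d x) (x ^ 7)" if "x \<in> X" for x
    using d(2)[OF that] roots_alg_int[OF that] roots_alg_int[OF dX[OF that]]
    by (auto simp: modrel_def intro: algebraic_int_power)
  \<comment> \<open>The chains for the cubic and the quintic factor have lengths 3 and 5; 15 is a
    common multiple.\<close>
  have per: "modrel (x ^ (7 ^ 15)) x" if x: "x \<in> X" for x
  proof -
    define g where "g = [:2, 0, 0, 1 :: int:]"
    define h where "h = [:3, 2, 3, 0, 3, 1 :: int:]"
    have xi: "algebraic_int x" by (rule roots_alg_int[OF x])
    have "[:int 7:] dvd (f - lap_poly) + (lap_poly - [:0, 1:] * g * h)"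
      unfolding g_def h_def by (rule dvd_add[OF c7 cert7_factor])
    then have "[:int 7:] dvd f - [:0, 1:] * g * h" by (simp only: diff_add_cancel add_diff_eq)
    from ipoly_modrel[OF this xi] have "modrel 0 (x * poly (of_int_poly g) x * poly (of_int_poly h) x)"
      using x unfolding ipoly_mult by (simp add: X_def)
    from modrel_sym[OF this] have "x * poly (of_int_poly g) x * poly (of_int_poly h) x \<in> m" by (simp add: modrel_def)
    moreover have "algebraic_int (poly (of_int_poly g) x)" "algebraic_int (poly (of_int_poly h) x)"
      using xi algebraic_int_ipoly by auto
    moreover have "algebraic_int (x * poly (of_int_poly g) x)" using algebraic_int_add_mult xi calculation(2) by blast
    ultimately consider "x \<in> m" | "poly (of_int_poly g) x \<in> m" | "poly (of_int_poly h) x \<in> m"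
      using prime_ideal xi by blast
    then show ?thesis
    proof cases
      case 1
      then show ?thesis using xi by (intro linear_period[of x 0]) (auto simp: modrel_def)
    next
      case 2
      have "g = Poly [2, 0, 0, 1]" by (simp add: g_def)
      with 2 show ?thesis by (intro frob_chain_period[OF xi _ cert7_chain3, of 5]) auto
    next
      case 3
      have "h = Poly [3, 2, 3, 0, 3, 1]" by (simp add: h_def)
      with 3 show ?thesis by (intro frob_chain_period[OF xi _ cert7_chain5, of 3]) auto
    qed
  qed
  have "(d ^^ 15) x = x" if x: "x \<in> X" for x
  proof (rule incong)
    show "(d ^^ 15) x \<in> X" by (rule dX'[OF x])
    show "modrel ((d ^^ 15) x) x"
      using modrel_trans[OF funpow_modrel[OF dX roots_alg_int d(2) x, of 15] per[OF x]] .
  qed (rule x)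
  \<comment> \<open>A fixed root is congruent to an integer \<open>c\<close>, which is then a root
    of \<open>lap_poly\<close> modulo 7 and so 0. As roots are distinct modulo \<open>m\<close>,
    there is at most one.\<close>
  moreover have fix0: "modrel x 0" if x: "x \<in> X" "d x = x" for x
  proof -
    have "modrel (x ^ 7) x" using dm[OF x(1)] x(2) modrel_sym by auto
    then obtain c where c: "c < 7" "modrel x (of_nat c)"
      using frob_fixed_int[OF roots_alg_int[OF x(1)] _ cert_fermat(2)] by blast
    have "modrel (poly (of_int_poly f) x) (poly (of_int_poly lap_poly) x)"
      by (rule ipoly_modrel[OF c7 roots_alg_int[OF x(1)]])
    moreover have "modrel (poly (of_int_poly lap_poly) x) (poly (of_int_poly lap_poly) (of_nat c))"
      by (rule poly_rel_eval[OF ring_rel_modrel poly_rel_of_int[OF ring_rel_modrel] c(2)])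
    ultimately have "modrel 0 (poly (of_int_poly lap_poly) (of_nat c))"
      using modrel_trans x(1) unfolding X_def by fastforce
    moreover have "poly (of_int_poly lap_poly) (of_nat c) = (of_int (poly lap_poly (int c)) :: complex)"
      by (simp add: lap_poly_def)
    ultimately have "modrel 0 (of_int (poly lap_poly (int c)))" by simp
    from modrel_sym[OF this] have "of_int (poly lap_poly (int c)) \<in> m" by (simp add: modrel_def)
    then have "c = 0" using c(1) of_int_in_iff by (intro lap_poly_root_mod7) auto
    then show ?thesis using c(2) by simp
  qed
  \<comment> \<open>The constant coefficient of \<open>f\<close> is divisible by 7, so some root
    lies in \<open>m\<close> and is fixed by \<open>d\<close>, leaving eight moved points. Were
    \<open>d ^^ 3\<close> trivial, their number would be divisible by 3.\<close>
  moreover have "\<exists>x\<in>X. (d ^^ 3) x \<noteq> x"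
  proof (rule ccontr)
    assume no: "\<not> ?thesis"
    have "(\<Prod>z\<in>X. - z) = poly (of_int_poly f) 0"
      using simple_roots_mod(5)[OF monic bz, folded X_def] by (simp add: poly_prod)
    also have "\<dots> = of_int (coeff f 0)" by (simp add: poly_0_coeff_0)
    also have "\<dots> \<in> m"
    proof -
      have "int 7 dvd coeff (f - lap_poly) 0" using c7 by (simp only: const_poly_dvd_iff)
      then show ?thesis unfolding of_int_in_iff by (simp add: lap_poly_def)
    qed
    finally obtain x0 where "x0 \<in> X" "- x0 \<in> m"
      using prod_modrel_0[OF finite_roots, of uminus] roots_alg_int by auto
    then have x0: "x0 \<in> X" "modrel x0 0"
      using uminus[of "- x0"] roots_alg_int by (auto simp: modrel_def)
    have "d x0 = x0"
    proof (rule incong[OF dX[OF x0(1)] x0(1)])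
      have "modrel (x0 ^ 7) (0 ^ 7)" by (rule ring_rel_power[OF ring_rel_modrel x0(2)])
      then have "modrel (x0 ^ 7) 0" by simp
      then show "modrel (d x0) x0" using dm[OF x0(1)] modrel_trans modrel_sym x0(2) by blast
    qed
    then have "{x \<in> X. d x \<noteq> x} = X - {x0}"
      using fix0 incong x0 modrel_trans modrel_sym by blast
    moreover have "3 dvd card {x \<in> X. d x \<noteq> x}"
      using no dX by (intro prime_dvd_card_moved(2)[OF _ finite_roots]) auto
    ultimately show False using x0 finite_roots card_roots by simp
  qed
  moreover have "x = y" if "x \<in> X" "y \<in> X" "d x = x" "d y = y" for x y
    using incong fix0 that modrel_trans modrel_sym by blast
  ultimately show ?thesis using d(1) by blast
qed

theorem radical_roots_unique:
  assumes "x \<in> X" "y \<in> X" "x \<in> radical_computable" "y \<in> radical_computable"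
  shows "x = y"
proof -
  obtain b x7 where b: "b \<in> alg_auts" "\<And>x. x \<in> X \<Longrightarrow> (b ^^ 7) x = x" "b x7 \<noteq> x7" "x7 \<in> X"
    using seven_cycle by blast
  obtain d x5 where d: "d \<in> alg_auts" "\<And>x. x \<in> X \<Longrightarrow> (d ^^ 15) x = x"
    "\<And>x y. x \<in> X \<Longrightarrow> y \<in> X \<Longrightarrow> d x = x \<Longrightarrow> d y = y \<Longrightarrow> x = y"
    "(d ^^ 3) x5 \<noteq> x5" "x5 \<in> X"
    using fifteen_cycle by blast
  obtain nx where nx: "\<And>s. s \<in> derived_series alg_auts nx \<Longrightarrow> s x = x"
    using radical_computable_fixed[OF assms(3)] by blast
  obtain ny where ny: "\<And>s. s \<in> derived_series alg_auts ny \<Longrightarrow> s y = y"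
    using radical_computable_fixed[OF assms(4)] by blast
  define n where "n = max nx ny"
  have n: "derived_series alg_auts n \<subseteq> derived_series alg_auts nx" "derived_series alg_auts n \<subseteq> derived_series alg_auts ny"
    unfolding n_def by (auto intro!: derived_series_antimono[OF perm_group_alg_auts])
  show ?thesis
  proof (rule derived_series_fixes_at_most_one[OF perm_group_alg_auts finite_roots card_roots])
    show "s z \<in> X" if "s \<in> alg_auts" "z \<in> X" for s z by (rule alg_auts_roots[OF that])
    show "s x = x" if "s \<in> derived_series alg_auts n" for s using nx n that by blast
    show "s y = y" if "s \<in> derived_series alg_auts n" for s using ny n that by blast
  qed (fact b d assms(1,2))+
qed

end

section \<open>The graph\<close>

text \<open>The matrix \<open>b (L - \<rho> D)\<close> for \<open>\<rho> = 35 a / b\<close> and \<open>b = 35 c + 1\<close>; it is integral and congruent to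
  \<open>L\<close> modulo 35.\<close>

definition scaled_entry :: "int \<Rightarrow> int \<Rightarrow> nat \<Rightarrow> nat \<Rightarrow> int" where
  "scaled_entry a c i j = (35 * c + 1) * lap_entry i j - (if i = j then 35 * a * int (nine_deg i) else 0)"

lemma nine_adj_sym: "nine_adj i j \<longleftrightarrow> nine_adj j i"
  by (auto simp: nine_adj_def)

lemma nine_adj_irrefl: "\<not> nine_adj i i"
  by (auto simp: nine_adj_def nine_edges_def)

lemma scaled_entry_sym: "scaled_entry a c i j = scaled_entry a c j i"
  by (simp add: scaled_entry_def lap_entry_def nine_adj_sym[of i j])

lemma char_poly_scaled_entry:
  fixes a c :: int
  defines "f \<equiv> char_poly (Matrix.mat 9 9 (\<lambda>(i, j). scaled_entry a c i j))"
  shows "lead_coeff f = 1" "degree f = 9" "[:35:] dvd f - lap_poly"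
proof -
  show "lead_coeff f = 1" "degree f = 9"
    using degree_monic_char_poly[of "Matrix.mat 9 9 (\<lambda>(i, j). scaled_entry a c i j)" 9] by (auto simp: f_def)
  show "[:35:] dvd f - lap_poly"
    unfolding f_def char_poly_lap_entry[symmetric]
  proof (rule char_poly_cong[where n = 9])
    fix i j :: nat assume ij: "i < 9" "j < 9"
    have "scaled_entry a c i j - lap_entry i j =
        35 * (c * lap_entry i j - (if i = j then a * int (nine_deg i) else 0))"
      by (simp add: scaled_entry_def algebra_simps)
    then have "35 dvd scaled_entry a c i j - lap_entry i j" by (simp only: dvd_triv_left)
    then show "35 dvd Matrix.mat 9 9 (\<lambda>(i, j). scaled_entry a c i j) $$ (i, j) - Matrix.mat 9 9 (\<lambda>(i, j). lap_entry i j) $$ (i, j)"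
      using ij by simp
  qed auto
qed

lemma radical_sum: "(\<And>i. i \<in> I \<Longrightarrow> f i \<in> radical_computable) \<Longrightarrow> sum f I \<in> radical_computable"
  using radical_computable.int_const[of 0]
  by (induction I rule: infinite_finite_induct) (auto intro: radical_computable.add)

section \<open>Eigenvalues of the relaxed Laplacian, with vertices enumerated as numbers below
  9\<close>

context
  fixes e :: "nat \<Rightarrow> 9" and E :: "9 \<Rightarrow> 9 \<Rightarrow> bool"
  assumes e: "bij_betw e {..<9} UNIV"
    and E: "\<And>i j. i < 9 \<Longrightarrow> j < 9 \<Longrightarrow> E (e i) (e j) \<longleftrightarrow> nine_adj i j"
begin

lemma nine_vertex_cases: obtains i where "i < 9" "x = e i"
proof -
  have "x \<in> e ` {..<9}" using e by (simp add: bij_betw_def)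
  then show ?thesis using that by blast
qed

lemma nine_degree: "i < 9 \<Longrightarrow> card {k. E (e i) k} = nine_deg i"
proof -
  assume i: "i < 9"
  have "{k. E (e i) k} = e ` {j \<in> {..<9}. nine_adj i j}"
  proof (intro equalityI subsetI)
    fix k assume k: "k \<in> {k. E (e i) k}"
    obtain j where j: "j < 9" "k = e j" by (rule nine_vertex_cases)
    then show "k \<in> e ` {j \<in> {..<9}. nine_adj i j}" using k E[OF i j(1)] by auto
  next
    fix k assume "k \<in> e ` {j \<in> {..<9}. nine_adj i j}"
    then obtain j where "j < 9" "nine_adj i j" "k = e j" by blast
    then show "k \<in> {k. E (e i) k}" using E[OF i, of j] by simp
  qed
  moreover have "inj_on e {j \<in> {..<9}. nine_adj i j}"
    using e unfolding bij_betw_def by (auto intro: inj_on_subset)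
  ultimately have "card {k. E (e i) k} = card {j \<in> {..<9}. nine_adj i j}" by (simp add: card_image)
  also have "{j \<in> {..<9}. nine_adj i j} = set (filter (nine_adj i) [0..<9])" by auto
  also have "card \<dots> = nine_deg i" unfolding nine_deg_def by (rule distinct_card) simp
  finally show ?thesis .
qed

lemma relaxed_laplacian_entry:
  fixes a c :: int
  assumes ij: "i < 9" "j < 9" and c: "35 * c + 1 \<noteq> 0"
  defines "rho \<equiv> real_of_int (35 * a) / real_of_int (35 * c + 1)"
  shows "real_of_int (35 * c + 1) * vec_nth (vec_nth (relaxed_laplacian rho E) (e i)) (e j) = real_of_int (scaled_entry a c i j)"
proof -
  have eq: "e i = e j \<longleftrightarrow> i = j" using e ij unfolding bij_betw_def by (auto dest: inj_onD)
  have B: "real_of_int (35 * c + 1) \<noteq> 0" using c by linarith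
  have r: "real_of_int (35 * c + 1) * (rho * t) = real_of_int (35 * a) * t" for t
    using B by (simp add: rho_def)
  have "vec_nth (vec_nth (relaxed_laplacian rho E) (e i)) (e j) =
      (if i = j then real (nine_deg i) else 0) - (if nine_adj i j then 1 else 0) - rho * (if i = j then real (nine_deg i) else 0)"
    using E[OF ij] eq nine_degree[OF ij(1)] nine_degree[OF ij(2)]
    by (simp add: relaxed_laplacian_def laplacian_def degree_matrix_def adjacency_matrix_def)
  then show ?thesis
    by (simp only: right_diff_distrib r) (simp add: scaled_entry_def lap_entry_def algebra_simps)
qed

lemma not_drawable:
  fixes a c :: int
  assumes c: "35 * c + 1 > 0"
  defines "rho \<equiv> real_of_int (35 * a) / real_of_int (35 * c + 1)"
  shows "\<not> radical_spectral_drawable (relaxed_laplacian rho E)"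
proof
  assume "radical_spectral_drawable (relaxed_laplacian rho E)"
  then obtain pp where pp: "spectral_drawing (relaxed_laplacian rho E) pp"
    "\<And>v. complex_of_real (fst (pp v)) \<in> radical_computable" "\<And>v. complex_of_real (snd (pp v)) \<in> radical_computable"
    unfolding radical_spectral_drawable_def by blast
  then obtain u :: "nat \<Rightarrow> real^9" and lam :: "nat \<Rightarrow> real" and r s where
    eig: "\<And>i. i < 9 \<Longrightarrow> relaxed_laplacian rho E *v u i = lam i *s u i"
    and inj_u: "inj_on u {..<9}" and ind: "independent (u ` {..<9})"
    and rs: "r < 9" "s < 9" "r \<noteq> s" and ppv: "\<And>v. pp v = (vec_nth (u r) v, vec_nth (u s) v)"
    unfolding spectral_drawing_def by auto
  define B where "B = real_of_int (35 * c + 1)"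
  have B: "B \<noteq> 0" using c unfolding B_def by linarith
  define mu where "mu = (\<lambda>i. complex_of_real (B * lam i))"
  define f where "f = char_poly (Matrix.mat 9 9 (\<lambda>(i, j). scaled_entry a c i j))"
  define X where "X = {x :: complex. poly (of_int_poly f) x = 0}"
  have X_iff: "x \<in> X \<longleftrightarrow>
    (\<exists>w. (\<exists>i<9. w i \<noteq> 0) \<and> (\<forall>i<9. (\<Sum>j<9. of_int (scaled_entry a c i j) * w j) = x * w i))" for x
    unfolding X_def f_def mem_Collect_eq
    by (subst root_char_poly_iff[of _ 9]) simp_all
  define U where "U = (\<lambda>i j. complex_of_real (vec_nth (u i) (e j)))"
  have sum_e: "(\<Sum>y\<in>UNIV. g y) = (\<Sum>j<9. g (e j))" for g :: "9 \<Rightarrow> 'b::comm_monoid_add"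
    using sum.reindex_bij_betw[OF e, of g] by simp
  have eigU: "(\<Sum>k<9. of_int (scaled_entry a c j k) * U i k) = mu i * U i j" if i: "i < 9" and j: "j < 9" for i j
  proof -
    have "(\<Sum>k<9. vec_nth (vec_nth (relaxed_laplacian rho E) (e j)) (e k) * vec_nth (u i) (e k)) = lam i * vec_nth (u i) (e j)"
      using arg_cong[OF eig[OF i], of "\<lambda>v. vec_nth v (e j)"] by (simp add: matrix_vector_mult_def sum_e)
    then have "B * (\<Sum>k<9. vec_nth (vec_nth (relaxed_laplacian rho E) (e j)) (e k) * vec_nth (u i) (e k)) = B * lam i * vec_nth (u i) (e j)"
      by simp
    moreover have "B * (\<Sum>k<9. vec_nth (vec_nth (relaxed_laplacian rho E) (e j)) (e k) * vec_nth (u i) (e k)) =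
       (\<Sum>k<9. real_of_int (scaled_entry a c j k) * vec_nth (u i) (e k))"
      unfolding sum_distrib_left mult.assoc[symmetric]
    proof (rule sum.cong)
      fix k :: nat assume "k \<in> {..<9}"
      then show "B * vec_nth (vec_nth (relaxed_laplacian rho E) (e j)) (e k) * vec_nth (u i) (e k) =
          real_of_int (scaled_entry a c j k) * vec_nth (u i) (e k)"
        using relaxed_laplacian_entry[OF j, of k c a] c unfolding B_def rho_def by simp
    qed simp
    ultimately have "(\<Sum>k<9. real_of_int (scaled_entry a c j k) * vec_nth (u i) (e k)) = B * lam i * vec_nth (u i) (e j)"
      by simp
    from arg_cong[OF this, of complex_of_real] show ?thesis by (simp add: U_def mu_def)
  qed
  have nz: "\<exists>j<9. U i j \<noteq> 0" if i: "i < 9" for i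
  proof (rule ccontr)
    assume no: "\<not> ?thesis"
    have "u i = 0"
      unfolding Finite_Cartesian_Product.vec_eq_iff
    proof
      fix y
      obtain j where "j < 9" "y = e j" by (rule nine_vertex_cases)
      then show "vec_nth (u i) y = vec_nth 0 y" using no by (simp add: U_def)
    qed
    moreover have "u i \<in> u ` {..<9}" using i by blast
    ultimately show False using ind dependent_zero by metis
  qed
  have muX: "mu i \<in> X" if i: "i < 9" for i
    unfolding X_iff using nz[OF i] eigU[OF i] by (intro exI[of _ "U i"]) simp
  \<comment> \<open>By symmetry of the matrix, an eigenvector for any other value \<open>x\<close>
    has zero bilinear pairing with all \<open>u i\<close>. As these span the space, it would be
    0.\<close>
  have Xmu: "\<exists>i<9. x = mu i" if x: "x \<in> X" for x
  proof (rule ccontr)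
    assume no: "\<not> ?thesis"
    obtain w i0 where w: "i0 < 9" "w i0 \<noteq> 0" "\<And>i. i < 9 \<Longrightarrow> (\<Sum>j<9. of_int (scaled_entry a c i j) * w j) = x * w i"
      using x unfolding X_iff by blast
    have t0: "(\<Sum>j<9. U i j * w j) = 0" if i: "i < 9" for i
    proof -
      have "mu i * (\<Sum>j<9. U i j * w j) = (\<Sum>j<9. (mu i * U i j) * w j)"
        by (simp add: sum_distrib_left mult.assoc)
      also have "\<dots> = (\<Sum>j<9. (\<Sum>k<9. of_int (scaled_entry a c j k) * U i k) * w j)"
        using eigU[OF i] by (intro sum.cong) auto
      also have "\<dots> = (\<Sum>j<9. \<Sum>k<9. of_int (scaled_entry a c j k) * U i k * w j)"
        by (simp add: sum_distrib_right)
      also have "\<dots> = (\<Sum>k<9. \<Sum>j<9. of_int (scaled_entry a c j k) * U i k * w j)"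
        by (rule sum.swap)
      also have "\<dots> = (\<Sum>k<9. U i k * (\<Sum>j<9. of_int (scaled_entry a c k j) * w j))"
      proof (rule sum.cong)
        fix k :: nat
        show "(\<Sum>j<9. of_int (scaled_entry a c j k) * U i k * w j) = U i k * (\<Sum>j<9. of_int (scaled_entry a c k j) * w j)"
          unfolding sum_distrib_left by (intro sum.cong) (auto simp: scaled_entry_sym[of a c k] mult_ac)
      qed simp
      also have "\<dots> = (\<Sum>k<9. U i k * (x * w k))" using w(3) by (intro sum.cong) auto
      also have "\<dots> = x * (\<Sum>j<9. U i j * w j)" by (simp add: sum_distrib_left mult_ac)
      finally have "(mu i - x) * (\<Sum>j<9. U i j * w j) = 0" by (simp add: left_diff_distrib)
      then show ?thesis using no i by auto
    qed
    have span: "span (u ` {..<9}) = UNIV"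
    proof -
      have "card (u ` {..<9}) = DIM(real^9)" using inj_u by (simp add: card_image)
      then show ?thesis using card_ge_dim_independent[of "u ` {..<9}" UNIV] ind by auto
    qed
    have orth0: "z = 0" if z: "\<And>i. i < 9 \<Longrightarrow> inner (u i) z = 0" for z :: "real^9"
    proof -
      have "Linear_Algebra.orthogonal z z"
        by (rule orthogonal_to_span[of z "u ` {..<9}" z]) (use span z in \<open>auto simp: Linear_Algebra.orthogonal_def inner_commute\<close>)
      then show ?thesis by (simp add: Linear_Algebra.orthogonal_self)
    qed
    define idx where "idx = the_inv_into {..<9} e"
    have idx: "idx (e j) = j" if "j < 9" for j
      unfolding idx_def using e that by (intro the_inv_into_f_f) (auto simp: bij_betw_def)
    \<comment> \<open>The \<open>u i\<close> span over the reals, so the complex vector is split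
      into real and imaginary part.\<close>
    define wr :: "real^9" where "wr = (\<chi> y. Re (w (idx y)))"
    define wi :: "real^9" where "wi = (\<chi> y. Im (w (idx y)))"
    have "wr = 0"
    proof (rule orth0)
      fix i :: nat assume i: "i < 9"
      have "inner (u i) wr = (\<Sum>j<9. Re (U i j * w j))"
        unfolding inner_vec_def sum_e by (intro sum.cong) (auto simp: wr_def U_def idx)
      then show "inner (u i) wr = 0" using arg_cong[OF t0[OF i], of Re] by simp
    qed
    moreover have "wi = 0"
    proof (rule orth0)
      fix i :: nat assume i: "i < 9"
      have "inner (u i) wi = (\<Sum>j<9. Im (U i j * w j))"
        unfolding inner_vec_def sum_e by (intro sum.cong) (auto simp: wi_def U_def idx)
      then show "inner (u i) wi = 0" using arg_cong[OF t0[OF i], of Im] by simp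
    qed
    ultimately have "vec_nth wr (e i0) = 0" "vec_nth wi (e i0) = 0" by auto
    then have "w i0 = 0" using idx[OF w(1)] by (simp add: wr_def wi_def complex_eq_iff)
    then show False using w(2) by simp
  qed
  note cp = char_poly_scaled_entry[of a c, folded f_def]
  have "X = mu ` {..<9}" using muX Xmu by auto
  moreover have "card X = 9" using card_roots[OF cp] unfolding X_def .
  \<comment> \<open>Nine indices cover nine roots, so eigenvalues with different indices
    differ.\<close>
  ultimately have "inj_on mu {..<9}" by (intro eq_card_imp_inj_on) auto
  then have "mu r \<noteq> mu s" using rs by (auto dest: inj_onD)
  \<comment> \<open>The scaled matrix has integer entries, so the eigenvalue is an integer
    combination of the coordinates divided by a nonzero coordinate.\<close>
  have rad: "mu i \<in> radical_computable"
    if i: "i < 9" and ui: "\<And>v. complex_of_real (vec_nth (u i) v) \<in> radical_computable" for i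
  proof -
    have Ui: "U i j \<in> radical_computable" for j using ui by (simp add: U_def)
    obtain j where j: "j < 9" "U i j \<noteq> 0" using nz[OF i] by blast
    have "(\<Sum>k<9. of_int (scaled_entry a c j k) * U i k) / U i j \<in> radical_computable"
      using Ui j(2) by (intro radical_computable.divide radical_sum radical_computable.mult radical_computable.int_const)
    then show ?thesis using eigU[OF i j(1)] j(2) by simp
  qed
  have "mu r \<in> radical_computable" "mu s \<in> radical_computable"
    using rad[OF rs(1)] rad[OF rs(2)] pp(2,3) ppv by auto
  then have "mu r = mu s"
    using radical_roots_unique[OF cp, of "mu r" "mu s"] muX[OF rs(1)] muX[OF rs(2)] unfolding X_def by blast
  with \<open>mu r \<noteq> mu s\<close> show False by blast
qed

end

theorem theorem6:
  shows "\<exists>E :: 9 \<Rightarrow> 9 \<Rightarrow> bool. simple_graph E \<and>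
           \<not> radical_spectral_drawable (laplacian E) \<and>
           (\<exists>A :: real set. A \<subseteq> \<rat> \<and>
              (\<forall>a b. a < b \<longrightarrow> (\<exists>x\<in>A. a < x \<and> x < b)) \<and>
              (\<forall>rho\<in>A. \<not> radical_spectral_drawable (relaxed_laplacian rho E)))"
proof -
  obtain e :: "nat \<Rightarrow> 9" where "bij_betw e {0..<card (UNIV :: 9 set)} UNIV"
    using ex_bij_betw_nat_finite[of "UNIV :: 9 set"] by auto
  then have e: "bij_betw e {..<9} UNIV" by (simp add: atLeast0LessThan)
  define idx where "idx = the_inv_into {..<9} e"
  define E where "E = (\<lambda>x y. nine_adj (idx x) (idx y))"
  have idx: "idx (e j) = j" if "j < 9" for j
    unfolding idx_def using e that by (intro the_inv_into_f_f) (auto simp: bij_betw_def)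
  have E: "E (e i) (e j) \<longleftrightarrow> nine_adj i j" if "i < 9" "j < 9" for i j
    using that by (simp add: E_def idx)
  define A where "A = {real_of_int (35 * a) / real_of_int (35 * c + 1) | a c. 35 * c + 1 > 0}"
  have not_A: "\<not> radical_spectral_drawable (relaxed_laplacian rho E)" if "rho \<in> A" for rho
    using that not_drawable[OF e E] unfolding A_def by blast
  \<comment> \<open>The choice \<open>a = c = 0\<close> turns the relaxed Laplacian into the
    Laplacian itself.\<close>
  have "0 \<in> A" unfolding A_def by (auto intro!: exI[of _ 0])
  then have "\<not> radical_spectral_drawable (laplacian E)"
    using not_A[of 0] by (simp add: relaxed_laplacian_def)
  moreover have "simple_graph E"
    unfolding simple_graph_def E_def using nine_adj_sym nine_adj_irrefl by blast
  moreover have "A \<subseteq> \<rat>" unfolding A_def by auto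
  moreover have "\<exists>z\<in>A. x < z \<and> z < y" if xy: "x < y" for x y :: real
  proof -
    \<comment> \<open>For this \<open>n\<close> the multiples of \<open>35 / B\<close> form a grid
      finer than the interval, and \<open>a\<close> marks the first grid point strictly beyond
      \<open>x\<close>.\<close>
    obtain n :: nat where n: "real n > 35 / (y - x)" using reals_Archimedean2 by blast
    define B where "B = real_of_int (35 * int n + 1)"
    define a where "a = \<lfloor>x * B / 35\<rfloor> + 1"
    have B: "B > 0" "B > real n" unfolding B_def by linarith+
    have "35 / (y - x) < B" using n B by linarith
    then have By: "35 < B * (y - x)" using xy by (simp add: field_simps)
    have "x * B / 35 < real_of_int a" "real_of_int a \<le> x * B / 35 + 1" unfolding a_def by linarith+
    then have "x * B < 35 * real_of_int a" "35 * real_of_int a < y * B"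
      using By by (auto simp: algebra_simps)
    then have "x < real_of_int (35 * a) / B" "real_of_int (35 * a) / B < y"
      using B(1) by (auto simp: field_simps)
    moreover have "real_of_int (35 * a) / B \<in> A"
      unfolding A_def B_def by (intro CollectI exI[of _ a] exI[of _ "int n"]) auto
    ultimately show ?thesis by blast
  qed
  ultimately show ?thesis using not_A by blast
qed

end
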